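(* Let $X$ be a finite biquandle, let $S\subseteq \mathrm{End}(X)$, and let $N\ge 1$ be an integer. Then for all $n\ge 0$ (and all $N\ge 1$) the $n$-th $N$-directed clique homology group $H_n^{(N)}(L;X,S)$ is an invariant of links; that is, if $L_1$ and $L_2$ are virtually equivalent oriented virtual link diagrams, then $$H_n^{(N)}(L_1;X,S)\cong H_n^{(N)}(L_2;X,S).$$
   Context: **Links.** A virtual link diagram is an immersion of finitely many circles in the plane with finitely many transversal double points, each being either a classical crossing (with over/under information) or a virtual crossing (no over/under information). Diagrams are oriented. "Link" means oriented virtual link: an equivalence class of oriented virtual link diagrams under virtual equivalence, i.e. planar isotopy and the generalized Reidemeister moves: the classical Reidemeister moves R1, R2, R3 (on classical crossings), the virtual Reidemeister moves (the analogues of R1, R2, R3 with all crossings virtual), and the mixed move (an arc having two consecutive virtual crossings is moved across a classical crossing). A semi-arc is a segment of the diagram between two consecutive classical crossings (it may pass through virtual crossings; a component with no classical crossing is one semi-arc). **Biquandles.** A biquandle is a set $X$ with operations $\underline{\triangleright},\overline{\triangleright}:X\times X\to X$ such that for all $x,y,z\in X$: (1) $x\,\underline{\triangleright}\,x=x\,\overline{\triangleright}\,x$; (2) the maps $\alpha_y(x)=x\,\overline{\triangleright}\,y$, $\beta_y(x)=x\,\underline{\triangleright}\,y$ on $X$ and $S(x,y)=(y\,\overline{\triangleright}\,x,\;x\,\underline{\triangleright}\,y)$ on $X\times X$ are invertible; (3) $(x\underline{\triangleright}y)\underline{\triangleright}(z\underline{\triangleright}y)=(x\underline{\triangleright}z)\underline{\triangleright}(y\overline{\triangleright}z)$,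 $(x\underline{\triangleright}y)\overline{\triangleright}(z\underline{\triangleright}y)=(x\overline{\triangleright}z)\underline{\triangleright}(y\overline{\triangleright}z)$, $(x\overline{\triangleright}y)\overline{\triangleright}(z\overline{\triangleright}y)=(x\overline{\triangleright}z)\overline{\triangleright}(y\underline{\triangleright}z)$. $\mathrm{End}(X)$ is the set of maps $X\to X$ preserving both operations. **Colorings.** An $X$-coloring of a diagram $L$ is a labeling $f$ of the semi-arcs of $L$ by elements of $X$ such that at each classical crossing: if $x$ is the label of the semi-arc of the under-strand lying to the right of the (oriented) over-strand, and $y$ is the label of the semi-arc of the over-strand lying to the right of the (oriented) under-strand, then the other semi-arc of the under-strand (to the left of the over-strand) is labeled $x\,\underline{\triangleright}\,y$ and the other semi-arc of the over-strand (to the left of the under-strand) is labeled $y\,\overline{\triangleright}\,x$. Labels do not change at virtual crossings. $\mathrm{Col}_X(L)$ is the set of $X$-colorings. For $\alpha\in\mathrm{End}(X)$ and $f\in\mathrm{Col}_X(L)$, $\alpha\circ f\in \mathrm{Col}_X(L)$. **Coloring quiver.** A quiver is a directed graph, possibly with loops and multiple edges; $e_{\mathcal Q}(u,v)$ is the number of edges from $u$ to $v$ in $\mathcal Q$. For $S\subseteq\mathrm{End}(X)$, the $X$-coloring quiver $\mathcal Q_X^S(L)$ has vertex set $\{v_f: f\in\mathrm{Col}_X(L)\}$ and, for each $f$ and each $\alpha\in S$, one edge $v_f\to v_{\alpha\circ f}$; thus $e(v_f,v_g)=|\{\alpha\in S:\alpha\circ f=g\}|$. **$N$-directed clique homology.**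 For a finite quiver $\mathcal Q$ with vertex set $V$ and $N\ge1$, the $N$-directed clique complex $\mathcal K^{(N)}(\mathcal Q)$ is the abstract ordered simplicial complex (collection of finite lists of distinct vertices closed under taking sublists) with $K_0^{(N)}(\mathcal Q)=\{(v):v\in V\}$ and, for $n>0$, $K_n^{(N)}(\mathcal Q)=\{(v_0,\dots,v_n): v_i\ne v_j \text{ and } e_{\mathcal Q}(v_i,v_j)\ge N\text{ for all } i<j\}$. Its chain group $C_n$ is the free abelian group on $K_n^{(N)}(\mathcal Q)$, with $\partial_n(v_0,\dots,v_n)=\sum_{i=0}^n(-1)^i(v_0,\dots,\widehat{v_i},\dots,v_n)$ (and $\partial_0=0$), and $H_n^{(N)}(\mathcal Q)=\ker\partial_n/\operatorname{im}\partial_{n+1}$. Define $H_n^{(N)}(L;X,S):=H_n^{(N)}(\mathcal Q_X^S(L))$. *)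

theory Defs
  imports
    "HOL-Analysis.Analysis"
    "HOL-Algebra.Free_Abelian_Groups"
    "Graph_Theory.Digraph"
begin

section \<open>Virtual link diagrams\<close>

text \<open>
  The plane is \<^typ>\<open>complex\<close>. A diagram has \<open>ncircles\<close> components; component \<open>i\<close> is the
  curve \<open>curve i\<close> on the unit circle, oriented counterclockwise. The points of the source of the
  immersion are the pairs \<open>(i, z)\<close> with \<open>i < ncircles\<close> and \<open>z\<close> on the unit circle. A pair
  \<open>(p, q)\<close> of \<open>over_under\<close> is a classical crossing at which the branch through \<open>p\<close> passes over the
  branch through \<open>q\<close>; the remaining double points are the virtual crossings. Immersions and
  isotopies are continuously differentiable.
\<close>

type_synonym source_point = "nat \<times> complex"

record vdiagram =
  ncircles :: nat
  curve :: "nat \<Rightarrow> complex \<Rightarrow> complex"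
  over_under :: "(source_point \<times> source_point) set"

definition source :: "vdiagram \<Rightarrow> source_point set" where
  "source D = {..<ncircles D} \<times> sphere 0 1"

definition image_pt :: "vdiagram \<Rightarrow> source_point \<Rightarrow> complex" where
  "image_pt D p = curve D (fst p) (snd p)"

definition velocity :: "vdiagram \<Rightarrow> source_point \<Rightarrow> complex" where
  "velocity D p = vector_derivative (\<lambda>t. curve D (fst p) (snd p * cis t)) (at 0)"

definition double_points :: "vdiagram \<Rightarrow> (source_point \<times> source_point) set" where
  "double_points D =
     {(p, q). p \<in> source D \<and> q \<in> source D \<and> p \<noteq> q \<and> image_pt D p = image_pt D q}"

definition classical_at :: "vdiagram \<Rightarrow> source_point \<Rightarrow> source_point \<Rightarrow> bool" where
  "classical_at D p q \<longleftrightarrow> (p, q) \<in> over_under D \<or> (q, p) \<in> over_under D"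

text \<open>
  \<open>Im (cnj v * w)\<close> is the determinant of the pair \<open>(v, w)\<close>: the value below is \<open>1\<close> if the
  branch through \<open>q\<close> crosses the branch through \<open>p\<close> from its right to its left, and \<open>-1\<close> if it
  crosses from left to right.
\<close>

definition crossing_direction :: "vdiagram \<Rightarrow> source_point \<Rightarrow> source_point \<Rightarrow> real" where
  "crossing_direction D p q = sgn (Im (cnj (velocity D p) * velocity D q))"

definition is_vdiagram :: "vdiagram \<Rightarrow> bool" where
  "is_vdiagram D \<longleftrightarrow>
     (\<forall>i<ncircles D. (\<lambda>t. curve D i (cis t)) C1_differentiable_on UNIV) \<and>
     (\<forall>p\<in>source D. velocity D p \<noteq> 0) \<and>
     finite (double_points D) \<and>
     (\<forall>p q. (p, q) \<in> double_points D \<longrightarrow> crossing_direction D p q \<noteq> 0) \<and>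
     (\<forall>p q r. (p, q) \<in> double_points D \<longrightarrow> (p, r) \<in> double_points D \<longrightarrow> q = r) \<and>
     over_under D \<subseteq> double_points D \<and>
     (\<forall>p q. (p, q) \<in> over_under D \<longrightarrow> (q, p) \<notin> over_under D)"

subsection \<open>Semi-arcs\<close>

definition cut_points :: "vdiagram \<Rightarrow> nat \<Rightarrow> complex set" where
  "cut_points D i = {z. \<exists>q. classical_at D (i, z) q}"

definition semiarcs :: "vdiagram \<Rightarrow> source_point set set" where
  "semiarcs D = {{i} \<times> C | i C. i < ncircles D \<and> C \<in> components (sphere 0 1 - cut_points D i)}"

definition semiarc_after :: "vdiagram \<Rightarrow> source_point \<Rightarrow> source_point set" where
  "semiarc_after D p =
     (THE A. A \<in> semiarcs D \<and> (\<forall>\<^sub>F e in at_right 0. (fst p, snd p * cis e) \<in> A))"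

definition semiarc_before :: "vdiagram \<Rightarrow> source_point \<Rightarrow> source_point set" where
  "semiarc_before D p =
     (THE A. A \<in> semiarcs D \<and> (\<forall>\<^sub>F e in at_right 0. (fst p, snd p * cis (- e)) \<in> A))"

text \<open>
  At the crossing of the branches through \<open>p\<close> and \<open>q\<close>: the semi-arc of the branch through \<open>p\<close>
  lying to the right, respectively to the left, of the oriented branch through \<open>q\<close>.
\<close>

definition semiarc_right_of :: "vdiagram \<Rightarrow> source_point \<Rightarrow> source_point \<Rightarrow> source_point set" where
  "semiarc_right_of D p q =
     (if crossing_direction D q p > 0 then semiarc_before D p else semiarc_after D p)"

definition semiarc_left_of :: "vdiagram \<Rightarrow> source_point \<Rightarrow> source_point \<Rightarrow> source_point set" where
  "semiarc_left_of D p q =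
     (if crossing_direction D q p > 0 then semiarc_after D p else semiarc_before D p)"

section \<open>Virtual equivalence\<close>

subsection \<open>Planar isotopy\<close>

definition ambient_isotopy :: "(real \<Rightarrow> complex \<Rightarrow> complex) \<Rightarrow> bool" where
  "ambient_isotopy H \<longleftrightarrow>
     (\<forall>z. H 0 z = z) \<and>
     continuous_on ({0..1} \<times> UNIV) (\<lambda>(t, z). H t z) \<and>
     (\<forall>t\<in>{0..1}. bij (H t)) \<and>
     (\<exists>H'. (\<forall>t\<in>{0..1}. \<forall>z. (H t has_derivative H' t z) (at z) \<and> inj (H' t z)) \<and>
           (\<forall>v. continuous_on ({0..1} \<times> UNIV) (\<lambda>(t, z). H' t z v)))"

definition planar_isotopic :: "vdiagram \<Rightarrow> vdiagram \<Rightarrow> bool" where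
  "planar_isotopic D D' \<longleftrightarrow>
     (\<exists>H. ambient_isotopy H \<and> ncircles D' = ncircles D \<and>
          (\<forall>p\<in>source D. image_pt D' p = H 1 (image_pt D p)) \<and>
          over_under D' = over_under D)"

text \<open>
  The numbering of the components and their oriented parametrisations are not part of a diagram.
  The map \<open>\<phi> i\<close> is a lift to the reals of an orientation preserving diffeomorphism of the circle.
\<close>

definition reparametrised :: "vdiagram \<Rightarrow> vdiagram \<Rightarrow> bool" where
  "reparametrised D D' \<longleftrightarrow>
     (\<exists>\<pi> \<phi>. bij_betw \<pi> {..<ncircles D'} {..<ncircles D} \<and>
        (\<forall>i<ncircles D'.
           \<phi> i C1_differentiable_on UNIV \<and>
           (\<forall>t. vector_derivative (\<phi> i) (at t) > (0::real)) \<and>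
           (\<forall>t. \<phi> i (t + 2 * pi) = \<phi> i t + 2 * pi) \<and>
           (\<forall>t. curve D' i (cis t) = curve D (\<pi> i) (cis (\<phi> i t)))) \<and>
        (\<forall>i<ncircles D'. \<forall>j<ncircles D'. \<forall>s t.
           ((i, cis s), (j, cis t)) \<in> over_under D' \<longleftrightarrow>
           ((\<pi> i, cis (\<phi> i s)), (\<pi> j, cis (\<phi> j t))) \<in> over_under D))"

subsection \<open>Local changes in a disc\<close>

text \<open>
  The strand \<open>(i, a, b)\<close> is the part of component \<open>i\<close> with parameter \<open>cis t\<close>, \<open>a \<le> t \<le> b\<close>.
\<close>

type_synonym strand = "nat \<times> real \<times> real"

definition on_strand :: "strand \<Rightarrow> real \<Rightarrow> source_point" where
  "on_strand \<sigma> t = (fst \<sigma>, cis t)"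

definition params :: "strand \<Rightarrow> real set" where
  "params \<sigma> = {fst (snd \<sigma>)..snd (snd \<sigma>)}"

definition inner_params :: "strand \<Rightarrow> real set" where
  "inner_params \<sigma> = {fst (snd \<sigma>)<..<snd (snd \<sigma>)}"

definition strand_set :: "strand list \<Rightarrow> source_point set" where
  "strand_set \<sigma>s = (\<Union>\<sigma>\<in>set \<sigma>s. on_strand \<sigma> ` params \<sigma>)"

definition strand_interior :: "strand list \<Rightarrow> source_point set" where
  "strand_interior \<sigma>s = (\<Union>\<sigma>\<in>set \<sigma>s. on_strand \<sigma> ` inner_params \<sigma>)"

definition is_strand :: "vdiagram \<Rightarrow> strand \<Rightarrow> bool" where
  "is_strand D \<sigma> \<longleftrightarrow>
     (case \<sigma> of (i, a, b) \<Rightarrow> i < ncircles D \<and> a < b \<and> b < a + 2 * pi)"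

text \<open>
  Both diagrams meet the closed disc \<open>B\<close> exactly in the strands \<open>\<sigma>s\<close>, which run from boundary to
  boundary, and the diagrams coincide outside the interior of \<open>B\<close>.
\<close>

definition disc_change :: "strand list \<Rightarrow> vdiagram \<Rightarrow> vdiagram \<Rightarrow> bool" where
  "disc_change \<sigma>s D D' \<longleftrightarrow>
     ncircles D' = ncircles D \<and>
     (\<forall>\<sigma>\<in>set \<sigma>s. is_strand D \<sigma>) \<and>
     (\<forall>m<length \<sigma>s. \<forall>n<m. disjnt (strand_set [\<sigma>s ! m]) (strand_set [\<sigma>s ! n])) \<and>
     (\<forall>p\<in>source D - strand_interior \<sigma>s. image_pt D' p = image_pt D p) \<and>
     over_under D' - strand_set \<sigma>s \<times> strand_set \<sigma>s = over_under D - strand_set \<sigma>s \<times> strand_set \<sigma>s \<and>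
     (\<exists>B. B homeomorphic (cball 0 1 :: complex set) \<and>
        (\<forall>E\<in>{D, D'}. \<forall>p\<in>source E.
           (image_pt E p \<in> B \<longleftrightarrow> p \<in> strand_set \<sigma>s) \<and>
           (image_pt E p \<in> interior B \<longleftrightarrow> p \<in> strand_interior \<sigma>s)))"

definition double_points_on :: "strand list \<Rightarrow> vdiagram \<Rightarrow> (source_point \<times> source_point) set" where
  "double_points_on \<sigma>s D = double_points D \<inter> strand_set \<sigma>s \<times> strand_set \<sigma>s"

definition symmetrised :: "('b \<times> 'b) set \<Rightarrow> ('b \<times> 'b) set" where
  "symmetrised R = R \<union> R\<inverse>"

subsection \<open>Generalized Reidemeister moves\<close>

text \<open>
  The picture of each move inside the disc is given by its double points, their order along the
  oriented strands, and the direction in which the strands cross. These data determine the picture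
  up to planar isotopy of the disc. The conditions on directions hold in every planar picture with
  the given double points; they are stated because they are part of the picture. Every orientation
  and every choice of crossings allowed by the move is covered. Each move is stated in one direction, the
  inverse being supplied by the equivalence closure below.
\<close>

text \<open>A crossingless strand is replaced by a strand with a single curl.\<close>

definition curl :: "strand \<Rightarrow> real \<Rightarrow> real \<Rightarrow> vdiagram \<Rightarrow> vdiagram \<Rightarrow> bool" where
  "curl \<sigma> s t D D' \<longleftrightarrow>
     disc_change [\<sigma>] D D' \<and> s \<in> inner_params \<sigma> \<and> t \<in> inner_params \<sigma> \<and> s < t \<and>
     double_points_on [\<sigma>] D = {} \<and>
     double_points_on [\<sigma>] D' = symmetrised {(on_strand \<sigma> s, on_strand \<sigma> t)}"

definition classical_R1 :: "vdiagram \<Rightarrow> vdiagram \<Rightarrow> bool" where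
  "classical_R1 D D' \<longleftrightarrow>
     (\<exists>\<sigma> s t. curl \<sigma> s t D D' \<and> classical_at D' (on_strand \<sigma> s) (on_strand \<sigma> t))"

definition virtual_R1 :: "vdiagram \<Rightarrow> vdiagram \<Rightarrow> bool" where
  "virtual_R1 D D' \<longleftrightarrow>
     (\<exists>\<sigma> s t. curl \<sigma> s t D D' \<and> \<not> classical_at D' (on_strand \<sigma> s) (on_strand \<sigma> t))"

text \<open>
  Two disjoint strands are replaced by two strands forming a bigon: \<open>\<tau>\<close> crosses \<open>\<sigma>\<close> to the other
  side and back, so the two crossings have opposite directions; \<open>\<tau>\<close> may traverse them in either
  order.
\<close>

definition bigon :: "strand \<Rightarrow> strand \<Rightarrow> real \<Rightarrow> real \<Rightarrow> real \<Rightarrow> real \<Rightarrow> vdiagram \<Rightarrow> vdiagram \<Rightarrow> bool" where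
  "bigon \<sigma> \<tau> s\<^sub>1 s\<^sub>2 t\<^sub>1 t\<^sub>2 D D' \<longleftrightarrow>
     disc_change [\<sigma>, \<tau>] D D' \<and>
     {s\<^sub>1, s\<^sub>2} \<subseteq> inner_params \<sigma> \<and> {t\<^sub>1, t\<^sub>2} \<subseteq> inner_params \<tau> \<and> s\<^sub>1 < s\<^sub>2 \<and> t\<^sub>1 \<noteq> t\<^sub>2 \<and>
     double_points_on [\<sigma>, \<tau>] D = {} \<and>
     double_points_on [\<sigma>, \<tau>] D' =
       symmetrised {(on_strand \<sigma> s\<^sub>1, on_strand \<tau> t\<^sub>1), (on_strand \<sigma> s\<^sub>2, on_strand \<tau> t\<^sub>2)} \<and>
     crossing_direction D' (on_strand \<sigma> s\<^sub>1) (on_strand \<tau> t\<^sub>1) =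
       - crossing_direction D' (on_strand \<sigma> s\<^sub>2) (on_strand \<tau> t\<^sub>2)"

definition classical_R2 :: "vdiagram \<Rightarrow> vdiagram \<Rightarrow> bool" where
  "classical_R2 D D' \<longleftrightarrow>
     (\<exists>\<sigma> \<tau> s\<^sub>1 s\<^sub>2 t\<^sub>1 t\<^sub>2. bigon \<sigma> \<tau> s\<^sub>1 s\<^sub>2 t\<^sub>1 t\<^sub>2 D D' \<and>
        (on_strand \<sigma> s\<^sub>1, on_strand \<tau> t\<^sub>1) \<in> over_under D' \<and>
        (on_strand \<sigma> s\<^sub>2, on_strand \<tau> t\<^sub>2) \<in> over_under D')"

definition virtual_R2 :: "vdiagram \<Rightarrow> vdiagram \<Rightarrow> bool" where
  "virtual_R2 D D' \<longleftrightarrow>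
     (\<exists>\<sigma> \<tau> s\<^sub>1 s\<^sub>2 t\<^sub>1 t\<^sub>2. bigon \<sigma> \<tau> s\<^sub>1 s\<^sub>2 t\<^sub>1 t\<^sub>2 D D' \<and>
        \<not> classical_at D' (on_strand \<sigma> s\<^sub>1) (on_strand \<tau> t\<^sub>1) \<and>
        \<not> classical_at D' (on_strand \<sigma> s\<^sub>2) (on_strand \<tau> t\<^sub>2))"

text \<open>
  Three pairwise crossing strands \<open>\<sigma> 1, \<sigma> 2, \<sigma> 3\<close> forming a triangle; \<open>s a b\<close> is the parameter on
  \<open>\<sigma> a\<close> of its crossing with \<open>\<sigma> b\<close>. The last three equations describe the arrangement of three
  straight lines with directions \<open>d\<^sub>1, d\<^sub>2, d\<^sub>3\<close>: the triangle closes up as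
  \<open>x\<^sub>1 d\<^sub>1 - x\<^sub>2 d\<^sub>2 + x\<^sub>3 d\<^sub>3 = 0\<close>, where \<open>x\<^sub>1, x\<^sub>2, x\<^sub>3\<close> have the signs of \<open>s 1 3 - s 1 2\<close>,
  \<open>s 2 3 - s 2 1\<close>, \<open>s 3 2 - s 3 1\<close>, so \<open>(x\<^sub>1, x\<^sub>2, x\<^sub>3)\<close> is a multiple of
  \<open>(det d\<^sub>2 d\<^sub>3, det d\<^sub>1 d\<^sub>3, det d\<^sub>1 d\<^sub>2)\<close>. The two values of \<open>\<kappa>\<close> are the two sides of the move.
\<close>

abbreviation strand_crossing ::
    "(nat \<Rightarrow> strand) \<Rightarrow> (nat \<Rightarrow> nat \<Rightarrow> real) \<Rightarrow> nat \<Rightarrow> nat \<Rightarrow> source_point \<times> source_point" where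
  "strand_crossing \<sigma> s a b \<equiv> (on_strand (\<sigma> a) (s a b), on_strand (\<sigma> b) (s b a))"

abbreviation strand_direction ::
    "vdiagram \<Rightarrow> (nat \<Rightarrow> strand) \<Rightarrow> (nat \<Rightarrow> nat \<Rightarrow> real) \<Rightarrow> nat \<Rightarrow> nat \<Rightarrow> real" where
  "strand_direction D \<sigma> s a b \<equiv>
     crossing_direction D (on_strand (\<sigma> a) (s a b)) (on_strand (\<sigma> b) (s b a))"

definition triangle ::
    "real \<Rightarrow> (nat \<Rightarrow> strand) \<Rightarrow> (nat \<Rightarrow> nat \<Rightarrow> real) \<Rightarrow> vdiagram \<Rightarrow> bool" where
  "triangle \<kappa> \<sigma> s D \<longleftrightarrow>
     {s 1 2, s 1 3} \<subseteq> inner_params (\<sigma> 1) \<and>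
     {s 2 1, s 2 3} \<subseteq> inner_params (\<sigma> 2) \<and>
     {s 3 1, s 3 2} \<subseteq> inner_params (\<sigma> 3) \<and>
     double_points_on [\<sigma> 1, \<sigma> 2, \<sigma> 3] D =
       symmetrised {strand_crossing \<sigma> s 1 2, strand_crossing \<sigma> s 1 3, strand_crossing \<sigma> s 2 3} \<and>
     sgn (s 1 3 - s 1 2) = \<kappa> * strand_direction D \<sigma> s 2 3 \<and>
     sgn (s 2 3 - s 2 1) = \<kappa> * strand_direction D \<sigma> s 1 3 \<and>
     sgn (s 3 2 - s 3 1) = \<kappa> * strand_direction D \<sigma> s 1 2"

definition triangle_change ::
    "(nat \<Rightarrow> strand) \<Rightarrow> (nat \<Rightarrow> nat \<Rightarrow> real) \<Rightarrow> (nat \<Rightarrow> nat \<Rightarrow> real) \<Rightarrow> vdiagram \<Rightarrow> vdiagram \<Rightarrow> bool" where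
  "triangle_change \<sigma> s s' D D' \<longleftrightarrow>
     disc_change [\<sigma> 1, \<sigma> 2, \<sigma> 3] D D' \<and>
     (\<exists>\<kappa>\<in>{1, -1}. triangle \<kappa> \<sigma> s D \<and> triangle (- \<kappa>) \<sigma> s' D') \<and>
     strand_direction D' \<sigma> s' 1 2 = strand_direction D \<sigma> s 1 2 \<and>
     strand_direction D' \<sigma> s' 1 3 = strand_direction D \<sigma> s 1 3 \<and>
     strand_direction D' \<sigma> s' 2 3 = strand_direction D \<sigma> s 2 3"

text \<open>Strand 1 is the top one, strand 2 the middle one and strand 3 the bottom one.\<close>

definition classical_R3 :: "vdiagram \<Rightarrow> vdiagram \<Rightarrow> bool" where
  "classical_R3 D D' \<longleftrightarrow>
     (\<exists>\<sigma> s s'. triangle_change \<sigma> s s' D D' \<and>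
        {strand_crossing \<sigma> s 1 2, strand_crossing \<sigma> s 1 3, strand_crossing \<sigma> s 2 3}
          \<subseteq> over_under D \<and>
        {strand_crossing \<sigma> s' 1 2, strand_crossing \<sigma> s' 1 3, strand_crossing \<sigma> s' 2 3}
          \<subseteq> over_under D')"

definition virtual_R3 :: "vdiagram \<Rightarrow> vdiagram \<Rightarrow> bool" where
  "virtual_R3 D D' \<longleftrightarrow>
     (\<exists>\<sigma> s s'. triangle_change \<sigma> s s' D D' \<and>
        (\<forall>(a, b)\<in>{(1, 2), (1, 3), (2, 3)}.
           \<not> classical_at D (on_strand (\<sigma> a) (s a b)) (on_strand (\<sigma> b) (s b a)) \<and>
           \<not> classical_at D' (on_strand (\<sigma> a) (s' a b)) (on_strand (\<sigma> b) (s' b a))))"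

text \<open>Strand 1 is the arc with two virtual crossings, moved across the crossing of 2 over 3.\<close>

definition mixed_move :: "vdiagram \<Rightarrow> vdiagram \<Rightarrow> bool" where
  "mixed_move D D' \<longleftrightarrow>
     (\<exists>\<sigma> s s'. triangle_change \<sigma> s s' D D' \<and>
        strand_crossing \<sigma> s 2 3 \<in> over_under D \<and>
        strand_crossing \<sigma> s' 2 3 \<in> over_under D' \<and>
        (\<forall>(a, b)\<in>{(1, 2), (1, 3)}.
           \<not> classical_at D (on_strand (\<sigma> a) (s a b)) (on_strand (\<sigma> b) (s b a)) \<and>
           \<not> classical_at D' (on_strand (\<sigma> a) (s' a b)) (on_strand (\<sigma> b) (s' b a))))"

definition elementary_move :: "vdiagram \<Rightarrow> vdiagram \<Rightarrow> bool" where
  "elementary_move D D' \<longleftrightarrow>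
     is_vdiagram D \<and> is_vdiagram D' \<and>
     (planar_isotopic D D' \<or> reparametrised D D' \<or>
      classical_R1 D D' \<or> classical_R2 D D' \<or> classical_R3 D D' \<or>
      virtual_R1 D D' \<or> virtual_R2 D D' \<or> virtual_R3 D D' \<or> mixed_move D D')"

definition virtually_equivalent :: "vdiagram \<Rightarrow> vdiagram \<Rightarrow> bool" where
  "virtually_equivalent = equivclp elementary_move"

section \<open>Biquandles and colorings\<close>

locale biquandle =
  fixes X :: "'a set"
    and under_op :: "'a \<Rightarrow> 'a \<Rightarrow> 'a" (infixl \<open>\<triangleright>\<^sub>u\<close> 70)
    and over_op :: "'a \<Rightarrow> 'a \<Rightarrow> 'a" (infixl \<open>\<triangleright>\<^sub>o\<close> 70)
  assumes diagonal: "x \<in> X \<Longrightarrow> x \<triangleright>\<^sub>u x = x \<triangleright>\<^sub>o x"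
    and over_invertible: "y \<in> X \<Longrightarrow> bij_betw (\<lambda>x. x \<triangleright>\<^sub>o y) X X"
    and under_invertible: "y \<in> X \<Longrightarrow> bij_betw (\<lambda>x. x \<triangleright>\<^sub>u y) X X"
    and switch_invertible: "bij_betw (\<lambda>(x, y). (y \<triangleright>\<^sub>o x, x \<triangleright>\<^sub>u y)) (X \<times> X) (X \<times> X)"
    and exchange_uu: "\<lbrakk>x \<in> X; y \<in> X; z \<in> X\<rbrakk> \<Longrightarrow>
      (x \<triangleright>\<^sub>u y) \<triangleright>\<^sub>u (z \<triangleright>\<^sub>u y) = (x \<triangleright>\<^sub>u z) \<triangleright>\<^sub>u (y \<triangleright>\<^sub>o z)"
    and exchange_uo: "\<lbrakk>x \<in> X; y \<in> X; z \<in> X\<rbrakk> \<Longrightarrow>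
      (x \<triangleright>\<^sub>u y) \<triangleright>\<^sub>o (z \<triangleright>\<^sub>u y) = (x \<triangleright>\<^sub>o z) \<triangleright>\<^sub>u (y \<triangleright>\<^sub>o z)"
    and exchange_oo: "\<lbrakk>x \<in> X; y \<in> X; z \<in> X\<rbrakk> \<Longrightarrow>
      (x \<triangleright>\<^sub>o y) \<triangleright>\<^sub>o (z \<triangleright>\<^sub>o y) = (x \<triangleright>\<^sub>o z) \<triangleright>\<^sub>o (y \<triangleright>\<^sub>u z)"

text \<open>Extensional functions, so that distinct elements are distinct maps on \<open>X\<close>.\<close>

definition biquandle_End ::
    "'a set \<Rightarrow> ('a \<Rightarrow> 'a \<Rightarrow> 'a) \<Rightarrow> ('a \<Rightarrow> 'a \<Rightarrow> 'a) \<Rightarrow> ('a \<Rightarrow> 'a) set" where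
  "biquandle_End X under_op over_op =
     {\<alpha> \<in> X \<rightarrow>\<^sub>E X. \<forall>x\<in>X. \<forall>y\<in>X.
        \<alpha> (under_op x y) = under_op (\<alpha> x) (\<alpha> y) \<and> \<alpha> (over_op x y) = over_op (\<alpha> x) (\<alpha> y)}"

definition colorings ::
    "'a set \<Rightarrow> ('a \<Rightarrow> 'a \<Rightarrow> 'a) \<Rightarrow> ('a \<Rightarrow> 'a \<Rightarrow> 'a) \<Rightarrow> vdiagram \<Rightarrow> (source_point set \<Rightarrow> 'a) set" where
  "colorings X under_op over_op D =
     {f \<in> semiarcs D \<rightarrow>\<^sub>E X. \<forall>(p, q)\<in>over_under D.
        let x = f (semiarc_right_of D q p); y = f (semiarc_right_of D p q) in
          f (semiarc_left_of D q p) = under_op x y \<and>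
          f (semiarc_left_of D p q) = over_op y x}"

text \<open>The arc \<open>(f, \<alpha>)\<close> runs from \<open>f\<close> to \<open>\<alpha> \<circ> f\<close>.\<close>

definition coloring_quiver ::
    "'a set \<Rightarrow> ('a \<Rightarrow> 'a \<Rightarrow> 'a) \<Rightarrow> ('a \<Rightarrow> 'a \<Rightarrow> 'a) \<Rightarrow> ('a \<Rightarrow> 'a) set \<Rightarrow> vdiagram \<Rightarrow>
     (source_point set \<Rightarrow> 'a, (source_point set \<Rightarrow> 'a) \<times> ('a \<Rightarrow> 'a)) pre_digraph" where
  "coloring_quiver X under_op over_op S D =
     \<lparr>verts = colorings X under_op over_op D,
      arcs = colorings X under_op over_op D \<times> S,
      tail = fst,
      head = (\<lambda>(f, \<alpha>). compose (semiarcs D) \<alpha> f)\<rparr>"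

section \<open>Directed clique homology\<close>

definition edge_count :: "('v, 'e) pre_digraph \<Rightarrow> 'v \<Rightarrow> 'v \<Rightarrow> nat" where
  "edge_count Q u v = card {e \<in> arcs Q. tail Q e = u \<and> head Q e = v}"

definition clique_simplices :: "nat \<Rightarrow> ('v, 'e) pre_digraph \<Rightarrow> nat \<Rightarrow> 'v list set" where
  "clique_simplices N Q n =
     {vs. length vs = Suc n \<and> set vs \<subseteq> verts Q \<and>
          (\<forall>j<length vs. \<forall>i<j. vs ! i \<noteq> vs ! j \<and> edge_count Q (vs ! i) (vs ! j) \<ge> N)}"

definition clique_chain_group :: "nat \<Rightarrow> ('v, 'e) pre_digraph \<Rightarrow> nat \<Rightarrow> ('v list \<Rightarrow>\<^sub>0 int) monoid" where
  "clique_chain_group N Q n = free_Abelian_group (clique_simplices N Q n)"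

definition omit_vertex :: "nat \<Rightarrow> 'v list \<Rightarrow> 'v list" where
  "omit_vertex i vs = take i vs @ drop (Suc i) vs"

definition clique_boundary :: "nat \<Rightarrow> ('v list \<Rightarrow>\<^sub>0 int) \<Rightarrow> ('v list \<Rightarrow>\<^sub>0 int)" where
  "clique_boundary n c =
     (if n = 0 then 0
      else frag_extend (\<lambda>vs. \<Sum>i\<le>n. frag_cmul ((-1) ^ i) (frag_of (omit_vertex i vs))) c)"

definition clique_cycle_group :: "nat \<Rightarrow> ('v, 'e) pre_digraph \<Rightarrow> nat \<Rightarrow> ('v list \<Rightarrow>\<^sub>0 int) monoid" where
  "clique_cycle_group N Q n =
     subgroup_generated (clique_chain_group N Q n)
       {c \<in> carrier (clique_chain_group N Q n). clique_boundary n c = 0}"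

definition clique_boundaries :: "nat \<Rightarrow> ('v, 'e) pre_digraph \<Rightarrow> nat \<Rightarrow> ('v list \<Rightarrow>\<^sub>0 int) set" where
  "clique_boundaries N Q n = clique_boundary (Suc n) ` carrier (clique_chain_group N Q (Suc n))"

definition clique_homology ::
    "nat \<Rightarrow> ('v, 'e) pre_digraph \<Rightarrow> nat \<Rightarrow> ('v list \<Rightarrow>\<^sub>0 int) set monoid" where
  "clique_homology N Q n = clique_cycle_group N Q n Mod clique_boundaries N Q n"

definition link_homology ::
    "nat \<Rightarrow> 'a set \<Rightarrow> ('a \<Rightarrow> 'a \<Rightarrow> 'a) \<Rightarrow> ('a \<Rightarrow> 'a \<Rightarrow> 'a) \<Rightarrow> ('a \<Rightarrow> 'a) set \<Rightarrow> vdiagram \<Rightarrow> nat \<Rightarrow>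
     ((source_point set \<Rightarrow> 'a) list \<Rightarrow>\<^sub>0 int) set monoid" where
  "link_homology N X under_op over_op S L n =
     clique_homology N (coloring_quiver X under_op over_op S L) n"

end

theory Submission
  imports Defs
begin

text \<open>
  The homology depends only on the coloring quiver up to isomorphism, so it suffices to find, for every
  elementary move, a bijection between the colorings which commutes with all endomorphisms of \<open>X\<close>.
  Where the two diagrams coincide, the bijection leaves the labels unchanged; inside the disc of a move the
  biquandle axioms show that a coloring of the boundary extends to one diagram if and only if it extends to
  the other, and that the extension is unique. By uniqueness the bijection is equivariant. At a
  crossing any label of the under-strand and any label of the over-strand determine the remaining two, which
  gives uniqueness in every case; for the third Reidemeister move the two triangles are the faces of a cube
  around opposite vertices, and the exchange laws say that the labels of the cube are consistent.
\<close>

section \<open>Isomorphic quivers have isomorphic homology\<close>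

text \<open>The obstacle is that semi-arcs are global: one semi-arc may enter and leave the disc
  several times, and a move can split or join semi-arcs, so the colorings of the two diagrams are
  functions on different sets. Recording the labels just before and just after every source point
  makes the coloring condition local: a one-sided germ condition at each parameter and a rule at
  each classical crossing. Labels can then be copied outside the disc and overwritten inside it, and
  only agreement at the ends of the strands has to be checked. Two marks cut each strand into three
  labeled pieces, so a classical or mixed move becomes a finite statement about triples over X. The
  correspondence "equal outside the disc" is a pointwise relation, hence respected by every
  endomorphism. A planar isotopy or a purely virtual move changes only the curves, and the two sets
  of recorded colorings are then equal. Finiteness of X enters with the curl: by the axioms the map
  sending x to its product with itself is injective, and counting makes it surjective.\<close>

lemma FactGroup_cong_iso:
  assumes inj: "inj_on h U" and U: "carrier G \<subseteq> U" "H \<subseteq> U"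
    and closed: "\<And>x y. x \<in> U \<Longrightarrow> y \<in> U \<Longrightarrow> x \<otimes>\<^bsub>G\<^esub> y \<in> U"
    and mult: "\<And>x y. x \<in> U \<Longrightarrow> y \<in> U \<Longrightarrow> h (x \<otimes>\<^bsub>G\<^esub> y) = h x \<otimes>\<^bsub>G'\<^esub> h y"
    and carr: "h ` carrier G = carrier G'" and img: "h ` H = H'"
  shows "G Mod H \<cong> G' Mod H'"
proof -
  \<comment> \<open>U is a common domain of G and H closed under the product. Since h is injective
    and multiplicative on it, taking images is injective on cosets and carries cosets to cosets and
    products of cosets to products.\<close>
  have coset: "h ` (H #>\<^bsub>G\<^esub> a) = H' #>\<^bsub>G'\<^esub> h a" if "a \<in> carrier G" for a
  proof -
    have "h ` (H #>\<^bsub>G\<^esub> a) = (\<Union>x\<in>H. {h (x \<otimes>\<^bsub>G\<^esub> a)})"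
      by (simp add: r_coset_def image_UN)
    also have "\<dots> = (\<Union>x\<in>H. {h x \<otimes>\<^bsub>G'\<^esub> h a})"
    proof (rule SUP_cong)
      fix x assume "x \<in> H"
      then show "{h (x \<otimes>\<^bsub>G\<^esub> a)} = {h x \<otimes>\<^bsub>G'\<^esub> h a}"
        using that U mult[of x a] by blast
    qed simp
    finally show ?thesis
      by (simp add: r_coset_def flip: img)
  qed
  have coset_U: "H #>\<^bsub>G\<^esub> a \<subseteq> U" if "a \<in> carrier G" for a
    using that U closed unfolding r_coset_def by blast
  have set_mult: "h ` (A <#>\<^bsub>G\<^esub> B) = h ` A <#>\<^bsub>G'\<^esub> h ` B" if "A \<subseteq> U" "B \<subseteq> U" for A B
    using that mult unfolding set_mult_def by (auto simp: image_UN subset_iff)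
  have "(`) h \<in> iso (G Mod H) (G' Mod H')"
  proof (rule isoI)
    show "(`) h \<in> hom (G Mod H) (G' Mod H')"
    proof (rule homI)
      fix A assume "A \<in> carrier (G Mod H)"
      then show "h ` A \<in> carrier (G' Mod H')"
        using coset unfolding FactGroup_def RCOSETS_def carr[symmetric] by auto
    next
      fix A B assume "A \<in> carrier (G Mod H)" "B \<in> carrier (G Mod H)"
      then have "A \<subseteq> U" "B \<subseteq> U"
        using coset_U by (auto simp: FactGroup_def RCOSETS_def)
      then show "h ` (A \<otimes>\<^bsub>G Mod H\<^esub> B) = h ` A \<otimes>\<^bsub>G' Mod H'\<^esub> h ` B"
        using set_mult by (simp add: FactGroup_def)
    qed
    have "inj_on ((`) h) (carrier (G Mod H))"
    proof (rule inj_onI)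
      fix A B assume AB: "A \<in> carrier (G Mod H)" "B \<in> carrier (G Mod H)" "h ` A = h ` B"
      then have "A \<subseteq> U" "B \<subseteq> U"
        using coset_U by (auto simp: FactGroup_def RCOSETS_def)
      then show "A = B"
        using AB(3) inj by (simp add: inj_on_image_eq_iff)
    qed
    moreover have "(`) h ` carrier (G Mod H) = carrier (G' Mod H')"
      using coset unfolding FactGroup_def RCOSETS_def carr[symmetric] by (auto simp: image_UN)
    ultimately show "bij_betw ((`) h) (carrier (G Mod H)) (carrier (G' Mod H'))"
      by (simp add: bij_betw_def)
  qed
  then show ?thesis
    unfolding is_iso_def by blast
qed

section \<open>Chains, cycles and induced chain maps\<close>

lemma clique_boundary_add: "clique_boundary n (a + b) = clique_boundary n a + clique_boundary n b"
  by (simp add: clique_boundary_def frag_extend_add)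

lemma clique_boundary_minus: "clique_boundary n (- a) = - clique_boundary n a"
  by (simp add: clique_boundary_def frag_extend_minus)

lemma carrier_clique_chain_group:
  "c \<in> carrier (clique_chain_group N Q n) \<longleftrightarrow> Poly_Mapping.keys c \<subseteq> clique_simplices N Q n"
  by (simp add: clique_chain_group_def)

text \<open>The cycle group is declared as a generated subgroup; since the boundary is additive the
  cycles already form a subgroup, and generating adds nothing.\<close>

lemma carrier_clique_cycle_group:
  "carrier (clique_cycle_group N Q n) =
     {c. Poly_Mapping.keys c \<subseteq> clique_simplices N Q n \<and> clique_boundary n c = 0}"
proof -
  have "subgroup {c \<in> carrier (clique_chain_group N Q n). clique_boundary n c = 0}
          (clique_chain_group N Q n)"
  proof (rule group.subgroupI)
    show "group (clique_chain_group N Q n)"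
      by (simp add: clique_chain_group_def)
    show "{c \<in> carrier (clique_chain_group N Q n). clique_boundary n c = 0} \<noteq> {}"
      by (auto simp: clique_chain_group_def clique_boundary_def intro!: exI[of _ 0])
  next
    fix a b
    assume "a \<in> {c \<in> carrier (clique_chain_group N Q n). clique_boundary n c = 0}"
      "b \<in> {c \<in> carrier (clique_chain_group N Q n). clique_boundary n c = 0}"
    then show "a \<otimes>\<^bsub>clique_chain_group N Q n\<^esub> b
        \<in> {c \<in> carrier (clique_chain_group N Q n). clique_boundary n c = 0}"
      using keys_add[of a b] by (auto simp: clique_chain_group_def clique_boundary_add)
  qed (auto simp: clique_chain_group_def clique_boundary_minus)
  from subgroup.carrier_subgroup_generated_subgroup[OF this] show ?thesis
    by (auto simp: clique_cycle_group_def carrier_clique_chain_group)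
qed

lemma mult_clique_cycle_group: "x \<otimes>\<^bsub>clique_cycle_group N Q n\<^esub> y = x + y"
  by (simp add: clique_cycle_group_def clique_chain_group_def subgroup_generated_def)

definition chain_map :: "('v \<Rightarrow> 'w) \<Rightarrow> ('v list \<Rightarrow>\<^sub>0 int) \<Rightarrow> ('w list \<Rightarrow>\<^sub>0 int)" where
  "chain_map \<phi> = frag_extend (frag_of \<circ> map \<phi>)"

lemma keys_chain_map: "Poly_Mapping.keys (chain_map \<phi> c) \<subseteq> map \<phi> ` Poly_Mapping.keys c"
  using keys_frag_extend[of "frag_of \<circ> map \<phi>" c] by (auto simp: chain_map_def)

lemma chain_map_add: "chain_map \<phi> (a + b) = chain_map \<phi> a + chain_map \<phi> b"
  by (simp add: chain_map_def frag_extend_add)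

text \<open>The hypothesis speaks of the vertices occurring in c because the vertex maps to which it
  is applied invert each other on the vertex sets.\<close>

lemma chain_map_inverse:
  assumes "\<And>vs v. vs \<in> Poly_Mapping.keys c \<Longrightarrow> v \<in> set vs \<Longrightarrow> \<psi> (\<phi> v) = v"
  shows "chain_map \<psi> (chain_map \<phi> c) = c"
proof -
  have "chain_map \<psi> (chain_map \<phi> c) = frag_extend ((frag_of \<circ> map \<psi>) \<circ> map \<phi>) c"
    by (simp add: chain_map_def frag_extend_compose)
  also have "\<dots> = frag_extend frag_of c"
    by (rule frag_extend_eq) (auto simp: assms intro!: arg_cong[where f = frag_of] map_idI)
  finally show ?thesis
    by (simp flip: frag_expansion)
qed

text \<open>Deleting the i-th entry of a list commutes with applying a map to all entries, and both
  sides extend additively from single lists.\<close>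

lemma chain_map_boundary: "clique_boundary n (chain_map \<phi> c) = chain_map \<phi> (clique_boundary n c)"
proof (cases "n = 0")
  case False
  have "chain_map \<phi> (clique_boundary n c) =
      frag_extend (frag_extend (frag_of \<circ> map \<phi>) \<circ>
        (\<lambda>vs. \<Sum>i\<le>n. frag_cmul ((-1) ^ i) (frag_of (omit_vertex i vs)))) c"
    unfolding frag_extend_def[of "frag_extend _ \<circ> _"]
    using False by (simp add: chain_map_def clique_boundary_def frag_extend_def[of "\<lambda>vs. \<Sum>i\<le>n. _ i vs"]
        frag_extend_sum frag_extend_cmul o_def)
  also have "\<dots> = frag_extend ((\<lambda>vs. \<Sum>i\<le>n. frag_cmul ((-1) ^ i) (frag_of (omit_vertex i vs))) \<circ> map \<phi>) c"
    by (rule frag_extend_eq)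
      (simp add: frag_extend_sum frag_extend_cmul o_def omit_vertex_def take_map drop_map)
  also have "\<dots> = clique_boundary n (chain_map \<phi> c)"
    using False by (simp add: clique_boundary_def chain_map_def frag_extend_compose)
  finally show ?thesis ..
qed (simp add: clique_boundary_def chain_map_def)

text \<open>The clique complex sees a quiver only through \<open>edge_count\<close>, so counts are
  compared and no bijection of arcs is chosen.\<close>

definition quiver_iso :: "('v \<Rightarrow> 'w) \<Rightarrow> ('v, 'e) pre_digraph \<Rightarrow> ('w, 'f) pre_digraph \<Rightarrow> bool" where
  "quiver_iso \<phi> Q Q' \<longleftrightarrow> bij_betw \<phi> (verts Q) (verts Q') \<and>
     (\<forall>u\<in>verts Q. \<forall>v\<in>verts Q. edge_count Q' (\<phi> u) (\<phi> v) = edge_count Q u v)"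

lemma quiver_iso_inv: "quiver_iso \<phi> Q Q' \<Longrightarrow> quiver_iso (inv_into (verts Q) \<phi>) Q' Q"
  unfolding quiver_iso_def
proof (elim conjE, intro conjI ballI)
  assume bij: "bij_betw \<phi> (verts Q) (verts Q')"
    and edges: "\<forall>u\<in>verts Q. \<forall>v\<in>verts Q. edge_count Q' (\<phi> u) (\<phi> v) = edge_count Q u v"
  let ?\<psi> = "inv_into (verts Q) \<phi>"
  show bij': "bij_betw ?\<psi> (verts Q') (verts Q)"
    by (rule bij_betw_inv_into[OF bij])
  fix u v assume "u \<in> verts Q'" "v \<in> verts Q'"
  moreover from this have "?\<psi> u \<in> verts Q" "?\<psi> v \<in> verts Q"
    using bij_betwE[OF bij'] by auto
  ultimately show "edge_count Q (?\<psi> u) (?\<psi> v) = edge_count Q' u v"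
    using edges by (metis bij bij_betw_inv_into_right)
qed

text \<open>Injectivity of \<phi> keeps the vertices distinct, and equal edge counts keep the
  threshold N.\<close>

lemma quiver_iso_simplices:
  assumes "quiver_iso \<phi> Q Q'" "vs \<in> clique_simplices N Q n"
  shows "map \<phi> vs \<in> clique_simplices N Q' n"
proof -
  have bij: "bij_betw \<phi> (verts Q) (verts Q')" and vs: "set vs \<subseteq> verts Q"
    using assms by (simp_all add: quiver_iso_def clique_simplices_def)
  then have "\<phi> ` set vs \<subseteq> verts Q'"
    by (metis bij_betw_imp_surj_on image_mono)
  moreover have "vs ! i \<in> verts Q" if "i < length vs" for i
    using vs that by (meson nth_mem subsetD)
  ultimately show ?thesis
    using assms inj_onD[OF bij_betw_imp_inj_on[OF bij]]
    by (simp add: clique_simplices_def quiver_iso_def) (metis less_trans)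
qed

lemma clique_homology_iso:
  assumes iso: "quiver_iso \<phi> Q Q'"
  shows "clique_homology N Q n \<cong> clique_homology N Q' n"
proof -
  define \<psi> where "\<psi> = inv_into (verts Q) \<phi>"
  have iso': "quiver_iso \<psi> Q' Q"
    unfolding \<psi>_def by (rule quiver_iso_inv[OF iso])
  have bij: "bij_betw \<phi> (verts Q) (verts Q')"
    using iso by (simp add: quiver_iso_def)
  \<comment> \<open>Chains supported on lists of vertices: they include the cycles as well as the
    boundaries, and \<psi> undoes \<phi> on all of them.\<close>
  define U where "U = {c :: 'a list \<Rightarrow>\<^sub>0 int. \<forall>vs\<in>Poly_Mapping.keys c. set vs \<subseteq> verts Q}"
  have inv1: "chain_map \<psi> (chain_map \<phi> c) = c" if "c \<in> U" for c
    by (rule chain_map_inverse)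
      (use that bij in \<open>auto simp: U_def \<psi>_def subset_iff bij_betw_inv_into_left\<close>)
  have inv2: "chain_map \<phi> (chain_map \<psi> c) = c"
    if "Poly_Mapping.keys c \<subseteq> clique_simplices N Q' m" for c m
    by (rule chain_map_inverse)
      (use that bij in \<open>fastforce simp: \<psi>_def clique_simplices_def bij_betw_inv_into_right\<close>)
  have keys: "Poly_Mapping.keys (chain_map \<phi> c) \<subseteq> clique_simplices N Q' m"
    if "Poly_Mapping.keys c \<subseteq> clique_simplices N Q m" for c :: "'a list \<Rightarrow>\<^sub>0 int" and m
    using keys_chain_map[of \<phi> c] that quiver_iso_simplices[OF iso] by blast
  have keys': "Poly_Mapping.keys (chain_map \<psi> c) \<subseteq> clique_simplices N Q m"
    if "Poly_Mapping.keys c \<subseteq> clique_simplices N Q' m" for c m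
    using keys_chain_map[of \<psi> c] that quiver_iso_simplices[OF iso'] by blast
  \<comment> \<open>\<open>P\<close> and \<open>P'\<close> stand for the cycle condition in degree
    n, and for the trivial condition on the full chain group in degree n + 1.\<close>
  have img: "chain_map \<phi> ` {c. Poly_Mapping.keys c \<subseteq> clique_simplices N Q m \<and> P c} =
      {c. Poly_Mapping.keys c \<subseteq> clique_simplices N Q' m \<and> P' c}"
    if "\<And>c. P c \<Longrightarrow> P' (chain_map \<phi> c)" "\<And>c. P' c \<Longrightarrow> P (chain_map \<psi> c)"
    for m and P :: "('a list \<Rightarrow>\<^sub>0 int) \<Rightarrow> bool" and P'
  proof (intro equalityI subsetI)
    fix c assume "c \<in> {c. Poly_Mapping.keys c \<subseteq> clique_simplices N Q' m \<and> P' c}"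
    then show "c \<in> chain_map \<phi> ` {c. Poly_Mapping.keys c \<subseteq> clique_simplices N Q m \<and> P c}"
      using that(2)[of c] keys'[of c m] inv2[of c m]
      by (intro image_eqI[where x = "chain_map \<psi> c"]) simp_all
  qed (use that(1) keys in auto)
  have cyc: "chain_map \<phi> ` carrier (clique_cycle_group N Q n) = carrier (clique_cycle_group N Q' n)"
    unfolding carrier_clique_cycle_group
    by (rule img) (auto simp: chain_map_boundary, auto simp: chain_map_def)
  have "chain_map \<phi> ` carrier (clique_chain_group N Q (Suc n)) =
      carrier (clique_chain_group N Q' (Suc n))"
    using img[of "\<lambda>_. True" "\<lambda>_. True"] by (simp add: clique_chain_group_def free_Abelian_group_def)
  moreover have "chain_map \<phi> ` clique_boundary (Suc n) ` A = clique_boundary (Suc n) ` chain_map \<phi> ` A" for A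
    by (simp add: image_image chain_map_boundary)
  ultimately have bnd: "chain_map \<phi> ` clique_boundaries N Q n = clique_boundaries N Q' n"
    by (simp add: clique_boundaries_def)
  \<comment> \<open>Faces use only vertices of their simplex; this is what places the boundaries in
    U.\<close>
  have omit: "set (omit_vertex i vs) \<subseteq> set vs" for i and vs :: "'a list"
    by (auto simp: omit_vertex_def dest: in_set_takeD in_set_dropD)
  have bnd_U: "clique_boundaries N Q n \<subseteq> U"
  proof
    fix c assume "c \<in> clique_boundaries N Q n"
    then obtain d where d: "Poly_Mapping.keys d \<subseteq> clique_simplices N Q (Suc n)"
      and c: "c = clique_boundary (Suc n) d"
      by (auto simp: clique_boundaries_def carrier_clique_chain_group)
    have "\<exists>vs\<in>Poly_Mapping.keys d. set ws \<subseteq> set vs" if ws: "ws \<in> Poly_Mapping.keys c" for ws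
    proof -
      obtain vs where vs: "vs \<in> Poly_Mapping.keys d" and
        "ws \<in> Poly_Mapping.keys (\<Sum>i\<le>Suc n. frag_cmul ((-1) ^ i) (frag_of (omit_vertex i vs)))"
        using ws keys_frag_extend[of "\<lambda>vs. \<Sum>i\<le>Suc n. frag_cmul ((-1) ^ i) (frag_of (omit_vertex i vs))" d]
        by (auto simp: c clique_boundary_def subset_iff simp del: sum.atMost_Suc)
      then obtain i where "ws \<in> Poly_Mapping.keys (frag_cmul ((-1) ^ i) (frag_of (omit_vertex i vs)))"
        using keys_sum by (metis (no_types, lifting) UN_E subsetD)
      then have "ws = omit_vertex i vs"
        using keys_cmul by fastforce
      then show ?thesis
        using vs omit by blast
    qed
    then show "c \<in> U"
      using d by (fastforce simp: U_def clique_simplices_def)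
  qed
  show ?thesis
    unfolding clique_homology_def
  proof (rule FactGroup_cong_iso[where h = "chain_map \<phi>" and U = U])
    show "inj_on (chain_map \<phi>) U"
      by (metis inv1 inj_onI)
    show "carrier (clique_cycle_group N Q n) \<subseteq> U"
      by (auto simp: U_def carrier_clique_cycle_group clique_simplices_def)
  next
    fix x y assume "x \<in> U" "y \<in> U"
    then show "x \<otimes>\<^bsub>clique_cycle_group N Q n\<^esub> y \<in> U"
      using keys_add[of x y] by (auto simp: U_def mult_clique_cycle_group)
  qed (simp_all add: bnd_U cyc bnd mult_clique_cycle_group chain_map_add)
qed

section \<open>Colorings as step functions\<close>

text \<open>The components of g t are the limits of g from the left and from the right, attained
  near t; on either side of t both components coincide. The condition depends only on the germ of g
  at t, so step functions can be glued.\<close>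

definition step_at :: "(real \<Rightarrow> 'a \<times> 'a) \<Rightarrow> real \<Rightarrow> bool" where
  "step_at g t \<longleftrightarrow>
     (\<forall>\<^sub>F s in at_right t. g s = (snd (g t), snd (g t))) \<and>
     (\<forall>\<^sub>F s in at_left t. g s = (fst (g t), fst (g t)))"

text \<open>
  The arguments \<open>a\<close> and \<open>b\<close> are the pairs of labels before and after the crossing on the over-strand
  and on the under-strand, and \<open>d\<close> is the crossing direction.
\<close>

definition crossing_rule ::
    "('a \<Rightarrow> 'a \<Rightarrow> 'a) \<Rightarrow> ('a \<Rightarrow> 'a \<Rightarrow> 'a) \<Rightarrow> real \<Rightarrow> 'a \<times> 'a \<Rightarrow> 'a \<times> 'a \<Rightarrow> bool" where
  "crossing_rule under_op over_op d a b \<longleftrightarrow>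
     (if d > 0 then snd b = under_op (fst b) (snd a) \<and> fst a = over_op (snd a) (fst b)
      else fst b = under_op (snd b) (fst a) \<and> snd a = over_op (fst a) (snd b))"

definition is_cut :: "vdiagram \<Rightarrow> source_point \<Rightarrow> bool" where
  "is_cut D p \<longleftrightarrow> (\<exists>q. classical_at D p q)"

text \<open>A coloring is recorded by the pair of labels just before and just after each source point.\<close>

definition side_colorings ::
    "'a set \<Rightarrow> ('a \<Rightarrow> 'a \<Rightarrow> 'a) \<Rightarrow> ('a \<Rightarrow> 'a \<Rightarrow> 'a) \<Rightarrow> vdiagram \<Rightarrow> (source_point \<Rightarrow> 'a \<times> 'a) set" where
  "side_colorings X under_op over_op D =
     {c \<in> source D \<rightarrow>\<^sub>E X \<times> X.
        (\<forall>i<ncircles D. \<forall>t. step_at (\<lambda>s. c (i, cis s)) t) \<and>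
        (\<forall>p\<in>source D. \<not> is_cut D p \<longrightarrow> fst (c p) = snd (c p)) \<and>
        (\<forall>(p, q)\<in>over_under D. crossing_rule under_op over_op (crossing_direction D p q) (c p) (c q))}"

section \<open>Parameters on the circle\<close>

lemma cis_eq_cis_iff: "cis s = cis t \<longleftrightarrow> (\<exists>n::int. s = t + 2 * pi * of_int n)"
  using sin_cos_eq_iff[of s t] by (auto simp: complex_eq_iff)

lemma in_sphere_cis: "z \<in> sphere 0 1 \<longleftrightarrow> (\<exists>t. z = cis t)"
proof
  assume "z \<in> sphere 0 1"
  then have "z = cis (Arg z)"
    using cis_Arg[of z] by (cases "z = 0") (auto simp: sgn_div_norm)
  then show "\<exists>t. z = cis t" ..
qed auto

lemma source_cis: "p \<in> source D \<longleftrightarrow> (\<exists>i t. p = (i, cis t) \<and> i < ncircles D)"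
  by (cases p) (auto simp: source_def in_sphere_cis simp del: mem_sphere_0 mem_sphere)

lemma eventually_cis_avoids_finite:
  assumes "finite K"
  shows "\<forall>\<^sub>F s in at t. cis s \<notin> K"
proof -
  have "\<forall>\<^sub>F s in at t. cis s \<noteq> k" for k
  proof (cases "cis t = k")
    case True
    have "\<forall>\<^sub>F s in at t. s \<in> {t - pi<..<t + pi} \<and> s \<noteq> t"
      using eventually_nhds_in_open[of "{t - pi<..<t + pi}" t]
      by (auto simp: eventually_at_filter elim: eventually_mono)
    then show ?thesis
    proof (rule eventually_mono)
      fix s assume s: "s \<in> {t - pi<..<t + pi} \<and> s \<noteq> t"
      show "cis s \<noteq> k"
      proof
        assume "cis s = k"
        \<comment> \<open>Parameters with the same value of \<open>cis\<close> differ by a multiple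
          of 2 pi, and the window of half-width pi around t leaves room for n = 0 only.\<close>
        then obtain n :: int where n: "s = t + 2 * pi * of_int n"
          using True cis_eq_cis_iff[of s t] by metis
        then have "\<bar>2 * of_int n\<bar> * pi < 1 * pi"
          using s by (auto simp: abs_mult mult_ac abs_less_iff)
        then have "\<bar>2 * of_int n\<bar> < (1::real)"
          by (rule mult_right_less_imp_less) simp
        then have "n = 0"
          by linarith
        then show False
          using n s by simp
      qed
    qed
  next
    case False
    have "(cis \<longlongrightarrow> cis t) (at t)"
      using tendsto_cis[OF tendsto_ident_at] .
    then show ?thesis
      using False by (rule tendsto_imp_eventually_ne)
  qed
  then show ?thesis
    using eventually_ball_finite[OF assms, of "\<lambda>s k. cis s \<noteq> k" "at t"]
    by (auto elim: eventually_mono)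
qed

lemma crossing_direction_commute: "crossing_direction D q p = - crossing_direction D p q"
proof -
  have "Im (cnj (velocity D q) * velocity D p) = - Im (cnj (velocity D p) * velocity D q)"
    by (simp add: algebra_simps)
  then show ?thesis
    unfolding crossing_direction_def by (metis sgn_minus)
qed

section \<open>Semi-arcs of a diagram\<close>

locale virtual_diagram =
  fixes D :: vdiagram
  assumes vdiagram: "is_vdiagram D"
begin

lemma finite_double_points: "finite (double_points D)"
  and over_under_double: "over_under D \<subseteq> double_points D"
  and over_under_asym: "(p, q) \<in> over_under D \<Longrightarrow> (q, p) \<notin> over_under D"
  and double_points_unique: "(p, q) \<in> double_points D \<Longrightarrow> (p, r) \<in> double_points D \<Longrightarrow> q = r"
  and transversal: "(p, q) \<in> double_points D \<Longrightarrow> crossing_direction D p q \<noteq> 0"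
  and C1_curve: "i < ncircles D \<Longrightarrow> (\<lambda>t. curve D i (cis t)) C1_differentiable_on UNIV"
  using vdiagram unfolding is_vdiagram_def by iprover+

lemma over_under_source: "(p, q) \<in> over_under D \<Longrightarrow> p \<in> source D \<and> q \<in> source D"
  using over_under_double by (auto simp: double_points_def)

lemma cut_points_iff: "z \<in> cut_points D i \<longleftrightarrow> is_cut D (i, z)"
  by (simp add: cut_points_def is_cut_def)

lemma finite_cut_points: "finite (cut_points D i)"
proof (rule finite_subset)
  show "cut_points D i \<subseteq> snd ` (fst ` over_under D \<union> snd ` over_under D)"
    by (force simp: cut_points_def classical_at_def)
  show "finite (snd ` (fst ` over_under D \<union> snd ` over_under D))"
    using finite_subset[OF over_under_double finite_double_points] by blast
qed

lemma eventually_not_cut: "\<forall>\<^sub>F s in at t. \<not> is_cut D (i, cis s)"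
  using eventually_cis_avoids_finite[OF finite_cut_points] by (simp add: cut_points_iff)

lemma semiarc_unique:
  "\<lbrakk>A \<in> semiarcs D; B \<in> semiarcs D; p \<in> A; p \<in> B\<rbrakk> \<Longrightarrow> A = B"
  by (auto simp: semiarcs_def dest: components_nonoverlap)

text \<open>The arc over the interval is connected and avoids the cut points, so a single component
  contains it.\<close>

lemma semiarc_over_interval:
  assumes "i < ncircles D" "a < b" "\<And>s. a < s \<Longrightarrow> s < b \<Longrightarrow> \<not> is_cut D (i, cis s)"
  obtains A where "A \<in> semiarcs D" "\<And>s. a < s \<Longrightarrow> s < b \<Longrightarrow> (i, cis s) \<in> A"
proof -
  have "connected (cis ` {a<..<b})"
    by (intro connected_continuous_image continuous_intros) auto
  moreover have sub: "cis ` {a<..<b} \<subseteq> sphere 0 1 - cut_points D i"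
    using assms by (auto simp: cut_points_iff)
  moreover have "cis ` {a<..<b} \<noteq> {}"
    using assms(2) by auto
  ultimately obtain C where "C \<in> components (sphere 0 1 - cut_points D i)" "cis ` {a<..<b} \<subseteq> C"
    using exists_component_superset[of "cis ` {a<..<b}"] by blast
  moreover from this have "{i} \<times> C \<in> semiarcs D"
    using assms(1) unfolding semiarcs_def by blast
  ultimately show thesis
    using that[of "{i} \<times> C"] by (simp add: image_subset_iff)
qed

text \<open>Resolves the definite description: two semi-arcs that both contain the points just after
  t share a point and are therefore equal.\<close>

lemma semiarc_after_eqI:
  assumes A: "A \<in> semiarcs D" and ev: "\<forall>\<^sub>F s in at_right t. (i, cis s) \<in> A"
  shows "semiarc_after D (i, cis t) = A"
proof -
  have *: "(\<forall>\<^sub>F e in at_right 0. (i, cis t * cis e) \<in> B) \<longleftrightarrow> (\<forall>\<^sub>F s in at_right t. (i, cis s) \<in> B)" for B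
    unfolding eventually_at_right_to_0[of _ t] by (simp add: cis_mult add.commute)
  show ?thesis
    unfolding semiarc_after_def fst_conv snd_conv *
  proof (rule the_equality)
    fix B assume B: "B \<in> semiarcs D \<and> (\<forall>\<^sub>F s in at_right t. (i, cis s) \<in> B)"
    then have "\<forall>\<^sub>F s in at_right t. (i, cis s) \<in> A \<and> (i, cis s) \<in> B"
      using ev by (simp add: eventually_conj)
    then obtain s where "(i, cis s) \<in> A \<and> (i, cis s) \<in> B"
      using eventually_happens'[OF trivial_limit_at_right_real] by blast
    then show "B = A"
      using A B semiarc_unique by blast
  qed (use A ev in auto)
qed

lemma semiarc_before_eqI:
  assumes A: "A \<in> semiarcs D" and ev: "\<forall>\<^sub>F s in at_left t. (i, cis s) \<in> A"
  shows "semiarc_before D (i, cis t) = A"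
proof -
  \<comment> \<open>The reflection of the line turns the left-hand filter at t into a right-hand
    one, and a translation moves it to 0.\<close>
  have *: "(\<forall>\<^sub>F e in at_right 0. (i, cis t * cis (- e)) \<in> B) \<longleftrightarrow> (\<forall>\<^sub>F s in at_left t. (i, cis s) \<in> B)" for B
    unfolding eventually_at_left_to_right[of _ t] eventually_at_right_to_0[of _ "- t"]
    by (simp add: cis_mult)
  show ?thesis
    unfolding semiarc_before_def fst_conv snd_conv *
  proof (rule the_equality)
    fix B assume B: "B \<in> semiarcs D \<and> (\<forall>\<^sub>F s in at_left t. (i, cis s) \<in> B)"
    then have "\<forall>\<^sub>F s in at_left t. (i, cis s) \<in> A \<and> (i, cis s) \<in> B"
      using ev by (simp add: eventually_conj)
    then obtain s where "(i, cis s) \<in> A \<and> (i, cis s) \<in> B"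
      using eventually_happens'[OF trivial_limit_at_left_real] by blast
    then show "B = A"
      using A B semiarc_unique by blast
  qed (use A ev in auto)
qed

text \<open>There are finitely many cut points, so some interval to the right of t is free of them,
  even if t itself is a cut.\<close>

lemma semiarc_after:
  assumes "i < ncircles D"
  shows "semiarc_after D (i, cis t) \<in> semiarcs D"
    and "\<forall>\<^sub>F s in at_right t. (i, cis s) \<in> semiarc_after D (i, cis t)"
proof -
  have "\<forall>\<^sub>F s in at_right t. \<not> is_cut D (i, cis s)"
    using eventually_not_cut[of i t] by (simp add: eventually_at_split)
  then obtain b where b: "b > t" "\<And>s. t < s \<Longrightarrow> s < b \<Longrightarrow> \<not> is_cut D (i, cis s)"
    by (auto simp: eventually_at_right_field)
  from semiarc_over_interval[OF assms b] obtain A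
    where A: "A \<in> semiarcs D" "\<And>s. t < s \<Longrightarrow> s < b \<Longrightarrow> (i, cis s) \<in> A"
    by blast
  have ev: "\<forall>\<^sub>F s in at_right t. (i, cis s) \<in> A"
    using A(2) b(1) eventually_at_right_field by blast
  show "semiarc_after D (i, cis t) \<in> semiarcs D"
    "\<forall>\<^sub>F s in at_right t. (i, cis s) \<in> semiarc_after D (i, cis t)"
    using semiarc_after_eqI[OF A(1) ev] A(1) ev by auto
qed

lemma semiarc_before:
  assumes "i < ncircles D"
  shows "semiarc_before D (i, cis t) \<in> semiarcs D"
    and "\<forall>\<^sub>F s in at_left t. (i, cis s) \<in> semiarc_before D (i, cis t)"
proof -
  have "\<forall>\<^sub>F s in at_left t. \<not> is_cut D (i, cis s)"
    using eventually_not_cut[of i t] by (simp add: eventually_at_split)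
  then obtain b where b: "b < t" "\<And>s. b < s \<Longrightarrow> s < t \<Longrightarrow> \<not> is_cut D (i, cis s)"
    by (auto simp: eventually_at_left_field)
  from semiarc_over_interval[OF assms b] obtain A
    where A: "A \<in> semiarcs D" "\<And>s. b < s \<Longrightarrow> s < t \<Longrightarrow> (i, cis s) \<in> A"
    by blast
  have ev: "\<forall>\<^sub>F s in at_left t. (i, cis s) \<in> A"
    using A(2) b(1) eventually_at_left_field by blast
  show "semiarc_before D (i, cis t) \<in> semiarcs D"
    "\<forall>\<^sub>F s in at_left t. (i, cis s) \<in> semiarc_before D (i, cis t)"
    using semiarc_before_eqI[OF A(1) ev] A(1) ev by auto
qed

text \<open>A whole interval around t is free of cuts, so one semi-arc contains the point and both
  of its sides.\<close>

lemma semiarc_at_uncut: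
  assumes "i < ncircles D" "\<not> is_cut D (i, cis t)"
  shows "(i, cis t) \<in> semiarc_after D (i, cis t)"
    and "semiarc_before D (i, cis t) = semiarc_after D (i, cis t)"
proof -
  have "\<forall>\<^sub>F s in nhds t. \<not> is_cut D (i, cis s)"
    using eventually_not_cut[of i t] assms(2) by (auto simp: eventually_at_filter elim: eventually_mono)
  then obtain e where e: "e > 0" "\<And>s. dist s t < e \<Longrightarrow> \<not> is_cut D (i, cis s)"
    by (auto simp: eventually_nhds_metric)
  have "t - e < t + e" "\<And>s. t - e < s \<Longrightarrow> s < t + e \<Longrightarrow> \<not> is_cut D (i, cis s)"
    using e by (auto simp: dist_real_def)
  from semiarc_over_interval[OF assms(1) this] obtain A
    where A: "A \<in> semiarcs D" "\<And>s. t - e < s \<Longrightarrow> s < t + e \<Longrightarrow> (i, cis s) \<in> A"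
    by blast
  have "\<forall>\<^sub>F s in at_right t. (i, cis s) \<in> A"
    unfolding eventually_at_right_field using A(2) e(1) by (intro exI[of _ "t + e"]) auto
  then have after: "semiarc_after D (i, cis t) = A"
    by (rule semiarc_after_eqI[OF A(1)])
  have "\<forall>\<^sub>F s in at_left t. (i, cis s) \<in> A"
    unfolding eventually_at_left_field using A(2) e(1) by (intro exI[of _ "t - e"]) auto
  then have "semiarc_before D (i, cis t) = A"
    by (rule semiarc_before_eqI[OF A(1)])
  with after show "semiarc_before D (i, cis t) = semiarc_after D (i, cis t)"
    by (rule trans[OF _ sym, rotated])
  show "(i, cis t) \<in> semiarc_after D (i, cis t)"
    unfolding after using A(2)[of t] e(1) by simp
qed

lemma semiarc_point:
  assumes "A \<in> semiarcs D" "(i, z) \<in> A"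
  obtains t where "z = cis t" "i < ncircles D" "\<not> is_cut D (i, cis t)"
    "semiarc_after D (i, cis t) = A" "semiarc_before D (i, cis t) = A"
proof -
  obtain C where C: "C \<in> components (sphere 0 1 - cut_points D i)" "z \<in> C" "i < ncircles D"
    using assms by (auto simp: semiarcs_def)
  then have "z \<in> sphere 0 1 - cut_points D i"
    using in_components_subset by blast
  then obtain t where t: "z = cis t" "\<not> is_cut D (i, cis t)"
    unfolding in_sphere_cis cut_points_iff Diff_iff by blast
  moreover have "semiarc_after D (i, cis t) = A"
    by (rule semiarc_unique[OF semiarc_after(1)[OF C(3)] assms(1) semiarc_at_uncut(1)[OF C(3) t(2)]])
      (use assms(2) t(1) in simp)
  ultimately show thesis
    using that[of t] C(3) semiarc_at_uncut(2)[OF C(3) t(2)] by simp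
qed

lemma semiarc_nonempty: "A \<in> semiarcs D \<Longrightarrow> A \<noteq> {}"
  by (auto simp: semiarcs_def dest: in_components_nonempty)

section \<open>Colorings of semi-arcs as labels on the two sides of source points\<close>

definition sides :: "(source_point set \<Rightarrow> 'a) \<Rightarrow> source_point \<Rightarrow> 'a \<times> 'a" where
  "sides f = (\<lambda>p\<in>source D. (f (semiarc_before D p), f (semiarc_after D p)))"

lemma sides_cis:
  "i < ncircles D \<Longrightarrow> sides f (i, cis t) = (f (semiarc_before D (i, cis t)), f (semiarc_after D (i, cis t)))"
  by (auto simp: sides_def source_cis)

lemma sides_on_semiarc:
  assumes "A \<in> semiarcs D" "p \<in> A"
  shows "sides f p = (f A, f A)"
  using assms by (cases p) (auto elim!: semiarc_point simp: sides_cis)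

lemma step_at_sides:
  assumes "i < ncircles D"
  shows "step_at (\<lambda>s. sides f (i, cis s)) t"
  unfolding step_at_def sides_cis[OF assms] fst_conv snd_conv
  using semiarc_after[OF assms, of t] semiarc_before[OF assms, of t]
  by (auto elim!: eventually_mono simp: sides_on_semiarc simp flip: sides_cis[OF assms])

text \<open>The sign of the crossing direction translates right and left into before and after.
  Right and left test both \<open>crossing_direction D p q\<close> and its negative for positivity;
  transversality excludes the value 0, at which the two tests would not be complementary.\<close>

lemma sides_in_side_colorings_iff:
  assumes "f \<in> semiarcs D \<rightarrow>\<^sub>E X"
  shows "sides f \<in> side_colorings X under_op over_op D \<longleftrightarrow> f \<in> colorings X under_op over_op D"
proof -
  have "sides f \<in> source D \<rightarrow>\<^sub>E X \<times> X"
    using assms semiarc_after(1) semiarc_before(1)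
    by (fastforce simp: source_cis sides_cis sides_def)
  moreover have "fst (sides f p) = snd (sides f p)" if "p \<in> source D" "\<not> is_cut D p" for p
    using that by (auto simp: source_cis sides_cis semiarc_at_uncut)
  moreover have "crossing_rule under_op over_op (crossing_direction D p q) (sides f p) (sides f q) \<longleftrightarrow>
      (let x = f (semiarc_right_of D q p); y = f (semiarc_right_of D p q) in
        f (semiarc_left_of D q p) = under_op x y \<and> f (semiarc_left_of D p q) = over_op y x)"
    if "(p, q) \<in> over_under D" for p q
  proof -
    have "crossing_direction D p q \<noteq> 0"
      using that transversal over_under_double by blast
    then show ?thesis
      using over_under_source[OF that]
      by (auto simp: crossing_rule_def semiarc_right_of_def semiarc_left_of_def sides_def
          crossing_direction_commute[of D q p] Let_def)
  qed
  ultimately show ?thesis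
    using assms step_at_sides by (auto simp: side_colorings_def colorings_def)
qed

text \<open>At an uncut point both one-sided limits equal the value, so c is locally constant on the
  semi-arc, which is connected.\<close>

lemma side_coloring_constant:
  assumes c: "c \<in> side_colorings X under_op over_op D" and A: "A \<in> semiarcs D" "p \<in> A" "q \<in> A"
  shows "c p = c q"
proof -
  obtain i C where AC: "A = {i} \<times> C" "i < ncircles D" "C \<in> components (sphere 0 1 - cut_points D i)"
    using A(1) by (auto simp: semiarcs_def)
  then obtain z w where zw: "p = (i, z)" "q = (i, w)" "z \<in> C" "w \<in> C"
    using A by auto
  have C_sphere: "C \<subseteq> sphere 0 1"
    using AC(3) in_components_subset by blast
  have "c (i, z) = c (i, w)"
  proof (rule connected_local_const[where f = "\<lambda>z. c (i, z)", OF _ zw(3,4)])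
    show "connected C"
      using AC(3) in_components_connected by blast
    show "\<forall>z\<in>C. \<forall>\<^sub>F w in at z within C. c (i, z) = c (i, w)"
    proof
      fix z assume z: "z \<in> C"
      then obtain t where t: "z = cis t" "\<not> is_cut D (i, cis t)"
        using A(1) unfolding AC(1) by (auto elim: semiarc_point)
      have "(i, cis t) \<in> source D"
        using AC(2) source_cis by blast
      then have "step_at (\<lambda>s. c (i, cis s)) t" "fst (c (i, cis t)) = snd (c (i, cis t))"
        using c t(2) AC(2) by (simp_all add: side_colorings_def)
      then have "\<forall>\<^sub>F s in at t. c (i, cis s) = c (i, cis t)"
        by (simp add: step_at_def eventually_at_split prod_eq_iff)
      then have const: "\<forall>\<^sub>F s in nhds t. c (i, cis t) = c (i, cis s)"
        by (auto simp: eventually_at_filter elim: eventually_mono)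
      \<comment> \<open>Local constancy in the parameter must be moved to the circle: the map from w
        to \<open>t + Arg (w / z)\<close> is a lift of the circle to parameters, continuous at z
        because z / z = 1 is off the branch cut of \<open>Arg\<close>.\<close>
      have "isCont Arg (z / z)"
        using t(1) by (intro continuous_at_Arg) simp
      moreover have "isCont (\<lambda>w. w / z) z"
        using t(1) by (intro continuous_intros) simp
      ultimately have "isCont (\<lambda>w. Arg (w / z)) z"
        by (rule isCont_o2[rotated])
      then have "((\<lambda>w. Arg (w / z)) \<longlongrightarrow> Arg (z / z)) (at z within C)"
        unfolding isCont_def by (rule tendsto_within_subset) simp
      then have "((\<lambda>w. t + Arg (w / z)) \<longlongrightarrow> t + Arg (z / z)) (at z within C)"
        by (rule tendsto_add[OF tendsto_const])
      then have "((\<lambda>w. t + Arg (w / z)) \<longlongrightarrow> t) (at z within C)"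
        using t(1) by simp
      then have "\<forall>\<^sub>F w in at z within C. c (i, cis t) = c (i, cis (t + Arg (w / z)))"
        by (rule eventually_compose_filterlim[OF const])
      moreover have "cis (t + Arg (w / z)) = w" if "w \<in> C" for w
      proof -
        have "w \<in> sphere 0 1" "z \<in> sphere 0 1"
          using C_sphere that z by blast+
        then have "norm (w / z) = 1"
          by (simp add: norm_divide)
        then have "cis (Arg (w / z)) = w / z"
          using cis_Arg[of "w / z"] by (cases "w / z = 0") (auto simp: sgn_div_norm)
        then show ?thesis
          using t(1) by (simp flip: cis_mult)
      qed
      ultimately show "\<forall>\<^sub>F w in at z within C. c (i, z) = c (i, w)"
        unfolding t(1)[symmetric] by (auto simp: eventually_at_filter elim: eventually_mono)
    qed
  qed
  then show ?thesis
    using zw by simp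
qed

lemma side_coloring_is_sides:
  assumes c: "c \<in> side_colorings X under_op over_op D"
  shows "c \<in> sides ` colorings X under_op over_op D"
proof -
  \<comment> \<open>The chosen point does not matter, as c is constant on each semi-arc.\<close>
  define f where "f = (\<lambda>A\<in>semiarcs D. fst (c (SOME p. p \<in> A)))"
  have f: "f A = fst (c p)" if "A \<in> semiarcs D" "p \<in> A" for A p
  proof -
    have "c (SOME p. p \<in> A) = c p"
      using side_coloring_constant[OF c that(1)] that(2) someI[of "\<lambda>p. p \<in> A"] by blast
    then show ?thesis
      using that(1) by (simp add: f_def)
  qed
  have cX: "c \<in> source D \<rightarrow>\<^sub>E X \<times> X"
    using c by (simp add: side_colorings_def)
  have "sides f = c"
  proof (rule extensionalityI)
    show "sides f \<in> extensional (source D)" "c \<in> extensional (source D)"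
      using cX by (auto simp: sides_def PiE_def)
    fix p assume "p \<in> source D"
    then obtain i t where p: "p = (i, cis t)" "i < ncircles D"
      by (auto simp: source_cis)
    have step: "step_at (\<lambda>s. c (i, cis s)) t"
      using c p(2) by (simp add: side_colorings_def)
    have "\<forall>\<^sub>F s in at_right t. (i, cis s) \<in> semiarc_after D p \<and> c (i, cis s) = (snd (c p), snd (c p))"
      using step semiarc_after(2)[OF p(2), of t] by (simp add: step_at_def p(1) eventually_conj)
    \<comment> \<open>A parameter slightly beyond t lies in the semi-arc after p, and there c
      already shows the label after p.\<close>
    then obtain s where "(i, cis s) \<in> semiarc_after D p" "c (i, cis s) = (snd (c p), snd (c p))"
      using eventually_happens'[OF trivial_limit_at_right_real] by blast
    then have after: "f (semiarc_after D p) = snd (c p)"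
      using f semiarc_after(1)[OF p(2)] p(1) by fastforce
    have "\<forall>\<^sub>F s in at_left t. (i, cis s) \<in> semiarc_before D p \<and> c (i, cis s) = (fst (c p), fst (c p))"
      using step semiarc_before(2)[OF p(2), of t] by (simp add: step_at_def p(1) eventually_conj)
    then obtain s where "(i, cis s) \<in> semiarc_before D p" "c (i, cis s) = (fst (c p), fst (c p))"
      using eventually_happens'[OF trivial_limit_at_left_real] by blast
    then have "f (semiarc_before D p) = fst (c p)"
      using f semiarc_before(1)[OF p(2)] p(1) by fastforce
    with after show "sides f p = c p"
      using \<open>p \<in> source D\<close> by (simp add: sides_def)
  qed
  moreover have "f \<in> semiarcs D \<rightarrow>\<^sub>E X"
  proof
    fix A assume A: "A \<in> semiarcs D"
    then obtain p where p: "p \<in> A"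
      using semiarc_nonempty by blast
    then have "p \<in> source D"
      using A by (cases p) (auto elim: semiarc_point simp: source_cis)
    then show "f A \<in> X"
      using f[OF A p] cX by (auto dest: PiE_mem)
  qed (simp add: f_def)
  ultimately show ?thesis
    using c sides_in_side_colorings_iff[of f X under_op over_op] by blast
qed

lemma bij_betw_sides: "bij_betw sides (colorings X under_op over_op D) (side_colorings X under_op over_op D)"
  unfolding bij_betw_def
proof
  show "inj_on sides (colorings X under_op over_op D)"
  proof (rule inj_onI)
    fix f g assume fg: "f \<in> colorings X under_op over_op D" "g \<in> colorings X under_op over_op D"
      "sides f = sides g"
    show "f = g"
    proof (rule extensionalityI)
      show "f \<in> extensional (semiarcs D)" "g \<in> extensional (semiarcs D)"
        using fg by (auto simp: colorings_def PiE_def)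
      fix A assume "A \<in> semiarcs D"
      then show "f A = g A"
        using semiarc_nonempty sides_on_semiarc fg(3) by (metis all_not_in_conv prod.inject)
    qed
  qed
  show "sides ` colorings X under_op over_op D = side_colorings X under_op over_op D"
  proof (intro equalityI subsetI)
    fix c assume "c \<in> sides ` colorings X under_op over_op D"
    then obtain f where f: "f \<in> colorings X under_op over_op D" "c = sides f"
      by blast
    then have "f \<in> semiarcs D \<rightarrow>\<^sub>E X"
      by (simp add: colorings_def)
    then show "c \<in> side_colorings X under_op over_op D"
      using sides_in_side_colorings_iff[of f X under_op over_op] f by simp
  qed (rule side_coloring_is_sides)
qed

end

subsection \<open>The action of endomorphisms\<close>

definition side_act :: "vdiagram \<Rightarrow> ('a \<Rightarrow> 'a) \<Rightarrow> (source_point \<Rightarrow> 'a \<times> 'a) \<Rightarrow> source_point \<Rightarrow> 'a \<times> 'a" where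
  "side_act D \<alpha> c = compose (source D) (map_prod \<alpha> \<alpha>) c"

lemma step_at_map_prod: "step_at g t \<Longrightarrow> step_at (\<lambda>s. map_prod \<alpha> \<alpha> (g s)) t"
  by (auto simp: step_at_def elim!: eventually_mono)

lemma crossing_rule_End:
  assumes "\<alpha> \<in> biquandle_End X under_op over_op" "a \<in> X \<times> X" "b \<in> X \<times> X"
    and "crossing_rule under_op over_op d a b"
  shows "crossing_rule under_op over_op d (map_prod \<alpha> \<alpha> a) (map_prod \<alpha> \<alpha> b)"
  using assms by (auto simp: crossing_rule_def biquandle_End_def split: if_splits)

lemma side_colorings_PiE: "c \<in> side_colorings X under_op over_op D \<Longrightarrow> c \<in> source D \<rightarrow>\<^sub>E X \<times> X"
  by (simp add: side_colorings_def)

lemma (in virtual_diagram) side_act_in_side_colorings: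
  assumes c: "c \<in> side_colorings X under_op over_op D"
    and \<alpha>: "\<alpha> \<in> biquandle_End X under_op over_op"
  shows "side_act D \<alpha> c \<in> side_colorings X under_op over_op D"
proof -
  have cX: "c p \<in> X \<times> X" if "p \<in> source D" for p
    using side_colorings_PiE[OF c] that by (rule PiE_mem)
  have "side_act D \<alpha> c \<in> source D \<rightarrow>\<^sub>E X \<times> X"
  proof
    fix p assume "p \<in> source D"
    moreover have "\<alpha> \<in> X \<rightarrow> X"
      using \<alpha> by (auto simp: biquandle_End_def)
    ultimately show "side_act D \<alpha> c p \<in> X \<times> X"
      using cX[of p] by (auto simp: side_act_def compose_def map_prod_def split: prod.splits)
  qed (simp add: side_act_def compose_def)
  moreover have "step_at (\<lambda>s. side_act D \<alpha> c (i, cis s)) t" if "i < ncircles D" for i t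
  proof -
    have "(i, cis s) \<in> source D" for s
      using that source_cis by blast
    then show ?thesis
      using c that step_at_map_prod[of "\<lambda>s. c (i, cis s)" t]
      by (simp add: side_act_def compose_def side_colorings_def)
  qed
  moreover have "fst (side_act D \<alpha> c p) = snd (side_act D \<alpha> c p)" if "p \<in> source D" "\<not> is_cut D p" for p
    using c that by (simp add: side_act_def compose_def side_colorings_def)
  moreover have "crossing_rule under_op over_op (crossing_direction D p q) (side_act D \<alpha> c p) (side_act D \<alpha> c q)"
    if "(p, q) \<in> over_under D" for p q
  proof -
    have "crossing_rule under_op over_op (crossing_direction D p q) (c p) (c q)"
      using c that by (auto simp: side_colorings_def)
    then show ?thesis
      using crossing_rule_End[OF \<alpha>] cX over_under_source[OF that]
      by (simp add: side_act_def compose_def)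
  qed
  ultimately show ?thesis
    by (auto simp: side_colorings_def)
qed

lemma (in virtual_diagram) sides_compose:
  "sides (compose (semiarcs D) \<alpha> f) = side_act D \<alpha> (sides f)"
  using semiarc_after(1) semiarc_before(1)
  by (auto simp: sides_def side_act_def compose_def source_cis fun_eq_iff restrict_def)

lemma (in virtual_diagram) compose_in_colorings:
  assumes \<alpha>: "\<alpha> \<in> biquandle_End X under_op over_op" and f: "f \<in> colorings X under_op over_op D"
  shows "compose (semiarcs D) \<alpha> f \<in> colorings X under_op over_op D"
proof -
  have "f \<in> semiarcs D \<rightarrow>\<^sub>E X"
    using f by (simp add: colorings_def)
  moreover have "\<alpha> \<in> X \<rightarrow> X"
    using \<alpha> by (auto simp: biquandle_End_def)
  ultimately have "compose (semiarcs D) \<alpha> f \<in> semiarcs D \<rightarrow>\<^sub>E X"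
    by (auto simp: compose_def)
  moreover have "sides f \<in> side_colorings X under_op over_op D"
    using bij_betwE[OF bij_betw_sides] f by blast
  then have "sides (compose (semiarcs D) \<alpha> f) \<in> side_colorings X under_op over_op D"
    unfolding sides_compose by (rule side_act_in_side_colorings[OF _ \<alpha>])
  ultimately show ?thesis
    by (simp add: sides_in_side_colorings_iff)
qed

text \<open>An isomorphism of sets with an action of the endomorphism monoid of X. All endomorphisms
  are included, so one isomorphism serves every S.\<close>

definition same_colorings ::
    "'a set \<Rightarrow> ('a \<Rightarrow> 'a \<Rightarrow> 'a) \<Rightarrow> ('a \<Rightarrow> 'a \<Rightarrow> 'a) \<Rightarrow> vdiagram \<Rightarrow> vdiagram \<Rightarrow> bool" where
  "same_colorings X under_op over_op D D' \<longleftrightarrow>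
     (\<exists>\<psi>. bij_betw \<psi> (side_colorings X under_op over_op D) (side_colorings X under_op over_op D') \<and>
        (\<forall>\<alpha>\<in>biquandle_End X under_op over_op. \<forall>c\<in>side_colorings X under_op over_op D.
           \<psi> (side_act D \<alpha> c) = side_act D' \<alpha> (\<psi> c)))"

lemma same_colorings_refl: "same_colorings X under_op over_op D D"
  unfolding same_colorings_def by (rule exI[of _ id]) simp

lemma same_colorings_trans:
  assumes "same_colorings X under_op over_op D D'" "same_colorings X under_op over_op D' D''"
  shows "same_colorings X under_op over_op D D''"
proof -
  obtain \<psi> \<psi>' where
    "bij_betw \<psi> (side_colorings X under_op over_op D) (side_colorings X under_op over_op D')"
    "bij_betw \<psi>' (side_colorings X under_op over_op D') (side_colorings X under_op over_op D'')"
    "\<And>\<alpha> c. \<alpha> \<in> biquandle_End X under_op over_op \<Longrightarrow> c \<in> side_colorings X under_op over_op D \<Longrightarrow>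
      \<psi> (side_act D \<alpha> c) = side_act D' \<alpha> (\<psi> c)"
    "\<And>\<alpha> c. \<alpha> \<in> biquandle_End X under_op over_op \<Longrightarrow> c \<in> side_colorings X under_op over_op D' \<Longrightarrow>
      \<psi>' (side_act D' \<alpha> c) = side_act D'' \<alpha> (\<psi>' c)"
    using assms unfolding same_colorings_def by blast
  then show ?thesis
    unfolding same_colorings_def
    by (intro exI[of _ "\<psi>' \<circ> \<psi>"]) (auto intro: bij_betw_trans dest: bij_betwE)
qed

text \<open>The inverse of an equivariant bijection is equivariant, once the action is known to stay
  inside the side colorings of D; this is where D has to be a diagram.\<close>

lemma same_colorings_sym:
  assumes D: "is_vdiagram D" and "same_colorings X under_op over_op D D'"
  shows "same_colorings X under_op over_op D' D"
proof -
  let ?M = "side_colorings X under_op over_op D" and ?M' = "side_colorings X under_op over_op D'"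
  obtain \<psi> where bij: "bij_betw \<psi> ?M ?M'" and
    act: "\<And>\<alpha> c. \<alpha> \<in> biquandle_End X under_op over_op \<Longrightarrow> c \<in> ?M \<Longrightarrow>
      \<psi> (side_act D \<alpha> c) = side_act D' \<alpha> (\<psi> c)"
    using assms unfolding same_colorings_def by blast
  have "inv_into ?M \<psi> (side_act D' \<alpha> c') = side_act D \<alpha> (inv_into ?M \<psi> c')"
    if \<alpha>: "\<alpha> \<in> biquandle_End X under_op over_op" and "c' \<in> ?M'" for \<alpha> c'
  proof -
    obtain c where c: "c \<in> ?M" "c' = \<psi> c"
      using bij \<open>c' \<in> ?M'\<close> by (auto simp: bij_betw_def)
    moreover have "side_act D \<alpha> c \<in> ?M"
      using virtual_diagram.side_act_in_side_colorings[of D] D c(1) \<alpha> by (simp add: virtual_diagram_def)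
    ultimately show ?thesis
      using act[OF \<alpha> c(1)] bij by (metis bij_betw_inv_into_left)
  qed
  then show ?thesis
    unfolding same_colorings_def using bij_betw_inv_into[OF bij] by blast
qed

text \<open>The correspondence is given as a relation, since for a move it is simply agreement
  outside the disc. Existence and uniqueness in both directions make it the graph of a
  bijection.\<close>

lemma same_coloringsI:
  assumes total: "\<And>c. c \<in> side_colorings X under_op over_op D \<Longrightarrow>
      \<exists>c'\<in>side_colorings X under_op over_op D'. R c c'"
    and surj: "\<And>c'. c' \<in> side_colorings X under_op over_op D' \<Longrightarrow>
      \<exists>c\<in>side_colorings X under_op over_op D. R c c'"
    and right_unique: "\<And>c c' c''. \<lbrakk>c' \<in> side_colorings X under_op over_op D';
      c'' \<in> side_colorings X under_op over_op D'; R c c'; R c c''\<rbrakk> \<Longrightarrow> c' = c''"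
    and left_unique: "\<And>c c' c''. \<lbrakk>c \<in> side_colorings X under_op over_op D;
      c' \<in> side_colorings X under_op over_op D; R c c''; R c' c''\<rbrakk> \<Longrightarrow> c = c'"
    and act: "\<And>\<alpha> c c'. R c c' \<Longrightarrow> R (side_act D \<alpha> c) (side_act D' \<alpha> c')"
    and D: "is_vdiagram D" and D': "is_vdiagram D'"
  shows "same_colorings X under_op over_op D D'"
proof -
  let ?M = "side_colorings X under_op over_op D" and ?M' = "side_colorings X under_op over_op D'"
  define \<psi> where "\<psi> c = (SOME c'. c' \<in> ?M' \<and> R c c')" for c
  have \<psi>: "\<psi> c \<in> ?M' \<and> R c (\<psi> c)" if "c \<in> ?M" for c
    unfolding \<psi>_def by (rule someI_ex[where P = "\<lambda>c'. c' \<in> ?M' \<and> R c c'"]) (use total[OF that] in blast)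
  have "bij_betw \<psi> ?M ?M'"
  proof (rule bij_betw_imageI)
    show "inj_on \<psi> ?M"
    proof (rule inj_onI)
      fix c c' assume "c \<in> ?M" "c' \<in> ?M" "\<psi> c = \<psi> c'"
      then show "c = c'"
        using \<psi>[of c] \<psi>[of c'] left_unique[of c c' "\<psi> c"] by simp
    qed
    show "\<psi> ` ?M = ?M'"
    proof (intro equalityI subsetI)
      fix c' assume c': "c' \<in> ?M'"
      then obtain c where c: "c \<in> ?M" "R c c'"
        using surj by blast
      then show "c' \<in> \<psi> ` ?M"
        using \<psi>[of c] right_unique[of c' "\<psi> c" c] c' by auto
    qed (use \<psi> in auto)
  qed
  moreover have "\<psi> (side_act D \<alpha> c) = side_act D' \<alpha> (\<psi> c)"
    if "\<alpha> \<in> biquandle_End X under_op over_op" "c \<in> ?M" for \<alpha> c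
  \<comment> \<open>Both sides are related to the same coloring
    \<open>side_act D \<alpha> c\<close>, so uniqueness identifies them.\<close>
  proof (rule right_unique)
    have "side_act D \<alpha> c \<in> ?M"
      by (rule virtual_diagram.side_act_in_side_colorings[OF _ that(2,1)]) (simp add: virtual_diagram_def D)
    from \<psi>[OF this] show "\<psi> (side_act D \<alpha> c) \<in> ?M'" "R (side_act D \<alpha> c) (\<psi> (side_act D \<alpha> c))"
      by auto
    show "side_act D' \<alpha> (\<psi> c) \<in> ?M'"
      by (rule virtual_diagram.side_act_in_side_colorings[OF _ conjunct1[OF \<psi>[OF that(2)]] that(1)])
        (simp add: virtual_diagram_def D')
    show "R (side_act D \<alpha> c) (side_act D' \<alpha> (\<psi> c))"
      using \<psi>[OF that(2)] act by blast
  qed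
  ultimately show ?thesis
    unfolding same_colorings_def by blast
qed

text \<open>The arcs leaving u correspond to the elements of S, so an edge count is the number of
  \<alpha> in S carrying u to v. The map \<open>sides\<close> is injective and equivariant, so this
  number can be read from side colorings, where the given bijection preserves it.\<close>

lemma same_colorings_quiver_iso:
  assumes D: "is_vdiagram D" and D': "is_vdiagram D'"
    and S: "S \<subseteq> biquandle_End X under_op over_op"
    and same: "same_colorings X under_op over_op D D'"
  obtains \<phi> where "quiver_iso \<phi> (coloring_quiver X under_op over_op S D)
    (coloring_quiver X under_op over_op S D')"
proof -
  interpret D: virtual_diagram D by unfold_locales (rule D)
  interpret D': virtual_diagram D' by unfold_locales (rule D')
  let ?C = "colorings X under_op over_op D" and ?C' = "colorings X under_op over_op D'"
  let ?M = "side_colorings X under_op over_op D" and ?M' = "side_colorings X under_op over_op D'"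
  obtain \<psi> where bij: "bij_betw \<psi> ?M ?M'" and
    act: "\<And>\<alpha> c. \<alpha> \<in> biquandle_End X under_op over_op \<Longrightarrow> c \<in> ?M \<Longrightarrow>
      \<psi> (side_act D \<alpha> c) = side_act D' \<alpha> (\<psi> c)"
    using same unfolding same_colorings_def by blast
  note bs = D.bij_betw_sides[of X under_op over_op] and bs' = D'.bij_betw_sides[of X under_op over_op]
  define \<phi> where "\<phi> = inv_into ?C' D'.sides \<circ> (\<psi> \<circ> D.sides)"
  have bij_\<phi>: "bij_betw \<phi> ?C ?C'"
    unfolding \<phi>_def by (rule bij_betw_trans[OF bij_betw_trans[OF bs bij] bij_betw_inv_into[OF bs']])
  have sides_\<phi>: "D'.sides (\<phi> f) = \<psi> (D.sides f)" if "f \<in> ?C" for f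
  proof -
    have "\<psi> (D.sides f) \<in> ?M'"
      using that bij_betwE[OF bij] bij_betwE[OF bs] by blast
    then show ?thesis
      by (simp add: \<phi>_def bij_betw_inv_into_right[OF bs'])
  qed
  have count: "edge_count (coloring_quiver X under_op over_op S E) u v =
      card {\<alpha> \<in> S. side_act E \<alpha> (virtual_diagram.sides E u) = virtual_diagram.sides E v}"
    if E: "is_vdiagram E" and u: "u \<in> colorings X under_op over_op E"
      and v: "v \<in> colorings X under_op over_op E" for E u v
  proof -
    interpret E: virtual_diagram E by unfold_locales (rule E)
    have "compose (semiarcs E) \<alpha> u = v \<longleftrightarrow> side_act E \<alpha> (E.sides u) = E.sides v" if "\<alpha> \<in> S" for \<alpha>
    proof -
      have "compose (semiarcs E) \<alpha> u \<in> colorings X under_op over_op E"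
        using E.compose_in_colorings u S that by blast
      then show ?thesis
        using inj_on_eq_iff[OF bij_betw_imp_inj_on[OF E.bij_betw_sides] _ v, of "compose (semiarcs E) \<alpha> u"]
        by (simp flip: E.sides_compose)
    qed
    then have "{\<alpha> \<in> S. compose (semiarcs E) \<alpha> u = v} = {\<alpha> \<in> S. side_act E \<alpha> (E.sides u) = E.sides v}"
      by blast
    moreover have "{e \<in> arcs (coloring_quiver X under_op over_op S E).
          tail (coloring_quiver X under_op over_op S E) e = u \<and>
          head (coloring_quiver X under_op over_op S E) e = v}
        = Pair u ` {\<alpha> \<in> S. compose (semiarcs E) \<alpha> u = v}"
      using u by (auto simp: coloring_quiver_def)
    ultimately show ?thesis
      by (simp add: edge_count_def card_image inj_on_def)
  qed
  have "edge_count (coloring_quiver X under_op over_op S D') (\<phi> u) (\<phi> v) =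
      edge_count (coloring_quiver X under_op over_op S D) u v" if u: "u \<in> ?C" and v: "v \<in> ?C" for u v
  proof -
    have su: "D.sides u \<in> ?M" and sv: "D.sides v \<in> ?M"
      using bij_betwE[OF bs] u v by auto
    have "side_act D' \<alpha> (D'.sides (\<phi> u)) = D'.sides (\<phi> v) \<longleftrightarrow> side_act D \<alpha> (D.sides u) = D.sides v"
      if "\<alpha> \<in> S" for \<alpha>
    proof -
      have \<alpha>: "\<alpha> \<in> biquandle_End X under_op over_op"
        using S that by blast
      show ?thesis
        using inj_on_eq_iff[OF bij_betw_imp_inj_on[OF bij] D.side_act_in_side_colorings[OF su \<alpha>] sv]
        by (simp add: sides_\<phi> u v act[OF \<alpha> su])
    qed
    moreover have "\<phi> u \<in> ?C'" "\<phi> v \<in> ?C'"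
      using bij_betwE[OF bij_\<phi>] u v by auto
    ultimately show ?thesis
      using count[OF D u v] count[OF D'] by (simp cong: conj_cong)
  qed
  then have "quiver_iso \<phi> (coloring_quiver X under_op over_op S D) (coloring_quiver X under_op over_op S D')"
    unfolding quiver_iso_def using bij_\<phi> by (simp add: coloring_quiver_def)
  then show thesis
    by (rule that)
qed

section \<open>Planar isotopy and reparametrisation\<close>

lemma has_vector_derivative_shift:
  assumes "(f has_vector_derivative v) (at (a + b))"
  shows "((\<lambda>t. f (a + t)) has_vector_derivative v) (at b)"
proof -
  have "((\<lambda>t. a + t) has_vector_derivative 1) (at b)"
    by (auto intro!: derivative_eq_intros)
  from vector_diff_chain_at[OF this assms] show ?thesis
    by (simp add: o_def)
qed

lemma velocity_eqI:
  assumes "((\<lambda>t. curve D i (cis t)) has_vector_derivative v) (at \<theta>)"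
  shows "velocity D (i, cis \<theta>) = v"
  using has_vector_derivative_shift[of "\<lambda>t. curve D i (cis t)" v \<theta> 0] assms
  by (simp add: velocity_def cis_mult vector_derivative_at)

lemma (in virtual_diagram) velocity_has_vector_derivative:
  assumes "i < ncircles D"
  shows "((\<lambda>t. curve D i (cis t)) has_vector_derivative velocity D (i, cis \<theta>)) (at \<theta>)"
proof -
  obtain v where v: "((\<lambda>t. curve D i (cis t)) has_vector_derivative v) (at \<theta>)"
    using C1_curve[OF assms] by (auto simp: C1_differentiable_on_def)
  then show ?thesis
    using velocity_eqI[OF v] by simp
qed

lemma (in virtual_diagram) classical_at_source: "classical_at D p q \<Longrightarrow> p \<in> source D \<and> q \<in> source D"
  unfolding classical_at_def using over_under_source by blast

text \<open>The curves enter the side colorings only through the directions at classical crossings.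
  If these agree, the two sets of side colorings are equal and the identity is the bijection; this
  covers planar isotopy and the virtual moves.\<close>

lemma same_coloringsI_eq:
  fixes X :: "'a set"
  assumes "ncircles D' = ncircles D" "over_under D' = over_under D"
    and dir: "\<And>p q. (p, q) \<in> over_under D \<Longrightarrow> crossing_direction D' p q = crossing_direction D p q"
  shows "same_colorings X under_op over_op D D'"
proof -
  have source: "source D' = source D"
    using assms by (simp add: source_def)
  have "is_cut D' = is_cut D"
    using assms by (simp add: is_cut_def classical_at_def fun_eq_iff)
  then have "side_colorings X under_op over_op D' = side_colorings X under_op over_op D"
    unfolding side_colorings_def source assms(1,2) using dir
    by (intro Collect_cong conj_cong ball_cong refl) (auto split: prod.splits)
  moreover have "side_act D' \<alpha> c = side_act D \<alpha> c" for \<alpha> and c :: "source_point \<Rightarrow> 'a \<times> 'a"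
    by (simp add: side_act_def source)
  ultimately show ?thesis
    using same_colorings_refl[of X under_op over_op D] by (simp add: same_colorings_def)
qed

text \<open>Multiplicativity of the determinant: the first factor on the right is the determinant of
  L in the basis 1, \<open>\<i>\<close>.\<close>

lemma linear_complex_det:
  fixes L :: "complex \<Rightarrow> complex"
  assumes "linear L"
  shows "Im (cnj (L v) * L w) = Im (cnj (L 1) * L \<i>) * Im (cnj v * w)"
proof -
  have L: "L z = Re z *\<^sub>R L 1 + Im z *\<^sub>R L \<i>" for z
  proof -
    have "z = Re z *\<^sub>R 1 + Im z *\<^sub>R \<i>"
      by (simp add: complex_eq_iff)
    then have "L z = L (Re z *\<^sub>R 1 + Im z *\<^sub>R \<i>)"
      by simp
    also have "\<dots> = Re z *\<^sub>R L 1 + Im z *\<^sub>R L \<i>"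
      using assms by (simp only: linear_add linear_scale)
    finally show ?thesis .
  qed
  show ?thesis
    unfolding L[of v] L[of w] by (simp add: algebra_simps)
qed

text \<open>With determinant 0 all pairs of values of L would be dependent, although an injective L
  is surjective and takes the values 1 and \<open>\<i>\<close>.\<close>

lemma inj_linear_complex_det:
  fixes L :: "complex \<Rightarrow> complex"
  assumes L: "linear L" and inj: "inj L"
  shows "Im (cnj (L 1) * L \<i>) \<noteq> 0"
proof
  assume "Im (cnj (L 1) * L \<i>) = 0"
  then have zero: "Im (cnj (L v) * L w) = 0" for v w
    using linear_complex_det[OF L, of v w] by simp
  have "surj L"
    using linear_injective_imp_surjective[OF L inj] by simp
  then obtain v w where "1 = L v" "\<i> = L w"
    by (meson surjD)
  then have "Im (cnj 1 * \<i>) = 0"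
    using zero[of v w] by simp
  then show False
    by simp
qed

text \<open>The Jacobian determinant \<delta> at the fixed point z is continuous in time, never 0,
  and equal to 1 at time 0; by the intermediate value theorem it is positive at time 1.\<close>

lemma ambient_isotopy_orientation:
  assumes "ambient_isotopy H"
  obtains L where "(H 1 has_derivative L) (at z)" "Im (cnj (L 1) * L \<i>) > 0"
proof -
  obtain H' where H': "\<And>t z. t \<in> {0..1} \<Longrightarrow> (H t has_derivative H' t z) (at z) \<and> inj (H' t z)"
    and cont: "\<And>v. continuous_on ({0..1} \<times> UNIV) (\<lambda>(t, z). H' t z v)"
    and H0: "\<And>z. H 0 z = z"
    using assms unfolding ambient_isotopy_def by blast
  define \<delta> where "\<delta> t = Im (cnj (H' t z 1) * H' t z \<i>)" for t
  have cont_v: "continuous_on {0..1} (\<lambda>t. H' t z v)" for v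
  proof -
    have "continuous_on {0..1} (\<lambda>t. (t, z))"
      by (intro continuous_intros)
    moreover have "continuous_on ((\<lambda>t. (t, z)) ` {0..1}) (\<lambda>(t, z). H' t z v)"
      by (rule continuous_on_subset[OF cont]) auto
    ultimately show ?thesis
      using continuous_on_compose by (fastforce simp: o_def)
  qed
  have cont_\<delta>: "continuous_on {0..1} \<delta>"
    unfolding \<delta>_def by (intro continuous_intros cont_v)
  have nonzero: "\<delta> t \<noteq> 0" if "t \<in> {0..1}" for t
    unfolding \<delta>_def using H'[OF that, of z] by (intro inj_linear_complex_det) (auto dest: has_derivative_linear)
  have "H 0 = id"
    using H0 by auto
  then have "(H 0 has_derivative id) (at z)"
    by simp
  then have "H' 0 z = id"
    by (rule has_derivative_unique[rotated]) (use H'[of 0 z] in simp)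
  then have "\<delta> 0 = 1"
    by (simp add: \<delta>_def)
  have "\<delta> 1 > 0"
  proof (rule ccontr)
    assume "\<not> \<delta> 1 > 0"
    then obtain t where "0 \<le> t" "t \<le> 1" "\<delta> t = 0"
      using IVT2'[of \<delta> 1 0 0] cont_\<delta> \<open>\<delta> 0 = 1\<close> by auto
    then show False
      using nonzero by auto
  qed
  then show thesis
    using that H'[of 1 z] by (auto simp: \<delta>_def)
qed

lemma planar_isotopic_same_colorings:
  assumes D: "is_vdiagram D" and "planar_isotopic D D'"
  shows "same_colorings X under_op over_op D D'"
proof -
  interpret virtual_diagram D by unfold_locales (rule D)
  obtain H where H: "ambient_isotopy H" "ncircles D' = ncircles D" "over_under D' = over_under D"
    and img: "\<And>p. p \<in> source D \<Longrightarrow> image_pt D' p = H 1 (image_pt D p)"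
    using assms(2) unfolding planar_isotopic_def by blast
  have velocity: "velocity D' (i, cis t) = L (velocity D (i, cis t))"
    if i: "i < ncircles D" and L: "(H 1 has_derivative L) (at (curve D i (cis t)))" for i t L
  proof (rule velocity_eqI)
    have "(i, cis s) \<in> source D" for s
      using i source_cis by blast
    then have curve: "(\<lambda>s. curve D' i (cis s)) = H 1 \<circ> (\<lambda>s. curve D i (cis s))"
      using img[of "(i, cis _)"] by (simp add: image_pt_def fun_eq_iff)
    have "((\<lambda>s. curve D i (cis s)) has_derivative (\<lambda>h. h *\<^sub>R velocity D (i, cis t))) (at t)"
      using velocity_has_vector_derivative[OF i] by (simp add: has_vector_derivative_def)
    from diff_chain_at[OF this L] show "((\<lambda>s. curve D' i (cis s)) has_vector_derivative L (velocity D (i, cis t))) (at t)"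
      unfolding curve has_vector_derivative_def
      using has_derivative_linear[OF L] by (simp add: o_def linear_scale)
  qed
  show ?thesis
  proof (rule same_coloringsI_eq[OF H(2,3)])
    fix p q assume pq: "(p, q) \<in> over_under D"
    then have "(p, q) \<in> double_points D"
      using over_under_double by blast
    then have eq: "image_pt D p = image_pt D q" and "p \<in> source D" "q \<in> source D"
      by (auto simp: double_points_def)
    then obtain i s j t where p: "p = (i, cis s)" "i < ncircles D" and q: "q = (j, cis t)" "j < ncircles D"
      by (auto simp: source_cis)
    obtain L where L: "(H 1 has_derivative L) (at (image_pt D p))" "Im (cnj (L 1) * L \<i>) > 0"
      using ambient_isotopy_orientation[OF H(1)] by blast
    have "velocity D' p = L (velocity D p)"
      using velocity[OF p(2), of L s] L(1) by (simp add: p image_pt_def)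
    \<comment> \<open>The two branches meet at one point, so the same derivative L acts on both
      velocities and their determinant is multiplied by a positive number.\<close>
    moreover have "velocity D' q = L (velocity D q)"
      using velocity[OF q(2), of L t] L(1)[unfolded eq] by (simp add: q image_pt_def)
    ultimately show "crossing_direction D' p q = crossing_direction D p q"
      using L(2) linear_complex_det[OF has_derivative_linear[OF L(1)], of "velocity D p" "velocity D q"]
      by (simp only: crossing_direction_def sgn_mult sgn_pos mult_1)
  qed
qed

text \<open>An increasing surjection of the line is an order isomorphism, and one-sided
  neighbourhoods are described by the order alone.\<close>

lemma eventually_at_right_increasing:
  fixes f :: "real \<Rightarrow> real"
  assumes "strict_mono f" "surj f"
  shows "(\<forall>\<^sub>F s in at_right t. P (f s)) \<longleftrightarrow> (\<forall>\<^sub>F y in at_right (f t). P y)"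
    and "(\<forall>\<^sub>F s in at_left t. P (f s)) \<longleftrightarrow> (\<forall>\<^sub>F y in at_left (f t). P y)"
proof -
  have ex: "(\<exists>y. Q y) \<longleftrightarrow> (\<exists>s. Q (f s))" and all: "(\<forall>y. Q y) \<longleftrightarrow> (\<forall>s. Q (f s))" for Q
    using assms(2) by (metis surjD)+
  show "(\<forall>\<^sub>F s in at_right t. P (f s)) \<longleftrightarrow> (\<forall>\<^sub>F y in at_right (f t). P y)"
    unfolding eventually_at_right_field ex[of "\<lambda>b. b > f t \<and> _ b"] all[of "\<lambda>y. f t < y \<longrightarrow> _ y"]
      strict_mono_less[OF assms(1)] ..
  show "(\<forall>\<^sub>F s in at_left t. P (f s)) \<longleftrightarrow> (\<forall>\<^sub>F y in at_left (f t). P y)"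
    unfolding eventually_at_left_field ex[of "\<lambda>b. b < f t \<and> _ b"] all[of "\<lambda>y. _ < y \<longrightarrow> _ y"]
      strict_mono_less[OF assms(1)] ..
qed

lemma step_at_increasing:
  assumes "strict_mono f" "surj f"
  shows "step_at (\<lambda>s. g (f s)) t \<longleftrightarrow> step_at g (f t)"
  unfolding step_at_def by (simp add: eventually_at_right_increasing[OF assms, symmetric])

text \<open>A positive derivative gives strict monotonicity. For surjectivity, the values at
  multiples of 2 pi are shifts of \<phi> 0 and trap every y, and the intermediate value theorem
  applies.\<close>

lemma reparametrisation_lift:
  fixes \<phi> :: "real \<Rightarrow> real"
  assumes C1: "\<phi> C1_differentiable_on UNIV" and pos: "\<And>t. vector_derivative \<phi> (at t) > 0"
    and periodic: "\<And>t. \<phi> (t + 2 * pi) = \<phi> t + 2 * pi"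
  shows "(\<phi> has_vector_derivative vector_derivative \<phi> (at t)) (at t)"
    and "strict_mono \<phi>" and "surj \<phi>" and "\<phi> (t + 2 * pi * of_int n) = \<phi> t + 2 * pi * of_int n"
proof -
  show deriv: "(\<phi> has_vector_derivative vector_derivative \<phi> (at t)) (at t)" for t
    using C1 by (metis C1_differentiable_on_def UNIV_I vector_derivative_at)
  then have real_deriv: "(\<phi> has_real_derivative vector_derivative \<phi> (at t)) (at t)" for t
    by (simp add: has_real_derivative_iff_has_vector_derivative)
  show "strict_mono \<phi>"
    using DERIV_pos_imp_increasing real_deriv pos by (intro strict_monoI) blast
  have nat_shift: "\<phi> (t + 2 * pi * of_nat k) = \<phi> t + 2 * pi * of_nat k" for t k
  proof (induction k)
    case (Suc k)
    then show ?case
      using periodic[of "t + 2 * pi * of_nat k"] by (simp add: algebra_simps)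
  qed simp
  show shift: "\<phi> (t + 2 * pi * of_int n) = \<phi> t + 2 * pi * of_int n" for t n
  proof (cases "n \<ge> 0")
    case True
    then show ?thesis
      using nat_shift[of t "nat n"] by simp
  next
    case False
    then show ?thesis
      using nat_shift[of "t + 2 * pi * of_int n" "nat (- n)"] by simp
  qed
  show "surj \<phi>"
    unfolding surj_def
  proof
    fix y
    define n where "n = \<lfloor>(y - \<phi> 0) / (2 * pi)\<rfloor>"
    have "of_int n \<le> (y - \<phi> 0) / (2 * pi)" "(y - \<phi> 0) / (2 * pi) \<le> of_int (n + 1)"
      unfolding n_def by linarith+
    then have "\<phi> (2 * pi * of_int n) \<le> y" "y \<le> \<phi> (2 * pi * of_int (n + 1))"
      using shift[of 0 n] shift[of 0 "n + 1"] by (simp_all add: field_simps)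
    moreover have "2 * pi * of_int n \<le> 2 * pi * of_int (n + 1)"
      by (intro mult_left_mono) simp_all
    moreover have "continuous_on {2 * pi * of_int n..2 * pi * of_int (n + 1)} \<phi>"
      using real_deriv by (intro continuous_at_imp_continuous_on ballI DERIV_isCont)
    ultimately show "\<exists>t. y = \<phi> t"
      using IVT'[of \<phi> "2 * pi * of_int n" y "2 * pi * of_int (n + 1)"] by blast
  qed
qed

text \<open>Side labels are pulled back along the induced bijection \<Psi> of source points.
  Increasing lifts respect before and after, and velocities change by positive factors, so each
  clause of the coloring condition is preserved.\<close>

lemma reparametrised_same_colorings:
  fixes X :: "'a set"
  assumes D: "is_vdiagram D" and D': "is_vdiagram D'" and "reparametrised D D'"
  shows "same_colorings X under_op over_op D D'"
proof -
  interpret D: virtual_diagram D by unfold_locales (rule D)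
  interpret D': virtual_diagram D' by unfold_locales (rule D')
  obtain \<pi> \<phi> where \<pi>: "bij_betw \<pi> {..<ncircles D'} {..<ncircles D}"
    and \<phi>: "\<And>i. i < ncircles D' \<Longrightarrow> \<phi> i C1_differentiable_on UNIV"
      "\<And>i t. i < ncircles D' \<Longrightarrow> vector_derivative (\<phi> i) (at t) > (0::real)"
      "\<And>i t. i < ncircles D' \<Longrightarrow> \<phi> i (t + 2 * pi) = \<phi> i t + 2 * pi"
    and curve: "\<And>i t. i < ncircles D' \<Longrightarrow> curve D' i (cis t) = curve D (\<pi> i) (cis (\<phi> i t))"
    and ou: "\<And>i j s t. i < ncircles D' \<Longrightarrow> j < ncircles D' \<Longrightarrow>
      ((i, cis s), (j, cis t)) \<in> over_under D' \<longleftrightarrow>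
        ((\<pi> i, cis (\<phi> i s)), (\<pi> j, cis (\<phi> j t))) \<in> over_under D"
    using assms(3) unfolding reparametrised_def by blast
  have lift: "(\<phi> i has_vector_derivative vector_derivative (\<phi> i) (at t)) (at t)" "strict_mono (\<phi> i)"
    "surj (\<phi> i)" "\<phi> i (t + 2 * pi * of_int n) = \<phi> i t + 2 * pi * of_int n" if "i < ncircles D'" for i t n
    by (rule reparametrisation_lift; rule \<phi>[OF that])+
  have \<pi>_less: "\<pi> i < ncircles D" if "i < ncircles D'" for i
    using bij_betwE[OF \<pi>] that by blast
  \<comment> \<open>\<open>Arg\<close> selects one parameter of the point; the result is independent
    of this choice because \<phi> commutes with shifts by 2 pi.\<close>
  define \<Psi> where "\<Psi> p = (\<pi> (fst p), cis (\<phi> (fst p) (Arg (snd p))))" for p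
  have \<Psi>: "\<Psi> (i, cis t) = (\<pi> i, cis (\<phi> i t))" if i: "i < ncircles D'" for i t
  proof -
    have "cis (Arg (cis t)) = cis t"
      using cis_Arg[of "cis t"] by (simp add: sgn_div_norm)
    then obtain n :: int where "Arg (cis t) = t + 2 * pi * of_int n"
      using cis_eq_cis_iff by blast
    then have "\<phi> i (Arg (cis t)) = \<phi> i t + 2 * pi * of_int n"
      using lift(4)[OF i] by simp
    then show ?thesis
      using cis_eq_cis_iff by (auto simp: \<Psi>_def)
  qed
  have inj: "inj_on \<Psi> (source D')"
  proof (rule inj_onI)
    fix p q assume "p \<in> source D'" "q \<in> source D'" and eq: "\<Psi> p = \<Psi> q"
    then obtain i s j t where p: "p = (i, cis s)" "i < ncircles D'" and q: "q = (j, cis t)" "j < ncircles D'"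
      by (auto simp: source_cis)
    have "\<pi> i = \<pi> j"
      using eq p q \<Psi> by simp
    then have "i = j"
      using \<pi> p q by (auto simp: bij_betw_def dest: inj_onD)
    then have "cis (\<phi> i s) = cis (\<phi> i t)"
      using eq p q \<Psi> by simp
    then obtain n :: int where "\<phi> i s = \<phi> i (t + 2 * pi * of_int n)"
      using cis_eq_cis_iff[of "\<phi> i s" "\<phi> i t"] lift(4)[OF p(2)] by metis
    then have "s = t + 2 * pi * of_int n"
      using strict_mono_eq[OF lift(2)[OF p(2)]] by blast
    then show "p = q"
      using \<open>i = j\<close> p q cis_eq_cis_iff by auto
  qed
  have img: "\<Psi> ` source D' = source D"
  proof (intro equalityI subsetI)
    fix q assume "q \<in> source D"
    then obtain j t where q: "q = (j, cis t)" "j < ncircles D"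
      by (auto simp: source_cis)
    then obtain i where i: "i < ncircles D'" "j = \<pi> i"
      using \<pi> by (auto simp: bij_betw_def)
    obtain s where "t = \<phi> i s"
      using lift(3)[OF i(1)] by (meson surjD)
    then have "q = \<Psi> (i, cis s)" "(i, cis s) \<in> source D'"
      using q i \<Psi> by (auto simp: source_cis)
    then show "q \<in> \<Psi> ` source D'"
      by blast
  next
    fix q assume "q \<in> \<Psi> ` source D'"
    then obtain i t where "i < ncircles D'" "q = \<Psi> (i, cis t)"
      by (auto simp: source_cis)
    then show "q \<in> source D"
      using \<Psi> \<pi>_less by (auto simp: source_cis)
  qed
  have ou_\<Psi>: "(p, q) \<in> over_under D' \<longleftrightarrow> (\<Psi> p, \<Psi> q) \<in> over_under D" if "p \<in> source D'" "q \<in> source D'" for p q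
    using that ou \<Psi> by (auto simp: source_cis)
  have cut_\<Psi>: "is_cut D' p \<longleftrightarrow> is_cut D (\<Psi> p)" if p: "p \<in> source D'" for p
  proof
    assume "is_cut D' p"
    then obtain q where "classical_at D' p q" "q \<in> source D'"
      unfolding is_cut_def using D'.classical_at_source by blast
    then have "classical_at D (\<Psi> p) (\<Psi> q)"
      using ou_\<Psi> p by (simp add: classical_at_def)
    then show "is_cut D (\<Psi> p)"
      unfolding is_cut_def by blast
  next
    assume "is_cut D (\<Psi> p)"
    then obtain r where r: "classical_at D (\<Psi> p) r" "r \<in> source D"
      unfolding is_cut_def using D.classical_at_source by blast
    then obtain q where q: "q \<in> source D'" "r = \<Psi> q"
      using img by blast
    then have "classical_at D' p q"
      using ou_\<Psi> p r(1) by (simp add: classical_at_def)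
    then show "is_cut D' p"
      unfolding is_cut_def by blast
  qed
  have velocity: "\<exists>r>0. velocity D' p = r *\<^sub>R velocity D (\<Psi> p)" if p: "p \<in> source D'" for p
  proof -
    obtain i t where i: "p = (i, cis t)" "i < ncircles D'"
      using p by (auto simp: source_cis)
    have "((\<lambda>s. curve D' i (cis s)) has_vector_derivative
        vector_derivative (\<phi> i) (at t) *\<^sub>R velocity D (\<Psi> p)) (at t)"
      using vector_diff_chain_at[OF lift(1)[OF i(2)]
          D.velocity_has_vector_derivative[OF \<pi>_less[OF i(2)], of "\<phi> i t"]]
      by (simp add: o_def curve[OF i(2)] \<Psi> i)
    then show ?thesis
      using velocity_eqI \<phi>(2)[OF i(2)] i(1) by blast
  qed
  have dir: "crossing_direction D' p q = crossing_direction D (\<Psi> p) (\<Psi> q)"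
    if "p \<in> source D'" "q \<in> source D'" for p q
  proof -
    obtain r where "r > 0" "velocity D' p = r *\<^sub>R velocity D (\<Psi> p)"
      using velocity \<open>p \<in> source D'\<close> by blast
    moreover obtain r' where "r' > 0" "velocity D' q = r' *\<^sub>R velocity D (\<Psi> q)"
      using velocity \<open>q \<in> source D'\<close> by blast
    moreover have "Im (cnj (r *\<^sub>R v) * (r' *\<^sub>R w)) = r * r' * Im (cnj v * w)" for v w
      by (simp add: algebra_simps)
    ultimately show ?thesis
      by (simp add: crossing_direction_def sgn_mult)
  qed
  \<comment> \<open>An equivalence rather than an implication, so that it yields both existence of
    the pulled-back coloring and existence of a preimage. Extensionality of c makes membership
    readable from its values on the source.\<close>
  have transfer: "(\<lambda>p\<in>source D'. c (\<Psi> p)) \<in> side_colorings X under_op over_op D' \<longleftrightarrow>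
      c \<in> side_colorings X under_op over_op D" if ext: "c \<in> extensional (source D)" for c :: "source_point \<Rightarrow> 'a \<times> 'a"
  proof -
    let ?c = "\<lambda>p\<in>source D'. c (\<Psi> p)"
    have all: "(\<forall>q\<in>source D. P q) \<longleftrightarrow> (\<forall>p\<in>source D'. P (\<Psi> p))" for P
      unfolding img[symmetric] by blast
    have "?c \<in> source D' \<rightarrow>\<^sub>E X \<times> X \<longleftrightarrow> c \<in> source D \<rightarrow>\<^sub>E X \<times> X"
      using ext all[of "\<lambda>q. c q \<in> X \<times> X"] by (auto simp: PiE_def Pi_def)
    moreover have "(\<forall>i<ncircles D'. \<forall>t. step_at (\<lambda>s. ?c (i, cis s)) t) \<longleftrightarrow>
        (\<forall>j<ncircles D. \<forall>t. step_at (\<lambda>s. c (j, cis s)) t)"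
    proof -
      have "(\<forall>t. step_at (\<lambda>s. ?c (i, cis s)) t) \<longleftrightarrow> (\<forall>t. step_at (\<lambda>s. c (\<pi> i, cis s)) t)"
        if i: "i < ncircles D'" for i
      proof -
        have "(i, cis s) \<in> source D'" for s
          using i source_cis by blast
        then have "step_at (\<lambda>s. ?c (i, cis s)) t \<longleftrightarrow> step_at (\<lambda>s. c (\<pi> i, cis s)) (\<phi> i t)" for t
          using step_at_increasing[OF lift(2,3)[OF i], of "\<lambda>s. c (\<pi> i, cis s)"] by (simp add: \<Psi>[OF i])
        then show ?thesis
          using lift(3)[OF i] by (metis surjD)
      qed
      moreover have "(\<forall>j<ncircles D. P j) \<longleftrightarrow> (\<forall>i<ncircles D'. P (\<pi> i))" for P
        using \<pi> unfolding bij_betw_def by (metis (no_types, lifting) image_iff lessThan_iff)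
      ultimately show ?thesis
        by simp
    qed
    moreover have "(\<forall>p\<in>source D'. \<not> is_cut D' p \<longrightarrow> fst (?c p) = snd (?c p)) \<longleftrightarrow>
        (\<forall>q\<in>source D. \<not> is_cut D q \<longrightarrow> fst (c q) = snd (c q))"
      unfolding all by (simp add: cut_\<Psi>)
    moreover have "(\<forall>(p, q)\<in>over_under D'. crossing_rule under_op over_op (crossing_direction D' p q) (?c p) (?c q)) \<longleftrightarrow>
        (\<forall>(p, q)\<in>over_under D. crossing_rule under_op over_op (crossing_direction D p q) (c p) (c q))"
      (is "?L \<longleftrightarrow> ?R")
    proof -
      have "?L \<longleftrightarrow> (\<forall>p\<in>source D'. \<forall>q\<in>source D'. (p, q) \<in> over_under D' \<longrightarrow>
          crossing_rule under_op over_op (crossing_direction D' p q) (?c p) (?c q))"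
        using D'.over_under_source by blast
      also have "\<dots> \<longleftrightarrow> (\<forall>p\<in>source D'. \<forall>q\<in>source D'. (\<Psi> p, \<Psi> q) \<in> over_under D \<longrightarrow>
          crossing_rule under_op over_op (crossing_direction D (\<Psi> p) (\<Psi> q)) (c (\<Psi> p)) (c (\<Psi> q)))"
        by (simp add: ou_\<Psi> dir)
      also have "\<dots> \<longleftrightarrow> (\<forall>p\<in>source D. \<forall>q\<in>source D. (p, q) \<in> over_under D \<longrightarrow>
          crossing_rule under_op over_op (crossing_direction D p q) (c p) (c q))"
        unfolding all ..
      also have "\<dots> \<longleftrightarrow> ?R"
        using D.over_under_source by blast
      finally show ?thesis .
    qed
    ultimately show ?thesis
      unfolding side_colorings_def mem_Collect_eq by argo
  qed
  show ?thesis
  proof (rule same_coloringsI[where R = "\<lambda>c c'. \<forall>p\<in>source D'. c' p = c (\<Psi> p)", OF _ _ _ _ _ D D'])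
    fix c assume "c \<in> side_colorings X under_op over_op D"
    then show "\<exists>c'\<in>side_colorings X under_op over_op D'. \<forall>p\<in>source D'. c' p = c (\<Psi> p)"
      using transfer[of c] side_colorings_PiE[of c] by (intro bexI[of _ "\<lambda>p\<in>source D'. c (\<Psi> p)"]) (auto simp: PiE_def)
  next
    fix c' assume c': "c' \<in> side_colorings X under_op over_op D'"
    define c where "c = (\<lambda>q\<in>source D. c' (inv_into (source D') \<Psi> q))"
    have c: "c' p = c (\<Psi> p)" if "p \<in> source D'" for p
      using that img inj by (auto simp: c_def)
    have "(\<lambda>p\<in>source D'. c (\<Psi> p)) = c'"
      using c side_colorings_PiE[OF c'] by (intro extensionalityI[of _ "source D'"]) (auto simp: PiE_def)
    then have "c \<in> side_colorings X under_op over_op D"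
      using transfer[of c] c' by (simp add: c_def)
    then show "\<exists>c\<in>side_colorings X under_op over_op D. \<forall>p\<in>source D'. c' p = c (\<Psi> p)"
      using c by blast
  next
    fix c c' c''
    assume *: "c' \<in> side_colorings X under_op over_op D'" "c'' \<in> side_colorings X under_op over_op D'"
      "\<forall>p\<in>source D'. c' p = c (\<Psi> p)" "\<forall>p\<in>source D'. c'' p = c (\<Psi> p)"
    then show "c' = c''"
      using side_colorings_PiE[OF *(1)] side_colorings_PiE[OF *(2)] by (intro PiE_ext) auto
  next
    fix c c' c''
    assume *: "c \<in> side_colorings X under_op over_op D" "c' \<in> side_colorings X under_op over_op D"
      "\<forall>p\<in>source D'. c'' p = c (\<Psi> p)" "\<forall>p\<in>source D'. c'' p = c' (\<Psi> p)"
    show "c = c'"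
    proof (rule PiE_ext[OF side_colorings_PiE[OF *(1)] side_colorings_PiE[OF *(2)]])
      fix q assume "q \<in> source D"
      then obtain p where "p \<in> source D'" "q = \<Psi> p"
        unfolding img[symmetric] by blast
      then show "c q = c' q"
        using *(3,4) by metis
    qed
  next
    fix \<alpha> and c c' :: "source_point \<Rightarrow> 'a \<times> 'a"
    assume "\<forall>p\<in>source D'. c' p = c (\<Psi> p)"
    then show "\<forall>p\<in>source D'. side_act D' \<alpha> c' p = side_act D \<alpha> c (\<Psi> p)"
      using img by (auto simp: side_act_def compose_def)
  qed
qed

section \<open>Local changes\<close>

text \<open>At the end of a strand the new labels take over from the old ones, so different formulas
  describe the two sides of t.\<close>

lemma step_at_glue:
  assumes "\<forall>\<^sub>F s in at_right t. g s = g\<^sub>1 s" "\<forall>\<^sub>F s in at_left t. g s = g\<^sub>2 s"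
    and "g t = g\<^sub>1 t" "g t = g\<^sub>2 t" "step_at g\<^sub>1 t" "step_at g\<^sub>2 t"
  shows "step_at g t"
  using assms unfolding step_at_def by (auto elim: eventually_elim2)

text \<open>Equal components at the interior points leave no jump there, so g is locally constant on
  a connected interval; the one-sided conditions at x and y attach the constant to the ends.\<close>

lemma step_at_constant:
  assumes step: "\<And>t. step_at g t" and diag: "\<And>t. x < t \<Longrightarrow> t < y \<Longrightarrow> fst (g t) = snd (g t)" and "x < y"
  shows "\<And>t. x < t \<Longrightarrow> t < y \<Longrightarrow> g t = (snd (g x), snd (g x))" and "fst (g y) = snd (g x)"
proof -
  have const: "g s = g t" if "s \<in> {x<..<y}" "t \<in> {x<..<y}" for s t
  proof (rule connected_local_const[OF _ that])
    show "connected {x<..<y}"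
      by simp
    show "\<forall>s\<in>{x<..<y}. \<forall>\<^sub>F t in at s within {x<..<y}. g s = g t"
    proof
      fix s assume "s \<in> {x<..<y}"
      then have "\<forall>\<^sub>F t in at s. g s = g t"
        using step[of s] diag[of s] by (simp add: step_at_def eventually_at_split prod_eq_iff eq_commute)
      then show "\<forall>\<^sub>F t in at s within {x<..<y}. g s = g t"
        by (rule filter_leD[OF at_le, rotated]) simp
    qed
  qed
  have "\<forall>\<^sub>F s in at_right x. g s = (snd (g x), snd (g x)) \<and> s \<in> {x<..<y}"
    using step[of x] eventually_at_right_real[OF \<open>x < y\<close>] by (simp add: step_at_def eventually_conj_iff)
  then obtain s where s: "g s = (snd (g x), snd (g x))" "s \<in> {x<..<y}"
    using eventually_happens'[OF trivial_limit_at_right_real] by blast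
  then show inner: "g t = (snd (g x), snd (g x))" if "x < t" "t < y" for t
    using const[of t s] that by simp
  have "\<forall>\<^sub>F s in at_left y. g s = (fst (g y), fst (g y)) \<and> s \<in> {x<..<y}"
    using step[of y] eventually_at_left_real[OF \<open>x < y\<close>] by (simp add: step_at_def eventually_conj_iff)
  then obtain s where s: "g s = (fst (g y), fst (g y))" "s \<in> {x<..<y}"
    using eventually_happens'[OF trivial_limit_at_left_real] by blast
  then show "fst (g y) = snd (g x)"
    using inner[of s] by simp
qed

text \<open>The step function with values v0, v1, v2 and jumps at m1 and m2. The first component is
  the limit from the left, hence the non-strict comparisons; the second is the limit from the right,
  hence the strict ones.\<close>

definition two_step :: "real \<times> real \<Rightarrow> 'a \<times> 'a \<times> 'a \<Rightarrow> real \<Rightarrow> 'a \<times> 'a" where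
  "two_step m v t = (case m of (m1, m2) \<Rightarrow> case v of (v0, v1, v2) \<Rightarrow>
     (if t \<le> m1 then v0 else if t \<le> m2 then v1 else v2,
      if t < m1 then v0 else if t < m2 then v1 else v2))"

lemma two_step_marks:
  assumes "fst m < snd m"
  shows "two_step m v (fst m) = (fst v, fst (snd v))" "two_step m v (snd m) = (fst (snd v), snd (snd v))"
  using assms by (cases m; cases v; simp add: two_step_def)+

lemma step_at_two_step:
  assumes "fst m < snd m"
  shows "step_at (two_step m v) t"
proof -
  obtain m1 m2 v0 v1 v2 where [simp]: "m = (m1, m2)" "v = (v0, v1, v2)"
    by (cases m, cases v) auto
  \<comment> \<open>Up to r on the right and l on the left there is no further mark; they are the
    neighbouring marks, or points at distance 1 where no mark follows.\<close>
  define r where "r = (if t < m1 then m1 else if t < m2 then m2 else t + 1)"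
  define l where "l = (if t \<le> m1 then t - 1 else if t \<le> m2 then m1 else m2)"
  have "\<forall>s>t. s < r \<longrightarrow> two_step m v s = (snd (two_step m v t), snd (two_step m v t))" "r > t"
    using assms by (auto simp: two_step_def r_def)
  moreover have "\<forall>s>l. s < t \<longrightarrow> two_step m v s = (fst (two_step m v t), fst (two_step m v t))" "l < t"
    using assms by (auto simp: two_step_def l_def)
  ultimately show ?thesis
    unfolding step_at_def eventually_at_right_field eventually_at_left_field by blast
qed

text \<open>The over-strand with its parameter comes first, the under-strand with its parameter
  second.\<close>

type_synonym local_crossing = "strand \<times> real \<times> strand \<times> real"

definition crossed :: "local_crossing set \<Rightarrow> strand \<Rightarrow> real \<Rightarrow> bool" where
  "crossed C \<sigma> t \<longleftrightarrow> (\<exists>\<tau> s. (\<sigma>, t, \<tau>, s) \<in> C \<or> (\<tau>, s, \<sigma>, t) \<in> C)"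

definition local_crossings :: "strand list \<Rightarrow> vdiagram \<Rightarrow> local_crossing set \<Rightarrow> bool" where
  "local_crossings \<sigma>s E C \<longleftrightarrow>
     over_under E \<inter> strand_set \<sigma>s \<times> strand_set \<sigma>s =
       (\<lambda>(\<sigma>, s, \<tau>, t). (on_strand \<sigma> s, on_strand \<tau> t)) ` C \<and>
     (\<forall>(\<sigma>, s, \<tau>, t)\<in>C. \<sigma> \<in> set \<sigma>s \<and> s \<in> inner_params \<sigma> \<and> \<tau> \<in> set \<sigma>s \<and> t \<in> inner_params \<tau>)"

definition marked :: "strand list \<Rightarrow> local_crossing set \<Rightarrow> (strand \<Rightarrow> real \<times> real) \<Rightarrow> bool" where
  "marked \<sigma>s C m \<longleftrightarrow>
     (\<forall>\<sigma>\<in>set \<sigma>s. fst (m \<sigma>) < snd (m \<sigma>) \<and> fst (m \<sigma>) \<in> inner_params \<sigma> \<and> snd (m \<sigma>) \<in> inner_params \<sigma> \<and>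
        (\<forall>t. crossed C \<sigma> t \<longrightarrow> t = fst (m \<sigma>) \<or> t = snd (m \<sigma>)))"

text \<open>
  The marks \<open>m \<sigma>\<close> cut the strand \<open>\<sigma>\<close> into three pieces, labeled by \<open>v \<sigma>\<close>. Marks without a classical
  crossing are allowed, so that all strands of all moves have the same shape.
\<close>

definition fits ::
    "'a set \<Rightarrow> ('a \<Rightarrow> 'a \<Rightarrow> 'a) \<Rightarrow> ('a \<Rightarrow> 'a \<Rightarrow> 'a) \<Rightarrow> strand list \<Rightarrow> vdiagram \<Rightarrow> local_crossing set \<Rightarrow>
     (strand \<Rightarrow> real \<times> real) \<Rightarrow> (strand \<Rightarrow> 'a \<times> 'a \<times> 'a) \<Rightarrow> bool" where
  "fits X under_op over_op \<sigma>s E C m v \<longleftrightarrow>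
     (\<forall>\<sigma>\<in>set \<sigma>s. v \<sigma> \<in> X \<times> X \<times> X \<and>
        (\<not> crossed C \<sigma> (fst (m \<sigma>)) \<longrightarrow> fst (v \<sigma>) = fst (snd (v \<sigma>))) \<and>
        (\<not> crossed C \<sigma> (snd (m \<sigma>)) \<longrightarrow> fst (snd (v \<sigma>)) = snd (snd (v \<sigma>)))) \<and>
     (\<forall>(\<sigma>, s, \<tau>, t)\<in>C. crossing_rule under_op over_op
        (crossing_direction E (on_strand \<sigma> s) (on_strand \<tau> t))
        (two_step (m \<sigma>) (v \<sigma>) s) (two_step (m \<tau>) (v \<tau>) t))"

definition same_ends :: "strand list \<Rightarrow> (strand \<Rightarrow> 'a \<times> 'a \<times> 'a) \<Rightarrow> (strand \<Rightarrow> 'a \<times> 'a \<times> 'a) \<Rightarrow> bool" where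
  "same_ends \<sigma>s v v' \<longleftrightarrow>
     (\<forall>\<sigma>\<in>set \<sigma>s. fst (v' \<sigma>) = fst (v \<sigma>) \<and> snd (snd (v' \<sigma>)) = snd (snd (v \<sigma>)))"

locale local_change = D: virtual_diagram D + D': virtual_diagram D' for D D' +
  fixes \<sigma>s :: "strand list"
  assumes change: "disc_change \<sigma>s D D'"
    and interior: "double_points_on \<sigma>s D \<subseteq> strand_interior \<sigma>s \<times> strand_interior \<sigma>s"
    and interior': "double_points_on \<sigma>s D' \<subseteq> strand_interior \<sigma>s \<times> strand_interior \<sigma>s"
begin

text \<open>The definition of a disc change treats the two diagrams alike; lemmas proved for D are
  used for D' through this exchange.\<close>

lemma local_change_sym: "local_change D' D \<sigma>s"
proof
  have "ncircles D' = ncircles D"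
    using change by (simp add: disc_change_def)
  then have "source D' = source D" "is_strand D' = is_strand D"
    by (simp_all add: source_def is_strand_def fun_eq_iff)
  then show "disc_change \<sigma>s D' D"
    using change unfolding disc_change_def by (simp add: insert_commute)
qed (fact interior interior')+

lemma ncircles: "ncircles D' = ncircles D"
  using change by (simp add: disc_change_def)

lemma source: "source D' = source D"
  by (simp add: source_def ncircles)

section \<open>Geometry of the strands\<close>

lemma strand: "(i, a, b) \<in> set \<sigma>s \<Longrightarrow> i < ncircles D \<and> a < b \<and> b < a + 2 * pi"
  using change by (auto simp: disc_change_def is_strand_def)

lemma in_strand_set: "p \<in> strand_set \<sigma>s \<longleftrightarrow> (\<exists>\<sigma>\<in>set \<sigma>s. \<exists>t\<in>params \<sigma>. p = on_strand \<sigma> t)"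
  by (auto simp: strand_set_def)

lemma in_strand_interior: "p \<in> strand_interior \<sigma>s \<longleftrightarrow> (\<exists>\<sigma>\<in>set \<sigma>s. \<exists>t\<in>inner_params \<sigma>. p = on_strand \<sigma> t)"
  by (auto simp: strand_interior_def)

lemma inner_params_subset: "inner_params \<sigma> \<subseteq> params \<sigma>"
  by (auto simp: inner_params_def params_def)

lemma strand_interior_subset: "strand_interior \<sigma>s \<subseteq> strand_set \<sigma>s"
  using inner_params_subset by (fastforce simp: in_strand_set in_strand_interior)

lemma on_strand_source: "\<sigma> \<in> set \<sigma>s \<Longrightarrow> on_strand \<sigma> t \<in> source D"
  using strand by (cases \<sigma>) (auto simp: on_strand_def source_def)

lemma strand_set_source: "strand_set \<sigma>s \<subseteq> source D"
  using on_strand_source by (auto simp: in_strand_set)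

lemma strands_disjoint:
  assumes "\<sigma> \<in> set \<sigma>s" "\<tau> \<in> set \<sigma>s" "\<sigma> \<noteq> \<tau>"
  shows "disjnt (strand_set [\<sigma>]) (strand_set [\<tau>])"
proof -
  obtain m n where mn: "m < length \<sigma>s" "n < length \<sigma>s" "\<sigma> = \<sigma>s ! m" "\<tau> = \<sigma>s ! n"
    using assms by (metis in_set_conv_nth)
  have "\<forall>m<length \<sigma>s. \<forall>n<m. disjnt (strand_set [\<sigma>s ! m]) (strand_set [\<sigma>s ! n])"
    using change by (simp add: disc_change_def)
  moreover have "m \<noteq> n"
    using assms(3) mn by auto
  ultimately show ?thesis
    using mn disjnt_sym by (metis nat_neq_iff)
qed

lemma cis_eq_iff_near:
  assumes "\<bar>s - t\<bar> < 2 * pi"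
  shows "cis s = cis t \<longleftrightarrow> s = t"
proof
  assume "cis s = cis t"
  then obtain n :: int where n: "s = t + 2 * pi * of_int n"
    using cis_eq_cis_iff[of s t] by metis
  then have "2 * pi * \<bar>of_int n\<bar> < 2 * pi * 1"
    using assms by (simp add: abs_mult)
  then have "\<bar>of_int n\<bar> < (1::real)"
    by (subst (asm) mult_less_cancel_left_pos) simp_all
  then show "s = t"
    using n by simp
qed simp

text \<open>Different strands are disjoint, and a strand covers less than a full turn, so
  \<open>cis\<close> is injective on its parameters.\<close>

lemma on_strand_eq_iff:
  assumes "\<sigma> \<in> set \<sigma>s" "\<tau> \<in> set \<sigma>s" "s \<in> params \<sigma>" "t \<in> params \<tau>"
  shows "on_strand \<sigma> s = on_strand \<tau> t \<longleftrightarrow> \<sigma> = \<tau> \<and> s = t"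
proof
  assume eq: "on_strand \<sigma> s = on_strand \<tau> t"
  have "\<sigma> = \<tau>"
  proof (rule ccontr)
    assume "\<sigma> \<noteq> \<tau>"
    moreover have "on_strand \<sigma> s \<in> strand_set [\<sigma>]" "on_strand \<tau> t \<in> strand_set [\<tau>]"
      using assms by (auto simp: strand_set_def)
    ultimately show False
      using strands_disjoint[OF assms(1,2)] eq unfolding disjnt_iff by metis
  qed
  obtain i a b where \<tau>: "\<tau> = (i, a, b)"
    by (cases \<tau>)
  have "cis s = cis t"
    using eq by (simp add: on_strand_def)
  moreover have "\<bar>s - t\<bar> < 2 * pi"
    using assms strand[of i a b] \<open>\<sigma> = \<tau>\<close> by (auto simp: \<tau> params_def)
  ultimately show "\<sigma> = \<tau> \<and> s = t"
    using \<open>\<sigma> = \<tau>\<close> cis_eq_iff_near by blast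
qed simp

text \<open>Lying on a strand is decided by whether the image lies in the disc B, and the two source
  points of a double point have the same image.\<close>

lemma double_point_sides:
  "(p, q) \<in> double_points D \<Longrightarrow> p \<in> strand_set \<sigma>s \<longleftrightarrow> q \<in> strand_set \<sigma>s"
proof -
  assume pq: "(p, q) \<in> double_points D"
  obtain B where "\<forall>E\<in>{D, D'}. \<forall>p\<in>source E.
      (image_pt E p \<in> B \<longleftrightarrow> p \<in> strand_set \<sigma>s) \<and> (image_pt E p \<in> interior B \<longleftrightarrow> p \<in> strand_interior \<sigma>s)"
    using change unfolding disc_change_def by blast
  then have "image_pt D p \<in> B \<longleftrightarrow> p \<in> strand_set \<sigma>s" if "p \<in> source D" for p
    using that by blast
  moreover have "p \<in> source D" "q \<in> source D" "image_pt D p = image_pt D q"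
    using pq by (simp_all add: double_points_def)
  ultimately show ?thesis
    by metis
qed

lemma over_under_outside:
  assumes "p \<notin> strand_set \<sigma>s"
  shows "(p, q) \<in> over_under D' \<longleftrightarrow> (p, q) \<in> over_under D"
    and "(q, p) \<in> over_under D' \<longleftrightarrow> (q, p) \<in> over_under D"
proof -
  have "over_under D' - strand_set \<sigma>s \<times> strand_set \<sigma>s = over_under D - strand_set \<sigma>s \<times> strand_set \<sigma>s"
    using change by (simp add: disc_change_def)
  then show "(p, q) \<in> over_under D' \<longleftrightarrow> (p, q) \<in> over_under D"
    "(q, p) \<in> over_under D' \<longleftrightarrow> (q, p) \<in> over_under D"
    using assms by blast+
qed

lemma is_cut_outside: "p \<notin> strand_set \<sigma>s \<Longrightarrow> is_cut D' p \<longleftrightarrow> is_cut D p"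
  by (simp add: is_cut_def classical_at_def over_under_outside)

text \<open>Strands are compact images of closed intervals, so their union is closed.\<close>

lemma eventually_avoids_strands:
  assumes "(i, cis t) \<notin> strand_set \<tau>s"
  shows "\<forall>\<^sub>F s in nhds t. (i, cis s) \<notin> strand_set \<tau>s"
proof -
  have "closed (on_strand \<sigma> ` params \<sigma>)" for \<sigma>
  proof -
    have "compact (params \<sigma>)"
      by (simp add: params_def)
    moreover have "continuous_on (params \<sigma>) (on_strand \<sigma>)"
      unfolding on_strand_def[abs_def] by (intro continuous_intros)
    ultimately show ?thesis
      by (intro compact_imp_closed compact_continuous_image)
  qed
  then have "closed (strand_set \<tau>s)"
    unfolding strand_set_def by (intro closed_UN) auto
  moreover have "continuous_on UNIV (\<lambda>s. (i, cis s))"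
    by (intro continuous_intros)
  ultimately have "open ((\<lambda>s. (i, cis s)) -` (- strand_set \<tau>s))"
    by (intro open_vimage) auto
  then show ?thesis
    using assms eventually_nhds_in_open[of "(\<lambda>s. (i, cis s)) -` (- strand_set \<tau>s)" t] by simp
qed

text \<open>A derivative needs agreement in a neighbourhood: off the closed strands all nearby
  points are off the strands too, and there the curves coincide.\<close>

lemma velocity_outside:
  assumes p: "p \<in> source D" "p \<notin> strand_set \<sigma>s"
  shows "velocity D' p = velocity D p"
proof -
  obtain i t where i: "p = (i, cis t)" "i < ncircles D"
    using p by (auto simp: source_cis)
  have "\<forall>\<^sub>F s in nhds t. (i, cis s) \<notin> strand_set \<sigma>s"
    using eventually_avoids_strands p(2) i(1) by blast
  then have ev: "\<forall>\<^sub>F s in nhds t. curve D i (cis s) = curve D' i (cis s)"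
  proof (rule eventually_mono)
    fix s assume "(i, cis s) \<notin> strand_set \<sigma>s"
    moreover have "(i, cis s) \<in> source D"
      using i(2) source_cis by blast
    ultimately have "image_pt D' (i, cis s) = image_pt D (i, cis s)"
      using change strand_interior_subset unfolding disc_change_def by blast
    then show "curve D i (cis s) = curve D' i (cis s)"
      by (simp add: image_pt_def)
  qed
  have "((\<lambda>s. curve D' i (cis s)) has_vector_derivative velocity D p) (at t)"
    using D.velocity_has_vector_derivative[OF i(2), of t] i(1)
      has_vector_derivative_cong_ev[of UNIV "\<lambda>s. curve D i (cis s)" "\<lambda>s. curve D' i (cis s)" t]
      ev eventually_nhds_x_imp_x[OF ev] by simp
  then show ?thesis
    using velocity_eqI i(1) by blast
qed

lemma crossing_direction_outside:
  assumes "(p, q) \<in> over_under D" "p \<notin> strand_set \<sigma>s"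
  shows "crossing_direction D' p q = crossing_direction D p q"
proof -
  have "(p, q) \<in> double_points D"
    using D.over_under_double assms(1) by blast
  then have "q \<notin> strand_set \<sigma>s"
    using double_point_sides assms(2) by blast
  then show ?thesis
    using velocity_outside D.over_under_source[OF assms(1)] assms(2) by (simp add: crossing_direction_def)
qed

section \<open>Reading and rewriting the labels along strands\<close>

lemma local_crossingsD:
  assumes "local_crossings \<sigma>s E C" "(\<sigma>, s, \<tau>, t) \<in> C"
  shows "\<sigma> \<in> set \<sigma>s" "s \<in> params \<sigma>" "\<tau> \<in> set \<sigma>s" "t \<in> params \<tau>"
    "(on_strand \<sigma> s, on_strand \<tau> t) \<in> over_under E"
proof -
  show "\<sigma> \<in> set \<sigma>s" "s \<in> params \<sigma>" "\<tau> \<in> set \<sigma>s" "t \<in> params \<tau>"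
    using bspec[OF conjunct2[OF assms(1)[unfolded local_crossings_def]] assms(2)]
      subsetD[OF inner_params_subset] by simp_all
  have "(on_strand \<sigma> s, on_strand \<tau> t) \<in> (\<lambda>(\<sigma>, s, \<tau>, t). (on_strand \<sigma> s, on_strand \<tau> t)) ` C"
    using assms(2) by force
  then show "(on_strand \<sigma> s, on_strand \<tau> t) \<in> over_under E"
    using assms(1) unfolding local_crossings_def by blast
qed

text \<open>A point on a strand can only cross another point on a strand, so C records every
  classical crossing it has, and its parameter is unique.\<close>

lemma is_cut_on_strand:
  assumes C: "local_crossings \<sigma>s D C" and \<sigma>: "\<sigma> \<in> set \<sigma>s" and t: "t \<in> params \<sigma>"
  shows "is_cut D (on_strand \<sigma> t) \<longleftrightarrow> crossed C \<sigma> t"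
proof -
  let ?f = "\<lambda>(\<sigma>, s, \<tau>, t). (on_strand \<sigma> s, on_strand \<tau> t)"
  have img: "over_under D \<inter> strand_set \<sigma>s \<times> strand_set \<sigma>s = ?f ` C"
    and ps: "\<And>\<sigma> s \<tau> t. (\<sigma>, s, \<tau>, t) \<in> C \<Longrightarrow> \<sigma> \<in> set \<sigma>s \<and> s \<in> params \<sigma> \<and> \<tau> \<in> set \<sigma>s \<and> t \<in> params \<tau>"
    using C local_crossingsD[OF C] by (simp_all add: local_crossings_def)
  have p: "on_strand \<sigma> t \<in> strand_set \<sigma>s"
    using \<sigma> t in_strand_set by blast
  show ?thesis
  proof
    assume "is_cut D (on_strand \<sigma> t)"
    then obtain q where "(on_strand \<sigma> t, q) \<in> over_under D \<or> (q, on_strand \<sigma> t) \<in> over_under D"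
      by (auto simp: is_cut_def classical_at_def)
    then show "crossed C \<sigma> t"
    proof
      assume q: "(on_strand \<sigma> t, q) \<in> over_under D"
      then have "q \<in> strand_set \<sigma>s"
        using D.over_under_double double_point_sides p by blast
      then have "(on_strand \<sigma> t, q) \<in> ?f ` C"
        using q p img by blast
      then obtain \<sigma>' s \<tau> r where "(\<sigma>', s, \<tau>, r) \<in> C" "on_strand \<sigma>' s = on_strand \<sigma> t"
        by auto
      then show ?thesis
        using ps on_strand_eq_iff \<sigma> t unfolding crossed_def by metis
    next
      assume q: "(q, on_strand \<sigma> t) \<in> over_under D"
      then have "q \<in> strand_set \<sigma>s"
        using D.over_under_double double_point_sides p by blast
      then have "(q, on_strand \<sigma> t) \<in> ?f ` C"
        using q p img by blast
      then obtain \<sigma>' s \<tau> r where "(\<tau>, r, \<sigma>', s) \<in> C" "on_strand \<sigma>' s = on_strand \<sigma> t"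
        by auto
      then show ?thesis
        using ps on_strand_eq_iff \<sigma> t unfolding crossed_def by metis
    qed
  next
    assume "crossed C \<sigma> t"
    then obtain \<tau> s where "(\<sigma>, t, \<tau>, s) \<in> C \<or> (\<tau>, s, \<sigma>, t) \<in> C"
      by (auto simp: crossed_def)
    then have "(on_strand \<sigma> t, on_strand \<tau> s) \<in> ?f ` C \<or> (on_strand \<tau> s, on_strand \<sigma> t) \<in> ?f ` C"
      by force
    then have "classical_at D (on_strand \<sigma> t) (on_strand \<tau> s)"
      unfolding img[symmetric] classical_at_def by blast
    then show "is_cut D (on_strand \<sigma> t)"
      unfolding is_cut_def by blast
  qed
qed

text \<open>All classical crossings of a strand are at its two marks, so the coloring is constant on
  each of the three pieces.\<close>

lemma side_coloring_reads:
  assumes c: "c \<in> side_colorings X under_op over_op D"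
    and C: "local_crossings \<sigma>s D C" and m: "marked \<sigma>s C m"
  obtains v where "fits X under_op over_op \<sigma>s D C m v"
    "\<And>\<sigma> t. \<sigma> \<in> set \<sigma>s \<Longrightarrow> t \<in> params \<sigma> \<Longrightarrow> c (on_strand \<sigma> t) = two_step (m \<sigma>) (v \<sigma>) t"
proof -
  \<comment> \<open>The three labels are read just before the first mark, just after it, and just
    after the second mark.\<close>
  define v where "v \<sigma> = (fst (c (on_strand \<sigma> (fst (m \<sigma>)))), snd (c (on_strand \<sigma> (fst (m \<sigma>)))),
    snd (c (on_strand \<sigma> (snd (m \<sigma>)))))" for \<sigma>
  have diag: "fst (c (on_strand \<sigma> t)) = snd (c (on_strand \<sigma> t))"
    if "\<sigma> \<in> set \<sigma>s" "t \<in> params \<sigma>" "\<not> crossed C \<sigma> t" for \<sigma> t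
    using c is_cut_on_strand[OF C that(1,2)] on_strand_source[OF that(1)] that(3)
    by (simp add: side_colorings_def)
  have reads: "c (on_strand \<sigma> t) = two_step (m \<sigma>) (v \<sigma>) t" if \<sigma>: "\<sigma> \<in> set \<sigma>s" and t: "t \<in> params \<sigma>" for \<sigma> t
  proof -
    obtain i a b where iab: "\<sigma> = (i, a, b)"
      by (cases \<sigma>)
    obtain m1 m2 where m12: "m \<sigma> = (m1, m2)"
      by (cases "m \<sigma>")
    have ord: "a < m1" "m1 < m2" "m2 < b"
      using bspec[OF m[unfolded marked_def] \<sigma>] by (simp_all add: inner_params_def m12) (simp_all add: iab)
    have uncrossed: "\<not> crossed C \<sigma> s" if "s \<noteq> m1" "s \<noteq> m2" for s
      using bspec[OF m[unfolded marked_def] \<sigma>] that by (simp add: m12) blast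
    define g where "g s = c (i, cis s)" for s
    have g: "c (on_strand \<sigma> s) = g s" for s
      by (simp add: g_def on_strand_def iab)
    have step: "step_at g s" for s
      using c strand \<sigma> unfolding iab g_def[abs_def] side_colorings_def by blast
    have dg: "fst (g s) = snd (g s)" if "a \<le> s" "s \<le> b" "s \<noteq> m1" "s \<noteq> m2" for s
    proof -
      have "params \<sigma> = {a..b}"
        by (simp add: params_def iab)
      then show ?thesis
        using diag[OF \<sigma>, of s] uncrossed[of s] that by (simp add: g)
    qed
    have 1: "fst (g m1) = snd (g a)" "\<And>s. a < s \<Longrightarrow> s < m1 \<Longrightarrow> g s = (snd (g a), snd (g a))"
      using step_at_constant[of g a m1] step dg ord by auto
    have 2: "fst (g m2) = snd (g m1)" "\<And>s. m1 < s \<Longrightarrow> s < m2 \<Longrightarrow> g s = (snd (g m1), snd (g m1))"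
      using step_at_constant[of g m1 m2] step dg ord by auto
    have 3: "fst (g b) = snd (g m2)" "\<And>s. m2 < s \<Longrightarrow> s < b \<Longrightarrow> g s = (snd (g m2), snd (g m2))"
      using step_at_constant[of g m2 b] step dg ord by auto
    have "fst (g a) = snd (g a)" "fst (g b) = snd (g b)"
      using dg ord by auto
    then have "g a = (fst (g m1), fst (g m1))" "g b = (snd (g m2), snd (g m2))"
      using 1 3 by (simp_all add: prod_eq_iff)
    moreover have "t = a \<or> a < t \<and> t < m1 \<or> t = m1 \<or> m1 < t \<and> t < m2 \<or> t = m2 \<or> m2 < t \<and> t < b \<or> t = b"
      using t by (auto simp: params_def iab)
    ultimately show ?thesis
      using 1 2 3 ord unfolding g v_def m12 two_step_def by (elim disjE) (simp_all add: prod_eq_iff)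
  qed
  have "fits X under_op over_op \<sigma>s D C m v"
    unfolding fits_def
  proof (intro conjI ballI)
    fix \<sigma> assume \<sigma>: "\<sigma> \<in> set \<sigma>s"
    have cX: "c (on_strand \<sigma> t) \<in> X \<times> X" for t
      using side_colorings_PiE[OF c] on_strand_source[OF \<sigma>] by (rule PiE_mem)
    show "v \<sigma> \<in> X \<times> X \<times> X"
      using cX[of "fst (m \<sigma>)"] cX[of "snd (m \<sigma>)"] by (simp add: v_def mem_Times_iff)
    have mp: "fst (m \<sigma>) \<in> params \<sigma>" "snd (m \<sigma>) \<in> params \<sigma>" "fst (m \<sigma>) < snd (m \<sigma>)"
      using bspec[OF m[unfolded marked_def] \<sigma>] subsetD[OF inner_params_subset] by simp_all
    show "\<not> crossed C \<sigma> (fst (m \<sigma>)) \<longrightarrow> fst (v \<sigma>) = fst (snd (v \<sigma>))"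
      using diag[OF \<sigma> mp(1)] by (simp add: v_def)
    have "fst (two_step (m \<sigma>) (v \<sigma>) (snd (m \<sigma>))) = fst (snd (v \<sigma>))"
      by (simp add: two_step_marks(2)[OF mp(3)])
    then have "fst (c (on_strand \<sigma> (snd (m \<sigma>)))) = fst (snd (v \<sigma>))"
      by (simp only: reads[OF \<sigma> mp(2)])
    then show "\<not> crossed C \<sigma> (snd (m \<sigma>)) \<longrightarrow> fst (snd (v \<sigma>)) = snd (snd (v \<sigma>))"
      using diag[OF \<sigma> mp(2)] by (simp add: v_def)
  next
    fix x assume x: "x \<in> C"
    obtain \<sigma> s \<tau> t where [simp]: "x = (\<sigma>, s, \<tau>, t)"
      by (cases x)
    have "\<sigma> \<in> set \<sigma>s" "s \<in> params \<sigma>" "\<tau> \<in> set \<sigma>s" "t \<in> params \<tau>"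
      using local_crossingsD[OF C] x by simp_all
    moreover have "(on_strand \<sigma> s, on_strand \<tau> t) \<in> over_under D"
      using local_crossingsD[OF C] x by simp
    then have "crossing_rule under_op over_op (crossing_direction D (on_strand \<sigma> s) (on_strand \<tau> t))
        (c (on_strand \<sigma> s)) (c (on_strand \<tau> t))"
      using c by (auto simp: side_colorings_def)
    ultimately show "case x of (\<sigma>, s, \<tau>, t) \<Rightarrow> crossing_rule under_op over_op
        (crossing_direction D (on_strand \<sigma> s) (on_strand \<tau> t))
        (two_step (m \<sigma>) (v \<sigma>) s) (two_step (m \<tau>) (v \<tau>) t)"
      using reads by simp
  qed
  then show thesis
    using that reads by blast
qed

lemma on_strand_not_interior:
  assumes "(i, a, b) \<in> set \<sigma>s"
  shows "(i, cis a) \<notin> strand_interior \<sigma>s" "(i, cis b) \<notin> strand_interior \<sigma>s"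
proof -
  have "on_strand (i, a, b) t \<notin> strand_interior \<sigma>s" if "t \<in> {a, b}" for t
  proof
    assume "on_strand (i, a, b) t \<in> strand_interior \<sigma>s"
    then obtain \<tau> s where "\<tau> \<in> set \<sigma>s" "s \<in> inner_params \<tau>" "on_strand (i, a, b) t = on_strand \<tau> s"
      unfolding in_strand_interior by blast
    moreover have "t \<in> params (i, a, b)"
      using that strand[OF assms] by (auto simp: params_def)
    ultimately have "(i, a, b) = \<tau>" "t = s"
      using on_strand_eq_iff[OF assms, of \<tau> t s] inner_params_subset by blast+
    then show False
      using \<open>s \<in> inner_params \<tau>\<close> that by (auto simp: inner_params_def)
  qed
  from this[of a] this[of b] show "(i, cis a) \<notin> strand_interior \<sigma>s" "(i, cis b) \<notin> strand_interior \<sigma>s"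
    by (simp_all add: on_strand_def)
qed

text \<open>The other strands form a closed set missing the end point, and the strand itself leaves
  a gap on its circle because it is shorter than 2 pi.\<close>

lemma eventually_not_interior:
  assumes \<sigma>: "(i, a, b) \<in> set \<sigma>s"
  shows "\<forall>\<^sub>F s in at_right b. (i, cis s) \<notin> strand_interior \<sigma>s"
    and "\<forall>\<^sub>F s in at_left a. (i, cis s) \<notin> strand_interior \<sigma>s"
proof -
  define \<tau>s where "\<tau>s = filter (\<lambda>\<tau>. \<tau> \<noteq> (i, a, b)) \<sigma>s"
  have others: "\<forall>\<^sub>F s in nhds t. (i, cis s) \<notin> strand_set \<tau>s" if "t \<in> {a, b}" for t
  proof (rule eventually_avoids_strands, rule notI)
    assume "(i, cis t) \<in> strand_set \<tau>s"
    then obtain \<tau> s where \<tau>: "\<tau> \<in> set \<sigma>s" "\<tau> \<noteq> (i, a, b)" "s \<in> params \<tau>" "(i, cis t) = on_strand \<tau> s"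
      by (auto simp: strand_set_def \<tau>s_def)
    have "t \<in> params (i, a, b)"
      using that strand[OF \<sigma>] by (auto simp: params_def)
    moreover have "on_strand (i, a, b) t = on_strand \<tau> s"
      using \<tau>(4) by (simp add: on_strand_def)
    ultimately show False
      using on_strand_eq_iff[OF \<sigma> \<tau>(1) _ \<tau>(3)] \<tau>(2) by blast
  qed
  have split: "(i, cis s) \<notin> strand_interior \<sigma>s"
    if "(i, cis s) \<notin> strand_set \<tau>s" "\<And>r. a < r \<Longrightarrow> r < b \<Longrightarrow> cis s \<noteq> cis r" for s
  proof
    assume "(i, cis s) \<in> strand_interior \<sigma>s"
    then obtain \<tau> r where \<tau>: "\<tau> \<in> set \<sigma>s" "r \<in> inner_params \<tau>" "(i, cis s) = on_strand \<tau> r"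
      unfolding in_strand_interior by blast
    show False
    proof (cases "\<tau> = (i, a, b)")
      case True
      then show False
        using \<tau> that(2) by (auto simp: inner_params_def on_strand_def)
    next
      case False
      then have "on_strand \<tau> r \<in> strand_set \<tau>s"
        using \<tau>(1,2) inner_params_subset unfolding strand_set_def \<tau>s_def set_filter by blast
      then show False
        using that(1) \<tau>(3) by simp
    qed
  qed
  have "\<forall>\<^sub>F s in at_right b. (i, cis s) \<notin> strand_set \<tau>s"
    using others[of b] by (simp add: eventually_at_filter eventually_mono)
  \<comment> \<open>The gap beyond b ends where the strand starts again, at the parameter a + 2
    pi.\<close>
  moreover have "\<forall>\<^sub>F s in at_right b. s \<in> {b<..<a + 2 * pi}"
    using strand[OF \<sigma>] by (intro eventually_at_right_real) simp
  ultimately show "\<forall>\<^sub>F s in at_right b. (i, cis s) \<notin> strand_interior \<sigma>s"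
  proof (rule eventually_elim2)
    fix s assume "(i, cis s) \<notin> strand_set \<tau>s" "s \<in> {b<..<a + 2 * pi}"
    then show "(i, cis s) \<notin> strand_interior \<sigma>s"
      by (intro split) (auto simp: cis_eq_iff_near)
  qed
  have "\<forall>\<^sub>F s in at_left a. (i, cis s) \<notin> strand_set \<tau>s"
    using others[of a] by (simp add: eventually_at_filter eventually_mono)
  moreover have "\<forall>\<^sub>F s in at_left a. s \<in> {b - 2 * pi<..<a}"
    using strand[OF \<sigma>] by (intro eventually_at_left_real) simp
  ultimately show "\<forall>\<^sub>F s in at_left a. (i, cis s) \<notin> strand_interior \<sigma>s"
  proof (rule eventually_elim2)
    fix s assume "(i, cis s) \<notin> strand_set \<tau>s" "s \<in> {b - 2 * pi<..<a}"
    then show "(i, cis s) \<notin> strand_interior \<sigma>s"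
      by (intro split) (auto simp: cis_eq_iff_near)
  qed
qed

text \<open>A point of a strand determines the strand and the parameter, so a function of both can
  be transported to source points.\<close>

lemma overwrite_strands:
  obtains c' where "\<And>\<sigma> t. \<sigma> \<in> set \<sigma>s \<Longrightarrow> t \<in> params \<sigma> \<Longrightarrow> c' (on_strand \<sigma> t) = h \<sigma> t"
    "\<And>p. p \<notin> strand_set \<sigma>s \<Longrightarrow> c' p = c p"
proof -
  let ?P = "Sigma (set \<sigma>s) params" and ?f = "\<lambda>(\<sigma>, t). on_strand \<sigma> t"
  define c' where "c' p = (if p \<in> strand_set \<sigma>s then case_prod h (inv_into ?P ?f p) else c p)" for p
  have inj: "inj_on ?f ?P"
    using on_strand_eq_iff by (auto simp: inj_on_def)
  have "c' (on_strand \<sigma> t) = h \<sigma> t" if "\<sigma> \<in> set \<sigma>s" "t \<in> params \<sigma>" for \<sigma> t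
    using that inv_into_f_f[OF inj, of "(\<sigma>, t)"] in_strand_set unfolding c'_def by auto
  then show thesis
    by (rule that) (simp_all add: c'_def)
qed

text \<open>A point of a strand may be presented with a parameter outside the strand's interval,
  differing by a multiple of 2 pi.\<close>

lemma step_at_shift:
  assumes "cis s = cis t"
  shows "step_at (\<lambda>r. c (i, cis r)) s \<longleftrightarrow> step_at (\<lambda>r. c (i, cis r)) t"
proof -
  obtain n :: int where n: "s = t + 2 * pi * of_int n"
    using assms cis_eq_cis_iff by metis
  have "strict_mono (\<lambda>r. r + 2 * pi * of_int n)" "surj (\<lambda>r. r + 2 * pi * of_int n)"
    by (auto simp: strict_mono_def surj_def intro: exI[of _ "_ - 2 * pi * of_int n"])
  from step_at_increasing[OF this, of "\<lambda>r. c (i, cis r)" t]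
  have "step_at (\<lambda>r. c (i, cis (r + 2 * pi * of_int n))) t \<longleftrightarrow> step_at (\<lambda>r. c (i, cis r)) s"
    by (simp add: n)
  moreover have "cis (r + 2 * pi * of_int n) = cis r" for r
    using cis_eq_cis_iff by blast
  ultimately show ?thesis
    by simp
qed

text \<open>The counterpart of reading: labels on the strands are replaced by step functions that
  satisfy the rules of D', and agreement at the ends makes the result a side coloring.\<close>

lemma side_coloring_writes:
  assumes c: "c \<in> side_colorings X under_op over_op D"
    and C: "local_crossings \<sigma>s D' C" and m: "marked \<sigma>s C m" and fits: "fits X under_op over_op \<sigma>s D' C m v"
    and ends: "\<And>i a b. (i, a, b) \<in> set \<sigma>s \<Longrightarrow> c (i, cis a) = (fst (v (i, a, b)), fst (v (i, a, b)))"
      "\<And>i a b. (i, a, b) \<in> set \<sigma>s \<Longrightarrow> c (i, cis b) = (snd (snd (v (i, a, b))), snd (snd (v (i, a, b))))"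
  obtains c' where "c' \<in> side_colorings X under_op over_op D'"
    "\<And>p. p \<in> source D - strand_interior \<sigma>s \<Longrightarrow> c' p = c p"
    "\<And>\<sigma> t. \<sigma> \<in> set \<sigma>s \<Longrightarrow> t \<in> params \<sigma> \<Longrightarrow> c' (on_strand \<sigma> t) = two_step (m \<sigma>) (v \<sigma>) t"
proof -
  interpret sym: local_change D' D \<sigma>s
    by (rule local_change_sym)
  obtain c' where reads: "\<And>\<sigma> t. \<sigma> \<in> set \<sigma>s \<Longrightarrow> t \<in> params \<sigma> \<Longrightarrow> c' (on_strand \<sigma> t) = two_step (m \<sigma>) (v \<sigma>) t"
    and outside: "\<And>p. p \<notin> strand_set \<sigma>s \<Longrightarrow> c' p = c p"
    using overwrite_strands[of "\<lambda>\<sigma>. two_step (m \<sigma>) (v \<sigma>)" c] by blast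
  have marks: "fst (m \<sigma>) < snd (m \<sigma>)" "fst (m \<sigma>) \<in> inner_params \<sigma>" "snd (m \<sigma>) \<in> inner_params \<sigma>"
    "crossed C \<sigma> t \<Longrightarrow> t = fst (m \<sigma>) \<or> t = snd (m \<sigma>)" if "\<sigma> \<in> set \<sigma>s" for \<sigma> t
    using m that unfolding marked_def by blast+
  \<comment> \<open>Besides points off the strands this concerns the strand ends, where the new
    labels equal the old ones by \<open>ends\<close>.\<close>
  have agree: "c' p = c p" if p: "p \<notin> strand_interior \<sigma>s" for p
  proof (cases "p \<in> strand_set \<sigma>s")
    case True
    then obtain \<sigma> t where \<sigma>: "\<sigma> \<in> set \<sigma>s" "t \<in> params \<sigma>" "p = on_strand \<sigma> t"
      unfolding in_strand_set by blast
    obtain i a b where iab: "\<sigma> = (i, a, b)"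
      by (cases \<sigma>)
    have "t \<notin> inner_params \<sigma>"
      using p \<sigma> in_strand_interior by blast
    then have t: "t = a \<or> t = b"
      using \<sigma>(2) by (auto simp: params_def inner_params_def iab)
    have "a < fst (m \<sigma>)" "snd (m \<sigma>) < b"
      using marks(2,3)[OF \<sigma>(1)] by (simp_all add: inner_params_def iab)
    then show ?thesis
      using reads[OF \<sigma>(1,2)] t marks(1)[OF \<sigma>(1)] ends[of i a b] \<sigma>(1)
      unfolding \<sigma>(3) by (auto simp: two_step_def on_strand_def iab split: prod.splits)
  qed (rule outside)
  have v: "v \<sigma> \<in> X \<times> X \<times> X" if "\<sigma> \<in> set \<sigma>s" for \<sigma>
    using fits that unfolding fits_def by blast
  have "c' \<in> source D' \<rightarrow>\<^sub>E X \<times> X"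
  proof
    fix p assume p: "p \<in> source D'"
    show "c' p \<in> X \<times> X"
    proof (cases "p \<in> strand_set \<sigma>s")
      case True
      then obtain \<sigma> t where "\<sigma> \<in> set \<sigma>s" "t \<in> params \<sigma>" "p = on_strand \<sigma> t"
        unfolding in_strand_set by blast
      then show ?thesis
        using reads v[of \<sigma>] by (auto simp: two_step_def split: prod.splits)
    next
      case False
      then show ?thesis
        using outside side_colorings_PiE[OF c] p source by (auto dest: PiE_mem)
    qed
  next
    fix p assume "p \<notin> source D'"
    then have "p \<notin> strand_set \<sigma>s" "p \<notin> source D"
      using strand_set_source source by auto
    then show "c' p = undefined"
      using outside PiE_arb[OF side_colorings_PiE[OF c]] by metis
  qed
  moreover have "step_at (\<lambda>s. c' (i, cis s)) \<theta>" if i: "i < ncircles D'" for i \<theta>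
  proof (cases "(i, cis \<theta>) \<in> strand_set \<sigma>s")
    case False
    from eventually_avoids_strands[OF this]
    have ev: "\<forall>\<^sub>F s in nhds \<theta>. c' (i, cis s) = c (i, cis s)"
      by (rule eventually_mono) (rule outside)
    have "step_at (\<lambda>s. c (i, cis s)) \<theta>"
      using c i ncircles by (simp add: side_colorings_def)
    moreover have "\<forall>\<^sub>F s in at_right \<theta>. c' (i, cis s) = c (i, cis s)"
      "\<forall>\<^sub>F s in at_left \<theta>. c' (i, cis s) = c (i, cis s)"
      using ev by (auto simp: eventually_at_filter elim: eventually_mono)
    ultimately show ?thesis
      using outside[OF False]
      by - (rule step_at_glue[where g\<^sub>1 = "\<lambda>s. c (i, cis s)" and g\<^sub>2 = "\<lambda>s. c (i, cis s)"]; assumption)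
  next
    case True
    then obtain \<sigma> t where \<sigma>: "\<sigma> \<in> set \<sigma>s" "t \<in> params \<sigma>" "(i, cis \<theta>) = on_strand \<sigma> t"
      unfolding in_strand_set by blast
    have "i = fst \<sigma>" and t: "cis \<theta> = cis t"
      using \<sigma>(3) by (simp_all add: on_strand_def)
    then obtain a b where iab: "\<sigma> = (i, a, b)"
      by (metis prod.collapse)
    have iabs: "(i, a, b) \<in> set \<sigma>s" and tab: "a \<le> t" "t \<le> b"
      using \<sigma> by (auto simp: iab params_def)
    have reads': "c' (i, cis s) = two_step (m \<sigma>) (v \<sigma>) s" if "a \<le> s" "s \<le> b" for s
      using reads[OF \<sigma>(1), of s] that by (simp add: on_strand_def params_def iab)
    have step_c: "step_at (\<lambda>s. c (i, cis s)) t"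
      using c i ncircles by (simp add: side_colorings_def)
    have step_h: "step_at (two_step (m \<sigma>) (v \<sigma>)) t"
      by (rule step_at_two_step[OF marks(1)[OF \<sigma>(1)]])
    let ?g\<^sub>1 = "if t < b then two_step (m \<sigma>) (v \<sigma>) else (\<lambda>s. c (i, cis s))"
    let ?g\<^sub>2 = "if a < t then two_step (m \<sigma>) (v \<sigma>) else (\<lambda>s. c (i, cis s))"
    \<comment> \<open>Both sides of an inner parameter follow the new step function; at the end b
      the right side follows the old coloring, and at the start a the left side does.\<close>
    have "step_at (\<lambda>s. c' (i, cis s)) t"
    proof (rule step_at_glue)
      show "\<forall>\<^sub>F s in at_right t. c' (i, cis s) = ?g\<^sub>1 s"
      proof (cases "t < b")
        case True
        then have "\<forall>\<^sub>F s in at_right t. s \<in> {t<..<b}"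
          by (rule eventually_at_right_real)
        then show ?thesis
          by (rule eventually_mono) (use True tab reads' in simp)
      next
        case False
        then have "t = b"
          using tab by simp
        then show ?thesis
          using eventually_not_interior(1)[OF iabs] by (auto elim!: eventually_mono simp: agree)
      qed
      show "\<forall>\<^sub>F s in at_left t. c' (i, cis s) = ?g\<^sub>2 s"
      proof (cases "a < t")
        case True
        then have "\<forall>\<^sub>F s in at_left t. s \<in> {a<..<t}"
          by (rule eventually_at_left_real)
        then show ?thesis
          by (rule eventually_mono) (use True tab reads' in simp)
      next
        case False
        then have "t = a"
          using tab by simp
        then show ?thesis
          using eventually_not_interior(2)[OF iabs] by (auto elim!: eventually_mono simp: agree)
      qed
      show "c' (i, cis t) = ?g\<^sub>1 t"
        using reads' tab agree on_strand_not_interior(2)[OF iabs] by (cases "t < b") auto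
      show "c' (i, cis t) = ?g\<^sub>2 t"
        using reads' tab agree on_strand_not_interior(1)[OF iabs] by (cases "a < t") auto
    qed (use step_c step_h in auto)
    then show ?thesis
      using step_at_shift[OF t, of c' i] by simp
  qed
  moreover have "fst (c' p) = snd (c' p)" if p: "p \<in> source D'" "\<not> is_cut D' p" for p
  proof (cases "p \<in> strand_set \<sigma>s")
    case True
    then obtain \<sigma> t where \<sigma>: "\<sigma> \<in> set \<sigma>s" "t \<in> params \<sigma>" "p = on_strand \<sigma> t"
      unfolding in_strand_set by blast
    then have "\<not> crossed C \<sigma> t"
      using p(2) sym.is_cut_on_strand[OF C \<sigma>(1,2)] by simp
    then have "t = fst (m \<sigma>) \<Longrightarrow> fst (v \<sigma>) = fst (snd (v \<sigma>))"
      "t = snd (m \<sigma>) \<Longrightarrow> fst (snd (v \<sigma>)) = snd (snd (v \<sigma>))"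
      using fits \<sigma>(1) unfolding fits_def by blast+
    then show ?thesis
      using reads[OF \<sigma>(1,2)] marks(1)[OF \<sigma>(1)] by (auto simp: \<sigma>(3) two_step_def split: prod.splits)
  next
    case False
    then show ?thesis
      using c p outside is_cut_outside source by (simp add: side_colorings_def)
  qed
  moreover have "crossing_rule under_op over_op (crossing_direction D' p q) (c' p) (c' q)"
    if pq: "(p, q) \<in> over_under D'" for p q
  proof (cases "p \<in> strand_set \<sigma>s")
    case True
    then have "q \<in> strand_set \<sigma>s"
      using sym.double_point_sides D'.over_under_double pq by blast
    then have "(p, q) \<in> (\<lambda>(\<sigma>, s, \<tau>, t). (on_strand \<sigma> s, on_strand \<tau> t)) ` C"
      using C pq True unfolding local_crossings_def by blast
    then obtain \<sigma> s \<tau> t where C': "(\<sigma>, s, \<tau>, t) \<in> C" "p = on_strand \<sigma> s" "q = on_strand \<tau> t"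
      by auto
    then have "\<sigma> \<in> set \<sigma>s" "s \<in> params \<sigma>" "\<tau> \<in> set \<sigma>s" "t \<in> params \<tau>"
      using local_crossingsD[OF C] by simp_all
    then show ?thesis
      using reads C' fits unfolding fits_def by auto
  next
    case False
    then have q: "q \<notin> strand_set \<sigma>s"
      using sym.double_point_sides D'.over_under_double pq by blast
    have "(p, q) \<in> over_under D"
      using over_under_outside(1)[OF False] pq by simp
    then show ?thesis
      using c outside[OF False] outside[OF q] crossing_direction_outside False
      by (auto simp: side_colorings_def)
  qed
  ultimately have "c' \<in> side_colorings X under_op over_op D'"
    by (auto simp: side_colorings_def)
  then show thesis
    using that agree reads by blast
qed

lemma two_step_ends:
  assumes "marked \<sigma>s C m" "(i, a, b) \<in> set \<sigma>s"
  shows "two_step (m (i, a, b)) w a = (fst w, fst w)" "two_step (m (i, a, b)) w b = (snd (snd w), snd (snd w))"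
proof -
  have "a < fst (m (i, a, b))" "snd (m (i, a, b)) < b" "fst (m (i, a, b)) < snd (m (i, a, b))"
    using bspec[OF assms(1)[unfolded marked_def] assms(2)] by (simp_all add: inner_params_def)
  then show "two_step (m (i, a, b)) w a = (fst w, fst w)" "two_step (m (i, a, b)) w b = (snd (snd w), snd (snd w))"
    by (auto simp: two_step_def split: prod.splits)
qed

lemma strand_ends_read:
  assumes "marked \<sigma>s C m" "(i, a, b) \<in> set \<sigma>s"
    and reads: "\<And>\<sigma> t. \<sigma> \<in> set \<sigma>s \<Longrightarrow> t \<in> params \<sigma> \<Longrightarrow> c (on_strand \<sigma> t) = two_step (m \<sigma>) (v \<sigma>) t"
  shows "c (i, cis a) = (fst (v (i, a, b)), fst (v (i, a, b)))"
    "c (i, cis b) = (snd (snd (v (i, a, b))), snd (snd (v (i, a, b))))"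
proof -
  have "a \<in> params (i, a, b)" "b \<in> params (i, a, b)"
    using strand[OF assms(2)] by (simp_all add: params_def)
  then show "c (i, cis a) = (fst (v (i, a, b)), fst (v (i, a, b)))"
    "c (i, cis b) = (snd (snd (v (i, a, b))), snd (snd (v (i, a, b))))"
    using reads[OF assms(2), of a] reads[OF assms(2), of b]
    by (simp_all add: two_step_ends[OF assms(1,2)] on_strand_def)
qed

text \<open>Read the triples of labels from c, exchange them for triples that fit D' and have the
  same ends, and write these back.\<close>

lemma side_coloring_extends:
  assumes c: "c \<in> side_colorings X under_op over_op D"
    and C: "local_crossings \<sigma>s D C" "marked \<sigma>s C m" and C': "local_crossings \<sigma>s D' C'" "marked \<sigma>s C' m'"
    and ext: "\<And>v. fits X under_op over_op \<sigma>s D C m v \<Longrightarrow>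
      \<exists>v'. fits X under_op over_op \<sigma>s D' C' m' v' \<and> same_ends \<sigma>s v v'"
  shows "\<exists>c'\<in>side_colorings X under_op over_op D'. \<forall>p\<in>source D - strand_interior \<sigma>s. c' p = c p"
proof -
  obtain v where v: "fits X under_op over_op \<sigma>s D C m v"
    and reads: "\<And>\<sigma> t. \<sigma> \<in> set \<sigma>s \<Longrightarrow> t \<in> params \<sigma> \<Longrightarrow> c (on_strand \<sigma> t) = two_step (m \<sigma>) (v \<sigma>) t"
    using side_coloring_reads[OF c C] by blast
  obtain v' where v': "fits X under_op over_op \<sigma>s D' C' m' v'" and "same_ends \<sigma>s v v'"
    using ext[OF v] by blast
  then have "fst (v' \<sigma>) = fst (v \<sigma>)" "snd (snd (v' \<sigma>)) = snd (snd (v \<sigma>))" if "\<sigma> \<in> set \<sigma>s" for \<sigma>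
    using that by (simp_all add: same_ends_def)
  then have "c (i, cis a) = (fst (v' (i, a, b)), fst (v' (i, a, b)))"
    "c (i, cis b) = (snd (snd (v' (i, a, b))), snd (snd (v' (i, a, b))))" if "(i, a, b) \<in> set \<sigma>s" for i a b
    using strand_ends_read[OF C(2) that reads] that by simp_all
  then show ?thesis
    using side_coloring_writes[OF c C' v'] by metis
qed

text \<open>Colorings that agree off the strand interiors agree at the strand ends, so the triples
  read from them have the same ends and uniqueness of triples applies.\<close>

lemma side_coloring_unique:
  assumes c: "c \<in> side_colorings X under_op over_op D" and c': "c' \<in> side_colorings X under_op over_op D"
    and C: "local_crossings \<sigma>s D C" "marked \<sigma>s C m"
    and uniq: "\<And>v v'. \<lbrakk>fits X under_op over_op \<sigma>s D C m v; fits X under_op over_op \<sigma>s D C m v';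
      same_ends \<sigma>s v v'\<rbrakk> \<Longrightarrow> \<forall>\<sigma>\<in>set \<sigma>s. v' \<sigma> = v \<sigma>"
    and agree: "\<forall>p\<in>source D - strand_interior \<sigma>s. c' p = c p"
  shows "c' = c"
proof (rule PiE_ext[OF side_colorings_PiE[OF c'] side_colorings_PiE[OF c]])
  fix p assume p: "p \<in> source D"
  obtain v where v: "fits X under_op over_op \<sigma>s D C m v"
    and reads: "\<And>\<sigma> t. \<sigma> \<in> set \<sigma>s \<Longrightarrow> t \<in> params \<sigma> \<Longrightarrow> c (on_strand \<sigma> t) = two_step (m \<sigma>) (v \<sigma>) t"
    using side_coloring_reads[OF c C] by blast
  obtain v' where v': "fits X under_op over_op \<sigma>s D C m v'"
    and reads': "\<And>\<sigma> t. \<sigma> \<in> set \<sigma>s \<Longrightarrow> t \<in> params \<sigma> \<Longrightarrow> c' (on_strand \<sigma> t) = two_step (m \<sigma>) (v' \<sigma>) t"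
    using side_coloring_reads[OF c' C] by blast
  have "same_ends \<sigma>s v v'"
    unfolding same_ends_def
  proof
    fix \<sigma> assume "\<sigma> \<in> set \<sigma>s"
    moreover obtain i a b where iab: "\<sigma> = (i, a, b)"
      by (cases \<sigma>)
    ultimately have \<sigma>: "(i, a, b) \<in> set \<sigma>s"
      by simp
    have "(i, cis a) \<in> source D" "(i, cis b) \<in> source D"
      using strand[OF \<sigma>] source_cis by blast+
    then have "c' (i, cis a) = c (i, cis a)" "c' (i, cis b) = c (i, cis b)"
      using agree on_strand_not_interior[OF \<sigma>] by blast+
    then show "fst (v' \<sigma>) = fst (v \<sigma>) \<and> snd (snd (v' \<sigma>)) = snd (snd (v \<sigma>))"
      using strand_ends_read[OF C(2) \<sigma> reads] strand_ends_read[OF C(2) \<sigma> reads'] by (simp add: iab)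
  qed
  then have eq: "\<forall>\<sigma>\<in>set \<sigma>s. v' \<sigma> = v \<sigma>"
    by (rule uniq[OF v v'])
  show "c' p = c p"
  proof (cases "p \<in> strand_interior \<sigma>s")
    case True
    then obtain \<sigma> t where "\<sigma> \<in> set \<sigma>s" "t \<in> params \<sigma>" "p = on_strand \<sigma> t"
      using strand_interior_subset in_strand_set by blast
    then show ?thesis
      using reads reads' eq by simp
  qed (use p agree in blast)
qed

end

text \<open>Reduces a move to an existence and a uniqueness statement about triples with prescribed
  ends, in both directions. The relation is equality of labels off the strand interiors, which the
  pointwise action of an endomorphism preserves.\<close>

lemma (in local_change) same_coloringsI_local:
  fixes X :: "'a set"
  assumes C: "local_crossings \<sigma>s D C" "marked \<sigma>s C m" and C': "local_crossings \<sigma>s D' C'" "marked \<sigma>s C' m'"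
    and ext: "\<And>v. fits X under_op over_op \<sigma>s D C m v \<Longrightarrow>
      \<exists>v'. fits X under_op over_op \<sigma>s D' C' m' v' \<and> same_ends \<sigma>s v v'"
    and ext': "\<And>v. fits X under_op over_op \<sigma>s D' C' m' v \<Longrightarrow>
      \<exists>v'. fits X under_op over_op \<sigma>s D C m v' \<and> same_ends \<sigma>s v v'"
    and uniq: "\<And>v v'. \<lbrakk>fits X under_op over_op \<sigma>s D C m v; fits X under_op over_op \<sigma>s D C m v';
      same_ends \<sigma>s v v'\<rbrakk> \<Longrightarrow> \<forall>\<sigma>\<in>set \<sigma>s. v' \<sigma> = v \<sigma>"
    and uniq': "\<And>v v'. \<lbrakk>fits X under_op over_op \<sigma>s D' C' m' v; fits X under_op over_op \<sigma>s D' C' m' v';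
      same_ends \<sigma>s v v'\<rbrakk> \<Longrightarrow> \<forall>\<sigma>\<in>set \<sigma>s. v' \<sigma> = v \<sigma>"
  shows "same_colorings X under_op over_op D D'"
proof -
  interpret sym: local_change D' D \<sigma>s
    by (rule local_change_sym)
  show ?thesis
  proof (rule same_coloringsI[where R = "\<lambda>c c'. \<forall>p\<in>source D - strand_interior \<sigma>s. c' p = c p"])
    fix c assume "c \<in> side_colorings X under_op over_op D"
    then show "\<exists>c'\<in>side_colorings X under_op over_op D'. \<forall>p\<in>source D - strand_interior \<sigma>s. c' p = c p"
      by (rule side_coloring_extends[OF _ C C' ext])
  next
    fix c' assume "c' \<in> side_colorings X under_op over_op D'"
    then have "\<exists>c\<in>side_colorings X under_op over_op D. \<forall>p\<in>source D' - strand_interior \<sigma>s. c p = c' p"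
      by (rule sym.side_coloring_extends[OF _ C' C ext'])
    then show "\<exists>c\<in>side_colorings X under_op over_op D. \<forall>p\<in>source D - strand_interior \<sigma>s. c' p = c p"
      by (metis source)
  next
    fix c c' c''
    assume "c' \<in> side_colorings X under_op over_op D'" "c'' \<in> side_colorings X under_op over_op D'"
      "\<forall>p\<in>source D - strand_interior \<sigma>s. c' p = c p" "\<forall>p\<in>source D - strand_interior \<sigma>s. c'' p = c p"
    then show "c' = c''"
      by (intro sym.side_coloring_unique[OF _ _ C' uniq']) (auto simp: source)
  next
    fix c c' c''
    assume "c \<in> side_colorings X under_op over_op D" "c' \<in> side_colorings X under_op over_op D"
      "\<forall>p\<in>source D - strand_interior \<sigma>s. c'' p = c p" "\<forall>p\<in>source D - strand_interior \<sigma>s. c'' p = c' p"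
    then show "c = c'"
      by (intro side_coloring_unique[OF _ _ C uniq]) auto
  next
    fix \<alpha> and c c' :: "source_point \<Rightarrow> 'a \<times> 'a"
    assume "\<forall>p\<in>source D - strand_interior \<sigma>s. c' p = c p"
    then show "\<forall>p\<in>source D - strand_interior \<sigma>s. side_act D' \<alpha> c' p = side_act D \<alpha> c p"
      by (simp add: side_act_def compose_def source)
  qed (rule D.vdiagram D'.vdiagram)+
qed

section \<open>Biquandle algebra of the moves\<close>

context biquandle
begin

abbreviation "crossing \<equiv> crossing_rule (\<triangleright>\<^sub>u) (\<triangleright>\<^sub>o)"
abbreviation "fits_X \<equiv> fits X (\<triangleright>\<^sub>u) (\<triangleright>\<^sub>o)"
abbreviation "same_colorings_X \<equiv> same_colorings X (\<triangleright>\<^sub>u) (\<triangleright>\<^sub>o)"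

section \<open>Consequences of the invertibility axioms\<close>

lemma under_closed [simp]: "x \<in> X \<Longrightarrow> y \<in> X \<Longrightarrow> x \<triangleright>\<^sub>u y \<in> X"
  using under_invertible bij_betwE by blast

lemma over_closed [simp]: "x \<in> X \<Longrightarrow> y \<in> X \<Longrightarrow> x \<triangleright>\<^sub>o y \<in> X"
  using over_invertible bij_betwE by blast

lemma under_inject: "\<lbrakk>x \<in> X; x' \<in> X; y \<in> X; x \<triangleright>\<^sub>u y = x' \<triangleright>\<^sub>u y\<rbrakk> \<Longrightarrow> x = x'"
  using under_invertible[of y] by (auto simp: bij_betw_def dest: inj_onD)

lemma over_inject: "\<lbrakk>x \<in> X; x' \<in> X; y \<in> X; x \<triangleright>\<^sub>o y = x' \<triangleright>\<^sub>o y\<rbrakk> \<Longrightarrow> x = x'"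
  using over_invertible[of y] by (auto simp: bij_betw_def dest: inj_onD)

lemma switch_inject:
  assumes "x \<in> X" "y \<in> X" "x' \<in> X" "y' \<in> X" "y \<triangleright>\<^sub>o x = y' \<triangleright>\<^sub>o x'" "x \<triangleright>\<^sub>u y = x' \<triangleright>\<^sub>u y'"
  shows "x = x'" "y = y'"
  using inj_onD[OF bij_betw_imp_inj_on[OF switch_invertible], of "(x, y)" "(x', y')"] assms by auto

lemma under_obtain:
  assumes "z \<in> X" "y \<in> X"
  obtains x where "x \<in> X" "x \<triangleright>\<^sub>u y = z"
proof -
  have "z \<in> (\<lambda>x. x \<triangleright>\<^sub>u y) ` X"
    using under_invertible[OF assms(2)] assms(1) by (simp add: bij_betw_def)
  then show thesis
    using that by auto
qed

lemma over_obtain: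
  assumes "z \<in> X" "y \<in> X"
  obtains x where "x \<in> X" "x \<triangleright>\<^sub>o y = z"
proof -
  have "z \<in> (\<lambda>x. x \<triangleright>\<^sub>o y) ` X"
    using over_invertible[OF assms(2)] assms(1) by (simp add: bij_betw_def)
  then show thesis
    using that by auto
qed

lemma switch_obtain:
  assumes "w \<in> X" "z \<in> X"
  obtains x y where "x \<in> X" "y \<in> X" "y \<triangleright>\<^sub>o x = w" "x \<triangleright>\<^sub>u y = z"
proof -
  have "(w, z) \<in> (\<lambda>(x, y). (y \<triangleright>\<^sub>o x, x \<triangleright>\<^sub>u y)) ` (X \<times> X)"
    using switch_invertible assms by (simp add: bij_betw_def)
  then show thesis
    using that by auto
qed

text \<open>Apart from the trivial combination, the possible choices of known labels are exactly the
  three invertibility axioms: for the under operation, the over operation and the switch.\<close>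

lemma switch_determined:
  assumes "x \<in> X" "y \<in> X" "x' \<in> X" "y' \<in> X"
    and "y = y' \<or> y \<triangleright>\<^sub>o x = y' \<triangleright>\<^sub>o x'" "x = x' \<or> x \<triangleright>\<^sub>u y = x' \<triangleright>\<^sub>u y'"
  shows "x = x' \<and> y = y'"
  using assms under_inject over_inject switch_inject by metis

lemma crossing_rule_determined:
  assumes "crossing d a b" "crossing d a' b'"
    and "a \<in> X \<times> X" "b \<in> X \<times> X" "a' \<in> X \<times> X" "b' \<in> X \<times> X"
    and "fst a = fst a' \<or> snd a = snd a'" "fst b = fst b' \<or> snd b = snd b'"
  shows "a = a'" "b = b'"
proof -
  have "a = a' \<and> b = b'"
  proof (cases "d > 0")
    case True
    then have "fst b = fst b' \<and> snd a = snd a'"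
      using assms by (intro switch_determined) (auto simp: crossing_rule_def)
    then show ?thesis
      using assms(1,2) True by (simp add: crossing_rule_def prod_eq_iff)
  next
    case False
    then have "snd b = snd b' \<and> fst a = fst a'"
      using assms by (intro switch_determined) (auto simp: crossing_rule_def)
    then show ?thesis
      using assms(1,2) False by (simp add: crossing_rule_def prod_eq_iff)
  qed
  then show "a = a'" "b = b'"
    by auto
qed

subsection \<open>Curls\<close>

text \<open>The switch map sends the diagonal to itself, injectively; for finite \<open>X\<close> also surjectively.\<close>

lemma diagonal_bij:
  assumes "finite X"
  shows "bij_betw (\<lambda>x. x \<triangleright>\<^sub>u x) X X"
proof -
  have "inj_on (\<lambda>x. x \<triangleright>\<^sub>u x) X"
    by (rule inj_onI) (use switch_inject diagonal in metis)
  moreover have "(\<lambda>x. x \<triangleright>\<^sub>u x) ` X \<subseteq> X"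
    by auto
  ultimately show ?thesis
    using endo_inj_surj[OF assms] by (simp add: bij_betw_def)
qed

text \<open>Write the common product as the square of some w, by surjectivity of the diagonal map;
  then (x, y) and (w, w) have the same image under the injective switch.\<close>

lemma curl_iff:
  assumes "finite X" "x \<in> X" "y \<in> X"
  shows "x \<triangleright>\<^sub>u y = y \<triangleright>\<^sub>o x \<longleftrightarrow> x = y"
proof
  assume eq: "x \<triangleright>\<^sub>u y = y \<triangleright>\<^sub>o x"
  have "x \<triangleright>\<^sub>u y \<in> (\<lambda>x. x \<triangleright>\<^sub>u x) ` X"
    using diagonal_bij[OF assms(1)] assms(2,3) by (simp add: bij_betw_def)
  then obtain w where w: "w \<in> X" "x \<triangleright>\<^sub>u y = w \<triangleright>\<^sub>u w"
    by auto
  moreover have "y \<triangleright>\<^sub>o x = w \<triangleright>\<^sub>o w"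
    using eq w diagonal by simp
  ultimately show "x = y"
    using switch_inject[of x y w w] assms(2,3) by simp
qed (use assms(3) diagonal in simp)

text \<open>v1 labels the loop, and v0 and v2 the parts before and after it. At the first passage
  through the crossing the labels change from v0 to v1, at the second from v1 to v2.\<close>

definition curl_rule :: "real \<Rightarrow> bool \<Rightarrow> 'a \<times> 'a \<times> 'a \<Rightarrow> bool" where
  "curl_rule d over_first v \<longleftrightarrow> (case v of (v0, v1, v2) \<Rightarrow>
     if over_first then crossing d (v0, v1) (v1, v2)
     else crossing d (v1, v2) (v0, v1))"

text \<open>In two of the four cases both end labels are products of v1 with itself, and
  \<open>diagonal\<close> makes them equal. In the other two v1 is both products of the end labels,
  and \<open>curl_iff\<close> forces these to coincide.\<close>

lemma curl_rule_iff:
  assumes "finite X" "v0 \<in> X" "v1 \<in> X" "v2 \<in> X"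
  shows "curl_rule d over_first (v0, v1, v2) \<longleftrightarrow>
    v2 = v0 \<and> (if d > 0 \<longleftrightarrow> over_first then v0 = v1 \<triangleright>\<^sub>u v1 else v1 = v0 \<triangleright>\<^sub>u v0)"
  using curl_iff[OF assms(1,2,4)] curl_iff[OF assms(1,4,2)] diagonal assms
  by (auto simp: curl_rule_def crossing_rule_def)

lemma curl_rule_ex1:
  assumes "finite X" "v \<in> X"
  shows "\<exists>!w. w \<in> X \<and> curl_rule d over_first (v, w, v)"
proof -
  have "\<exists>!w. w \<in> X \<and> v = w \<triangleright>\<^sub>u w"
  proof (rule ex_ex1I)
    have "v \<in> (\<lambda>x. x \<triangleright>\<^sub>u x) ` X"
      using diagonal_bij[OF assms(1)] assms(2) by (simp add: bij_betw_def)
    then show "\<exists>w. w \<in> X \<and> v = w \<triangleright>\<^sub>u w"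
      by auto
    show "w = w'" if "w \<in> X \<and> v = w \<triangleright>\<^sub>u w" "w' \<in> X \<and> v = w' \<triangleright>\<^sub>u w'" for w w'
      using inj_onD[OF bij_betw_imp_inj_on[OF diagonal_bij[OF assms(1)]], of w w'] that by simp
  qed
  then show ?thesis
    using assms by (cases "d > 0 \<longleftrightarrow> over_first") (auto simp: curl_rule_iff cong: conj_cong)
qed

subsection \<open>Triangles\<close>

text \<open>
  The truth values \<open>e1, e2, e3\<close> tell whether the triangle lies to the right of strand 1, 2, 3. The
  sides of the triangle are labeled \<open>a, b, c\<close>, and \<open>a2\<close> is the label of strand 1 beyond its crossing
  with strand 2, and so on. The coloring condition does not depend on the cyclic order of the strands
  in the plane, so the sixteen pictures of the third move reduce to eight.
\<close>

definition face :: "bool \<Rightarrow> bool \<Rightarrow> 'a \<Rightarrow> 'a \<Rightarrow> 'a \<Rightarrow> 'a \<Rightarrow> bool" where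
  "face e e' x x' y y' \<longleftrightarrow>
     (let (r, l) = if e then (x, x') else (x', x); (s, t) = if e' then (y, y') else (y', y)
      in l = r \<triangleright>\<^sub>u s \<and> t = s \<triangleright>\<^sub>o r)"

definition triangle_faces ::
    "bool \<Rightarrow> bool \<Rightarrow> bool \<Rightarrow> 'a \<Rightarrow> 'a \<Rightarrow> 'a \<Rightarrow> 'a \<Rightarrow> 'a \<Rightarrow> 'a \<Rightarrow> 'a \<Rightarrow> 'a \<Rightarrow> 'a \<Rightarrow> bool" where
  "triangle_faces e1 e2 e3 a a2 a3 b b1 b3 c c1 c2 \<longleftrightarrow>
     face e1 e2 b b1 a a2 \<and> face e1 e3 c c1 a a3 \<and> face e2 e3 c c2 b b3"

text \<open>
  Labels of the edges of a cube whose three edges at one vertex are labeled \<open>a, b, c\<close>. The two sides of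
  the third move show the faces around opposite vertices.
\<close>

definition edge_a :: "'a \<Rightarrow> 'a \<Rightarrow> 'a \<Rightarrow> bool \<Rightarrow> bool \<Rightarrow> 'a" where
  "edge_a a b c e2 e3 = (if e2 then if e3 then a else a \<triangleright>\<^sub>o c
     else if e3 then a \<triangleright>\<^sub>o b else (a \<triangleright>\<^sub>o b) \<triangleright>\<^sub>o (c \<triangleright>\<^sub>u b))"

definition edge_b :: "'a \<Rightarrow> 'a \<Rightarrow> 'a \<Rightarrow> bool \<Rightarrow> bool \<Rightarrow> 'a" where
  "edge_b a b c e1 e3 = (if e1 then if e3 then b else b \<triangleright>\<^sub>o c
     else if e3 then b \<triangleright>\<^sub>u a else (b \<triangleright>\<^sub>u a) \<triangleright>\<^sub>o (c \<triangleright>\<^sub>u a))"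

definition edge_c :: "'a \<Rightarrow> 'a \<Rightarrow> 'a \<Rightarrow> bool \<Rightarrow> bool \<Rightarrow> 'a" where
  "edge_c a b c e1 e2 = (if e1 then if e2 then c else c \<triangleright>\<^sub>u b
     else if e2 then c \<triangleright>\<^sub>u a else (c \<triangleright>\<^sub>u a) \<triangleright>\<^sub>u (b \<triangleright>\<^sub>u a))"

lemma edges_closed:
  assumes "a \<in> X" "b \<in> X" "c \<in> X"
  shows "edge_a a b c e e' \<in> X" "edge_b a b c e e' \<in> X" "edge_c a b c e e' \<in> X"
  using assms by (simp_all add: edge_a_def edge_b_def edge_c_def)

text \<open>Each of the three edges away from the base vertex in both remaining coordinates can be
  computed along two pairs of faces. The definitions choose one expression, and the three exchange
  laws, one per strand, identify it with the other.\<close>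

lemma cube_triangle_faces:
  assumes "a \<in> X" "b \<in> X" "c \<in> X"
  shows "triangle_faces e1 e2 e3
    (edge_a a b c e2 e3) (edge_a a b c (\<not> e2) e3) (edge_a a b c e2 (\<not> e3))
    (edge_b a b c e1 e3) (edge_b a b c (\<not> e1) e3) (edge_b a b c e1 (\<not> e3))
    (edge_c a b c e1 e2) (edge_c a b c (\<not> e1) e2) (edge_c a b c e1 (\<not> e2))"
  using exchange_uu[OF assms(3,1,2)] exchange_uo[OF assms(2,1,3)] exchange_oo[OF assms(1,3,2)]
  by (cases e1; cases e2; cases e3)
    (simp_all add: triangle_faces_def face_def edge_a_def edge_b_def edge_c_def)

text \<open>One changed coordinate is undone by inverting single operations; two are undone by
  inverting the switch on their common face and then single operations for the third edge.\<close>

lemma cube_vertex_surj: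
  assumes "\<alpha> \<in> X" "\<beta> \<in> X" "\<gamma> \<in> X"
  obtains a b c where "a \<in> X" "b \<in> X" "c \<in> X"
    "edge_a a b c e2 e3 = \<alpha>" "edge_b a b c e1 e3 = \<beta>" "edge_c a b c e1 e2 = \<gamma>"
proof -
  note edges = edge_a_def edge_b_def edge_c_def
  consider "e1" "e2" "e3" | "\<not> e1" "e2" "e3" | "e1" "\<not> e2" "e3" | "e1" "e2" "\<not> e3"
    | "\<not> e1" "\<not> e2" "e3" | "\<not> e1" "e2" "\<not> e3" | "e1" "\<not> e2" "\<not> e3" | "\<not> e1" "\<not> e2" "\<not> e3"
    by blast
  then show thesis
  proof cases
    case 1
    then show thesis
      using that[of \<alpha> \<beta> \<gamma>] assms by (simp add: edges)
  next
    case 2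
    obtain b where "b \<in> X" "b \<triangleright>\<^sub>u \<alpha> = \<beta>"
      using under_obtain[OF assms(2,1)] .
    moreover obtain c where "c \<in> X" "c \<triangleright>\<^sub>u \<alpha> = \<gamma>"
      using under_obtain[OF assms(3,1)] .
    ultimately show thesis
      using that[of \<alpha> b c] 2 assms by (simp add: edges)
  next
    case 3
    obtain a where "a \<in> X" "a \<triangleright>\<^sub>o \<beta> = \<alpha>"
      using over_obtain[OF assms(1,2)] .
    moreover obtain c where "c \<in> X" "c \<triangleright>\<^sub>u \<beta> = \<gamma>"
      using under_obtain[OF assms(3,2)] .
    ultimately show thesis
      using that[of a \<beta> c] 3 assms by (simp add: edges)
  next
    case 4
    obtain a where "a \<in> X" "a \<triangleright>\<^sub>o \<gamma> = \<alpha>"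
      using over_obtain[OF assms(1,3)] .
    moreover obtain b where "b \<in> X" "b \<triangleright>\<^sub>o \<gamma> = \<beta>"
      using over_obtain[OF assms(2,3)] .
    ultimately show thesis
      using that[of a b \<gamma>] 4 assms by (simp add: edges)
  next
    case 5
    obtain b a where ab: "b \<in> X" "a \<in> X" "a \<triangleright>\<^sub>o b = \<alpha>" "b \<triangleright>\<^sub>u a = \<beta>"
      using switch_obtain[OF assms(1,2)] .
    obtain c' where c': "c' \<in> X" "c' \<triangleright>\<^sub>u \<beta> = \<gamma>"
      using under_obtain[OF assms(3,2)] .
    obtain c where "c \<in> X" "c \<triangleright>\<^sub>u a = c'"
      using under_obtain[OF c'(1) ab(2)] .
    then show thesis
      using that[of a b c] 5 ab c' by (simp add: edges)
  next
    case 6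
    obtain c a where ac: "c \<in> X" "a \<in> X" "a \<triangleright>\<^sub>o c = \<alpha>" "c \<triangleright>\<^sub>u a = \<gamma>"
      using switch_obtain[OF assms(1,3)] .
    obtain b' where b': "b' \<in> X" "b' \<triangleright>\<^sub>o \<gamma> = \<beta>"
      using over_obtain[OF assms(2,3)] .
    obtain b where "b \<in> X" "b \<triangleright>\<^sub>u a = b'"
      using under_obtain[OF b'(1) ac(2)] .
    then show thesis
      using that[of a b c] 6 ac b' by (simp add: edges)
  next
    case 7
    obtain c b where bc: "c \<in> X" "b \<in> X" "b \<triangleright>\<^sub>o c = \<beta>" "c \<triangleright>\<^sub>u b = \<gamma>"
      using switch_obtain[OF assms(2,3)] .
    obtain a' where a': "a' \<in> X" "a' \<triangleright>\<^sub>o \<gamma> = \<alpha>"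
      using over_obtain[OF assms(1,3)] .
    obtain a where "a \<in> X" "a \<triangleright>\<^sub>o b = a'"
      using over_obtain[OF a'(1) bc(2)] .
    then show thesis
      using that[of a b c] 7 bc a' by (simp add: edges)
  next
    case 8
    \<comment> \<open>Here x, y are meant to be \<open>c \<triangleright>\<^sub>u b\<close>,
      \<open>a \<triangleright>\<^sub>o b\<close>, and p, q to be
      \<open>c \<triangleright>\<^sub>u a\<close>, \<open>b \<triangleright>\<^sub>u a\<close>. The
      labels a, b, c are solved from y, q and x; the remaining equation for p follows from
      \<open>exchange_uu\<close> by cancelling q.\<close>
    obtain x y where xy: "x \<in> X" "y \<in> X" "y \<triangleright>\<^sub>o x = \<alpha>" "x \<triangleright>\<^sub>u y = \<gamma>"
      using switch_obtain[OF assms(1,3)] .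
    obtain p q where pq: "p \<in> X" "q \<in> X" "q \<triangleright>\<^sub>o p = \<beta>" "p \<triangleright>\<^sub>u q = \<gamma>"
      using switch_obtain[OF assms(2,3)] .
    obtain b a where ab: "b \<in> X" "a \<in> X" "a \<triangleright>\<^sub>o b = y" "b \<triangleright>\<^sub>u a = q"
      using switch_obtain[OF xy(2) pq(2)] .
    obtain c where c: "c \<in> X" "c \<triangleright>\<^sub>u b = x"
      using under_obtain[OF xy(1) ab(1)] .
    have \<gamma>: "(c \<triangleright>\<^sub>u a) \<triangleright>\<^sub>u q = \<gamma>"
      using exchange_uu[OF c(1) ab(2,1)] ab c xy by simp
    have "c \<triangleright>\<^sub>u a = p"
      by (rule under_inject[OF _ pq(1,2)]) (use \<gamma> pq ab c in simp_all)
    then show thesis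
      using that[of a b c] 8 ab c xy pq \<gamma> by (simp add: edges)
  qed
qed

text \<open>Depending on e and e', the given x and y are right-hand or left-hand labels; in every
  combination one label of each strand is known, as \<open>switch_determined\<close>
  requires.\<close>

lemma face_determined:
  assumes "face e e' x x' y y'" "face e e' x x'' y y''" "x \<in> X" "x' \<in> X" "x'' \<in> X" "y \<in> X" "y' \<in> X" "y'' \<in> X"
  shows "x' = x'' \<and> y' = y''"
proof -
  let ?r = "if e then x else x'" and ?r' = "if e then x else x''"
  let ?s = "if e' then y else y'" and ?s' = "if e' then y else y''"
  have eqs: "(if e then x' else x) = ?r \<triangleright>\<^sub>u ?s" "(if e' then y' else y) = ?s \<triangleright>\<^sub>o ?r"
    "(if e then x'' else x) = ?r' \<triangleright>\<^sub>u ?s'" "(if e' then y'' else y) = ?s' \<triangleright>\<^sub>o ?r'"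
    using assms(1,2) by (cases e; cases e'; simp add: face_def)+
  have "?r = ?r' \<and> ?s = ?s'"
  proof (rule switch_determined)
    show "?s = ?s' \<or> ?s \<triangleright>\<^sub>o ?r = ?s' \<triangleright>\<^sub>o ?r'"
      unfolding eqs(2,4)[symmetric] by simp
    show "?r = ?r' \<or> ?r \<triangleright>\<^sub>u ?s = ?r' \<triangleright>\<^sub>u ?s'"
      unfolding eqs(1,3)[symmetric] by simp
  qed (use assms(3-8) in simp_all)
  then have "(if e then x' else x) = (if e then x'' else x)" "(if e' then y' else y) = (if e' then y'' else y)"
    "?r = ?r'" "?s = ?s'"
    using eqs by simp_all
  then show ?thesis
    by (cases e; cases e') simp_all
qed

text \<open>The inner labels are realised as the edges at a vertex of a cube, and they determine the
  six outer ones. The faces at the opposite vertex have the same outer edges, but the two outer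
  edges of each strand change roles, hence the interchange of a2 and a3, b1 and b3, c1 and
  c2.\<close>

lemma triangle_faces_move:
  assumes faces: "triangle_faces e1 e2 e3 \<alpha> a2 a3 \<beta> b1 b3 \<gamma> c1 c2"
    and X: "{\<alpha>, a2, a3, \<beta>, b1, b3, \<gamma>, c1, c2} \<subseteq> X"
  obtains \<alpha>' \<beta>' \<gamma>' where "\<alpha>' \<in> X" "\<beta>' \<in> X" "\<gamma>' \<in> X"
    "triangle_faces (\<not> e1) (\<not> e2) (\<not> e3) \<alpha>' a3 a2 \<beta>' b3 b1 \<gamma>' c2 c1"
proof -
  obtain a b c where abc: "a \<in> X" "b \<in> X" "c \<in> X"
    and inner: "\<alpha> = edge_a a b c e2 e3" "\<beta> = edge_b a b c e1 e3" "\<gamma> = edge_c a b c e1 e2"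
    using cube_vertex_surj[of \<alpha> \<beta> \<gamma> e2 e3 e1] X by (metis insert_subset)
  note closed = edges_closed[OF abc]
  have "b1 = edge_b a b c (\<not> e1) e3" "a2 = edge_a a b c (\<not> e2) e3"
    using face_determined[of e1 e2 \<beta> b1 \<alpha> a2] faces cube_triangle_faces[OF abc, of e1 e2 e3] X closed
    unfolding triangle_faces_def inner by auto
  moreover have "c1 = edge_c a b c (\<not> e1) e2" "a3 = edge_a a b c e2 (\<not> e3)"
    using face_determined[of e1 e3 \<gamma> c1 \<alpha> a3] faces cube_triangle_faces[OF abc, of e1 e2 e3] X closed
    unfolding triangle_faces_def inner by auto
  moreover have "c2 = edge_c a b c e1 (\<not> e2)" "b3 = edge_b a b c e1 (\<not> e3)"
    using face_determined[of e2 e3 \<gamma> c2 \<beta> b3] faces cube_triangle_faces[OF abc, of e1 e2 e3] X closed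
    unfolding triangle_faces_def inner by auto
  ultimately show thesis
    using that[OF closed, of "\<not> e2" "\<not> e3" "\<not> e1" "\<not> e3" "\<not> e1" "\<not> e2"]
      cube_triangle_faces[OF abc, of "\<not> e1" "\<not> e2" "\<not> e3"] by simp
qed

end

definition first_pair :: "'a \<times> 'a \<times> 'a \<Rightarrow> 'a \<times> 'a" where
  "first_pair v = (fst v, fst (snd v))"

definition last_pair :: "'a \<times> 'a \<times> 'a \<Rightarrow> 'a \<times> 'a" where
  "last_pair v = (fst (snd v), snd (snd v))"

context biquandle
begin

text \<open>\<open>f\<^sub>i\<close> tells whether strand \<open>i\<close> meets the smaller-numbered of the other two strands first.\<close>

definition triangle_rule ::
    "bool \<Rightarrow> bool \<Rightarrow> bool \<Rightarrow> real \<Rightarrow> real \<Rightarrow> real \<Rightarrow> 'a \<times> 'a \<times> 'a \<Rightarrow> 'a \<times> 'a \<times> 'a \<Rightarrow> 'a \<times> 'a \<times> 'a \<Rightarrow> bool" where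
  "triangle_rule f1 f2 f3 d12 d13 d23 a b c \<longleftrightarrow>
     crossing d12 (if f1 then first_pair a else last_pair a) (if f2 then first_pair b else last_pair b) \<and>
     crossing d13 (if f1 then last_pair a else first_pair a) (if f3 then first_pair c else last_pair c) \<and>
     crossing d23 (if f2 then last_pair b else first_pair b) (if f3 then last_pair c else first_pair c)"

text \<open>The assumptions are the order equations of \<open>triangle\<close>, with k for positive
  \<kappa>. The first three arguments of the faces compute, from k and the directions at a strand,
  on which side of it the triangle lies; k and three signs leave sixteen evaluations.\<close>

lemma triangle_rule_iff_faces:
  assumes "f1 \<longleftrightarrow> (k \<longleftrightarrow> d23 > 0)" "f2 \<longleftrightarrow> (k \<longleftrightarrow> d13 > 0)" "f3 \<longleftrightarrow> (k \<longleftrightarrow> d12 > 0)"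
  shows "triangle_rule f1 f2 f3 d12 d13 d23 (a0, a1, a2) (b0, b1, b2) (c0, c1, c2) \<longleftrightarrow>
    triangle_faces (\<not> (k \<longleftrightarrow> (d12 > 0 \<longleftrightarrow> d13 > 0))) (k \<longleftrightarrow> (d12 > 0 \<longleftrightarrow> d23 > 0)) (\<not> (k \<longleftrightarrow> (d13 > 0 \<longleftrightarrow> d23 > 0)))
      a1 (if f1 then a0 else a2) (if f1 then a2 else a0)
      b1 (if f2 then b0 else b2) (if f2 then b2 else b0)
      c1 (if f3 then c0 else c2) (if f3 then c2 else c0)"
  unfolding assms
  by (cases k; cases "d12 > 0"; cases "d13 > 0"; cases "d23 > 0")
    (simp_all add: triangle_rule_def triangle_faces_def face_def crossing_rule_def first_pair_def last_pair_def)

text \<open>Negating k while keeping the directions reverses the order on every strand and negates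
  all three sides, which is the passage to the opposite vertex with the strand ends fixed.\<close>

lemma triangle_rule_move:
  assumes f: "f1 \<longleftrightarrow> (k \<longleftrightarrow> d23 > 0)" "f2 \<longleftrightarrow> (k \<longleftrightarrow> d13 > 0)" "f3 \<longleftrightarrow> (k \<longleftrightarrow> d12 > 0)"
    and rule: "triangle_rule f1 f2 f3 d12 d13 d23 (a0, a1, a2) (b0, b1, b2) (c0, c1, c2)"
    and X: "{a0, a1, a2, b0, b1, b2, c0, c1, c2} \<subseteq> X"
  obtains a b c where "a \<in> X" "b \<in> X" "c \<in> X"
    "triangle_rule (\<not> f1) (\<not> f2) (\<not> f3) d12 d13 d23 (a0, a, a2) (b0, b, b2) (c0, c, c2)"
proof -
  let ?e1 = "\<not> (k \<longleftrightarrow> (d12 > 0 \<longleftrightarrow> d13 > 0))" and ?e2 = "k \<longleftrightarrow> (d12 > 0 \<longleftrightarrow> d23 > 0)"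
    and ?e3 = "\<not> (k \<longleftrightarrow> (d13 > 0 \<longleftrightarrow> d23 > 0))"
  have "{a1, if f1 then a0 else a2, if f1 then a2 else a0, b1, if f2 then b0 else b2,
      if f2 then b2 else b0, c1, if f3 then c0 else c2, if f3 then c2 else c0} \<subseteq> X"
    using X by simp
  from triangle_faces_move[OF iffD1[OF triangle_rule_iff_faces[OF f] rule] this] obtain a b c
    where abc: "a \<in> X" "b \<in> X" "c \<in> X" and faces: "triangle_faces (\<not> ?e1) (\<not> ?e2) (\<not> ?e3)
      a (if f1 then a2 else a0) (if f1 then a0 else a2) b (if f2 then b2 else b0) (if f2 then b0 else b2)
      c (if f3 then c2 else c0) (if f3 then c0 else c2)"
    by blast
  have f': "(\<not> f1) \<longleftrightarrow> (\<not> k \<longleftrightarrow> d23 > 0)" "(\<not> f2) \<longleftrightarrow> (\<not> k \<longleftrightarrow> d13 > 0)" "(\<not> f3) \<longleftrightarrow> (\<not> k \<longleftrightarrow> d12 > 0)"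
    using f by auto
  have e: "(\<not> ?e1) = (\<not> (\<not> k \<longleftrightarrow> (d12 > 0 \<longleftrightarrow> d13 > 0)))"
    "(\<not> ?e2) = (\<not> k \<longleftrightarrow> (d12 > 0 \<longleftrightarrow> d23 > 0))"
    "(\<not> ?e3) = (\<not> (\<not> k \<longleftrightarrow> (d13 > 0 \<longleftrightarrow> d23 > 0)))"
    by auto
  have swap: "(if \<not> f then x else y) = (if f then y else x)" for f and x y :: 'a
    by simp
  have "triangle_rule (\<not> f1) (\<not> f2) (\<not> f3) d12 d13 d23 (a0, a, a2) (b0, b, b2) (c0, c, c2)"
    unfolding triangle_rule_iff_faces[OF f'] swap using faces unfolding e .
  then show thesis
    by (rule that[OF abc])
qed

text \<open>Every crossing sees one end of each of its two strands. The crossing of strands 1 and 2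
  thereby fixes their middle labels, and the crossing of 1 and 3 that of strand 3.\<close>

lemma triangle_rule_determined:
  assumes "triangle_rule f1 f2 f3 d12 d13 d23 a b c" "triangle_rule f1 f2 f3 d12 d13 d23 a' b' c'"
    and X: "a \<in> X \<times> X \<times> X" "b \<in> X \<times> X \<times> X" "c \<in> X \<times> X \<times> X"
      "a' \<in> X \<times> X \<times> X" "b' \<in> X \<times> X \<times> X" "c' \<in> X \<times> X \<times> X"
    and ends: "fst a' = fst a" "snd (snd a') = snd (snd a)" "fst b' = fst b" "snd (snd b') = snd (snd b)"
      "fst c' = fst c" "snd (snd c') = snd (snd c)"
  shows "a' = a" "b' = b" "c' = c"
proof -
  have pairs: "first_pair v \<in> X \<times> X" "last_pair v \<in> X \<times> X" if "v \<in> X \<times> X \<times> X" for v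
    using that by (auto simp: first_pair_def last_pair_def)
  have "(if f1 then first_pair a else last_pair a) = (if f1 then first_pair a' else last_pair a') \<and>
      (if f2 then first_pair b else last_pair b) = (if f2 then first_pair b' else last_pair b')"
    using assms(1,2) ends unfolding triangle_rule_def
    by (intro conjI crossing_rule_determined[of d12 _ _ "if f1 then first_pair a' else last_pair a'"
          "if f2 then first_pair b' else last_pair b'"])
      (auto simp: pairs X, simp_all add: first_pair_def last_pair_def)
  moreover have "(if f1 then last_pair a else first_pair a) = (if f1 then last_pair a' else first_pair a') \<and>
      (if f3 then first_pair c else last_pair c) = (if f3 then first_pair c' else last_pair c')"
    using assms(1,2) ends unfolding triangle_rule_def
    by (intro conjI crossing_rule_determined[of d13 _ _ "if f1 then last_pair a' else first_pair a'"
          "if f3 then first_pair c' else last_pair c'"])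
      (auto simp: pairs X, simp_all add: first_pair_def last_pair_def)
  ultimately show "a' = a" "b' = b" "c' = c"
    using ends by (auto simp: first_pair_def last_pair_def prod_eq_iff split: if_splits)
qed

subsection \<open>Bigons\<close>

text \<open>Changing the sign of d exchanges, on both strands, which of before and after lies to the
  right; swapping both pairs compensates. The value 0 would fall into the second branch for d and -
  d alike.\<close>

lemma crossing_rule_reverse:
  assumes "d \<noteq> 0"
  shows "crossing (- d) (a1, a0) (b1, b0) \<longleftrightarrow> crossing d (a0, a1) (b0, b1)"
  using assms by (auto simp: crossing_rule_def)

text \<open>Given are the label of the over-strand before the crossing and one label of the
  under-strand, before it if t holds and after it otherwise. The four cases invert the over
  operation, the switch, the under operation, and nothing.\<close>

lemma crossing_rule_obtain:
  assumes "x \<in> X" "y \<in> X"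
  obtains a b where "a \<in> X" "b \<in> X" "crossing d (x, a) (if t then (y, b) else (b, y))"
proof (cases "d > 0"; cases t)
  assume t: "d > 0" t
  obtain a where "a \<in> X" "a \<triangleright>\<^sub>o y = x"
    using over_obtain[OF assms] .
  then show thesis
    using that[of a "y \<triangleright>\<^sub>u a"] t assms by (simp add: crossing_rule_def)
next
  assume t: "d > 0" "\<not> t"
  obtain b a where "b \<in> X" "a \<in> X" "a \<triangleright>\<^sub>o b = x" "b \<triangleright>\<^sub>u a = y"
    using switch_obtain[OF assms] .
  then show thesis
    using that[of a b] t by (simp add: crossing_rule_def)
next
  assume t: "\<not> d > 0" t
  obtain b where "b \<in> X" "b \<triangleright>\<^sub>u x = y"
    using under_obtain[OF assms(2,1)] .
  then show thesis
    using that[of "x \<triangleright>\<^sub>o b" b] t assms by (simp add: crossing_rule_def)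
next
  assume "\<not> d > 0" "\<not> t"
  then show thesis
    using that[of "x \<triangleright>\<^sub>o y" "y \<triangleright>\<^sub>u x"] assms by (simp add: crossing_rule_def)
qed

text \<open>t tells whether both strands meet the two crossings in the same order.\<close>

definition bigon_rule :: "bool \<Rightarrow> real \<Rightarrow> 'a \<times> 'a \<times> 'a \<Rightarrow> 'a \<times> 'a \<times> 'a \<Rightarrow> bool" where
  "bigon_rule t d a b \<longleftrightarrow>
     crossing d (first_pair a) (if t then first_pair b else last_pair b) \<and>
     crossing (- d) (last_pair a) (if t then last_pair b else first_pair b)"

text \<open>After reversing one of them, the two crossings obey the same rule and share the middle
  labels, which determine the outer ones.\<close>

lemma bigon_rule_ends:
  assumes "d \<noteq> 0" "bigon_rule t d (a0, a1, a2) (b0, b1, b2)" "{a0, a1, a2, b0, b1, b2} \<subseteq> X"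
  shows "a2 = a0" "b2 = b0"
proof -
  have "a2 = a0 \<and> b2 = b0"
  proof (cases t)
    case True
    then have "crossing (- d) (a1, a0) (b1, b0)" "crossing (- d) (a1, a2) (b1, b2)"
      using assms(2) by (simp_all add: bigon_rule_def first_pair_def last_pair_def crossing_rule_reverse[OF assms(1)])
    from crossing_rule_determined[OF this] show ?thesis
      using assms(3) by simp
  next
    case False
    then have "crossing (- d) (a1, a0) (b2, b1)" "crossing (- d) (a1, a2) (b0, b1)"
      using assms(2) by (simp_all add: bigon_rule_def first_pair_def last_pair_def crossing_rule_reverse[OF assms(1)])
    from crossing_rule_determined[OF this] show ?thesis
      using assms(3) by simp
  qed
  then show "a2 = a0" "b2 = b0"
    by auto
qed

lemma bigon_rule_obtain:
  assumes "d \<noteq> 0" "x \<in> X" "y \<in> X"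
  obtains a b where "a \<in> X" "b \<in> X" "bigon_rule t d (x, a, x) (y, b, y)"
proof -
  obtain a b where "a \<in> X" "b \<in> X" "crossing d (x, a) (if t then (y, b) else (b, y))"
    using crossing_rule_obtain[OF assms(2,3)] .
  then show thesis
    using that[of a b] by (cases t) (simp_all add: bigon_rule_def first_pair_def last_pair_def crossing_rule_reverse[OF assms(1)])
qed

lemma bigon_rule_determined:
  assumes "bigon_rule t d (x, a, x') (y, b, y')" "bigon_rule t d (x, a', x') (y, b', y')"
    and "{x, x', y, y', a, b, a', b'} \<subseteq> X"
  shows "a' = a" "b' = b"
proof -
  have "crossing d (x, a) (if t then (y, b) else (b, y'))"
    "crossing d (x, a') (if t then (y, b') else (b', y'))"
    using assms(1,2) by (simp_all add: bigon_rule_def first_pair_def last_pair_def split: if_splits)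
  from crossing_rule_determined[OF this] show "a' = a" "b' = b"
    using assms(3) by (cases t; simp)+
qed

end

section \<open>Invariance under the generalized Reidemeister moves\<close>

text \<open>V collects the virtual double points of the picture. A double point listed in C cannot
  also occur in \<open>over_under\<close> the other way round, by asymmetry.\<close>

lemma (in virtual_diagram) local_crossingsI:
  assumes dp: "double_points_on \<sigma>s D \<subseteq>
      symmetrised ((\<lambda>(\<sigma>, s, \<tau>, t). (on_strand \<sigma> s, on_strand \<tau> t)) ` C \<union> V)"
    and virtual: "\<And>p q. (p, q) \<in> V \<Longrightarrow> \<not> classical_at D p q"
    and ou: "\<And>\<sigma> s \<tau> t. (\<sigma>, s, \<tau>, t) \<in> C \<Longrightarrow> (on_strand \<sigma> s, on_strand \<tau> t) \<in> over_under D"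
    and inner: "\<And>\<sigma> s \<tau> t. (\<sigma>, s, \<tau>, t) \<in> C \<Longrightarrow>
      \<sigma> \<in> set \<sigma>s \<and> s \<in> inner_params \<sigma> \<and> \<tau> \<in> set \<sigma>s \<and> t \<in> inner_params \<tau>"
  shows "local_crossings \<sigma>s D C"
proof -
  let ?f = "\<lambda>(\<sigma>, s, \<tau>, t). (on_strand \<sigma> s, on_strand \<tau> t)"
  have img_ou: "(p, q) \<in> over_under D" if pq: "(p, q) \<in> ?f ` C" for p q
  proof -
    obtain \<sigma> s \<tau> t where "(\<sigma>, s, \<tau>, t) \<in> C" "(p, q) = (on_strand \<sigma> s, on_strand \<tau> t)"
      using pq by auto
    then show ?thesis
      using ou by simp
  qed
  have img_set: "?f x \<in> strand_set \<sigma>s \<times> strand_set \<sigma>s" if "x \<in> C" for x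
  proof -
    obtain \<sigma> s \<tau> t where x: "x = (\<sigma>, s, \<tau>, t)"
      by (cases x)
    have "s \<in> params \<sigma>" "t \<in> params \<tau>"
      using inner[of \<sigma> s \<tau> t] that unfolding x inner_params_def params_def by auto
    then have "on_strand \<sigma> s \<in> strand_set \<sigma>s" "on_strand \<tau> t \<in> strand_set \<sigma>s"
      using inner[of \<sigma> s \<tau> t] that unfolding x strand_set_def by blast+
    then show ?thesis
      by (simp add: x)
  qed
  have "over_under D \<inter> strand_set \<sigma>s \<times> strand_set \<sigma>s = ?f ` C"
  proof (intro equalityI subsetI)
    fix x assume "x \<in> over_under D \<inter> strand_set \<sigma>s \<times> strand_set \<sigma>s"
    moreover obtain p q where x: "x = (p, q)"
      by (cases x)
    ultimately have pq: "(p, q) \<in> over_under D" "(p, q) \<in> double_points_on \<sigma>s D"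
      using over_under_double by (auto simp: double_points_on_def)
    then consider "(p, q) \<in> ?f ` C" | "(q, p) \<in> ?f ` C" | "(p, q) \<in> V" | "(q, p) \<in> V"
      using dp unfolding symmetrised_def by blast
    then show "x \<in> ?f ` C"
    proof cases
      case 2
      then show ?thesis
        using over_under_asym[OF pq(1)] img_ou by blast
    next
      case 3
      then show ?thesis
        using virtual pq(1) unfolding classical_at_def by blast
    next
      case 4
      then show ?thesis
        using virtual pq(1) unfolding classical_at_def by blast
    qed (simp add: x)
  next
    fix x assume "x \<in> ?f ` C"
    then show "x \<in> over_under D \<inter> strand_set \<sigma>s \<times> strand_set \<sigma>s"
      using img_ou img_set by (cases x) auto
  qed
  then show ?thesis
    unfolding local_crossings_def using inner by auto
qed

lemma crossed_empty: "\<not> crossed {} \<rho> r"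
  by (simp add: crossed_def)

lemma crossed_insert:
  "crossed (insert (\<sigma>, s, \<tau>, t) C) \<rho> r \<longleftrightarrow> \<rho> = \<sigma> \<and> r = s \<or> \<rho> = \<tau> \<and> r = t \<or> crossed C \<rho> r"
  unfolding crossed_def by blast

lemma strand_interiorI: "\<sigma> \<in> set \<sigma>s \<Longrightarrow> s \<in> inner_params \<sigma> \<Longrightarrow> on_strand \<sigma> s \<in> strand_interior \<sigma>s"
  unfolding strand_interior_def by blast

text \<open>A repeated strand would be disjoint from itself, yet it contains its starting
  point.\<close>

lemma (in local_change) strands_distinct: "distinct \<sigma>s"
proof -
  have "\<sigma>s ! m \<noteq> \<sigma>s ! n" if "m < length \<sigma>s" "n < m" for m n
  proof
    assume eq: "\<sigma>s ! m = \<sigma>s ! n"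
    obtain i a b where iab: "\<sigma>s ! m = (i, a, b)"
      by (cases "\<sigma>s ! m")
    then have "(i, a, b) \<in> set \<sigma>s"
      using that(1) by (metis nth_mem)
    then have "a \<in> params (i, a, b)"
      using strand by (simp add: params_def less_imp_le)
    then have "on_strand (i, a, b) a \<in> strand_set [\<sigma>s ! m]"
      by (simp add: strand_set_def iab)
    moreover have "disjnt (strand_set [\<sigma>s ! m]) (strand_set [\<sigma>s ! n])"
      using change that unfolding disc_change_def by blast
    ultimately show False
      unfolding eq disjnt_iff by blast
  qed
  then show ?thesis
    unfolding distinct_conv_nth by (metis nat_neq_iff)
qed

text \<open>Marks must be increasing, while the order of two crossings on a strand varies with the
  picture; taking \<open>min\<close> and \<open>max\<close> treats all orders at once.\<close>

lemma two_step_min_max: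
  assumes "s \<noteq> t"
  shows "two_step (min s t, max s t) v s = (if s < t then first_pair v else last_pair v)"
    and "two_step (min s t, max s t) v t = (if s < t then last_pair v else first_pair v)"
  using assms by (cases v; auto simp: two_step_def first_pair_def last_pair_def min_def max_def)+

section \<open>Classical curls and bigons\<close>

context biquandle
begin

lemma classical_R1_same_colorings:
  assumes "finite X" and D: "is_vdiagram D" and D': "is_vdiagram D'" and R1: "classical_R1 D D'"
  shows "same_colorings_X D D'"
proof -
  obtain \<sigma> s t where change: "disc_change [\<sigma>] D D'"
    and inner: "s \<in> inner_params \<sigma>" "t \<in> inner_params \<sigma>" and st: "s < t"
    and dp: "double_points_on [\<sigma>] D = {}"
    and dp': "double_points_on [\<sigma>] D' = symmetrised {(on_strand \<sigma> s, on_strand \<sigma> t)}"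
    and classical: "classical_at D' (on_strand \<sigma> s) (on_strand \<sigma> t)"
    using R1 unfolding classical_R1_def curl_def by blast
  interpret local_change D D' "[\<sigma>]"
    by unfold_locales (use D D' change dp in \<open>auto simp: dp' symmetrised_def inner intro!: strand_interiorI\<close>)
  \<comment> \<open>\<open>classical_at\<close> leaves open which passage is the over one; d below
    is accordingly taken from the over branch to the under branch.\<close>
  define over_first where "over_first \<longleftrightarrow> (on_strand \<sigma> s, on_strand \<sigma> t) \<in> over_under D'"
  define C' where "C' = (if over_first then {(\<sigma>, s, \<sigma>, t)} else {(\<sigma>, t, \<sigma>, s)})"
  define d where "d = (if over_first then crossing_direction D' (on_strand \<sigma> s) (on_strand \<sigma> t)
    else crossing_direction D' (on_strand \<sigma> t) (on_strand \<sigma> s))"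
  \<comment> \<open>The same marks are used for D, where they carry no crossing and the three labels
    are therefore equal.\<close>
  define m where "m = (\<lambda>_ :: strand. (min s t, max s t))"
  have C: "local_crossings [\<sigma>] D {}"
    by (rule D.local_crossingsI[where V = "{}"]) (simp_all add: dp)
  have C': "local_crossings [\<sigma>] D' C'"
  proof (rule D'.local_crossingsI[where V = "{}"])
    show "double_points_on [\<sigma>] D' \<subseteq> symmetrised ((\<lambda>(\<sigma>, s, \<tau>, t). (on_strand \<sigma> s, on_strand \<tau> t)) ` C' \<union> {})"
      by (auto simp: dp' C'_def symmetrised_def)
  qed (use classical inner in \<open>auto simp: C'_def over_first_def classical_at_def split: if_splits\<close>)
  have m: "marked [\<sigma>] {} m" "marked [\<sigma>] C' m"
    using inner st by (auto simp: marked_def m_def crossed_insert crossed_empty C'_def split: if_splits)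
  have fits: "fits_X [\<sigma>] D {} m v \<longleftrightarrow> (\<exists>x\<in>X. v \<sigma> = (x, x, x))" for v
    by (cases "v \<sigma>") (auto simp: fits_def crossed_insert crossed_empty)
  have fits': "fits_X [\<sigma>] D' C' m v \<longleftrightarrow> (\<exists>x\<in>X. \<exists>y\<in>X. v \<sigma> = (x, y, x) \<and> curl_rule d over_first (x, y, x))"
    for v
  proof -
    obtain x y z where v: "v \<sigma> = (x, y, z)"
      by (cases "v \<sigma>")
    have "crossed C' \<sigma> s" "crossed C' \<sigma> t"
      by (auto simp: crossed_insert crossed_empty C'_def)
    then have "fits_X [\<sigma>] D' C' m v \<longleftrightarrow> x \<in> X \<and> y \<in> X \<and> z \<in> X \<and> curl_rule d over_first (x, y, z)"
      using st two_step_min_max[of s t "(x, y, z)"]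
      by (cases over_first)
        (simp_all add: fits_def C'_def m_def v curl_rule_def d_def first_pair_def last_pair_def)
    then show ?thesis
      using curl_rule_iff[OF \<open>finite X\<close>] by (auto simp: v)
  qed
  show ?thesis
  proof (rule same_coloringsI_local[OF C m(1) C' m(2)])
    fix v assume "fits_X [\<sigma>] D {} m v"
    then obtain x where x: "x \<in> X" "v \<sigma> = (x, x, x)"
      using fits by blast
    then obtain y where "y \<in> X" "curl_rule d over_first (x, y, x)"
      using curl_rule_ex1[OF \<open>finite X\<close>] by blast
    then show "\<exists>v'. fits_X [\<sigma>] D' C' m v' \<and> same_ends [\<sigma>] v v'"
      using x by (intro exI[of _ "\<lambda>_. (x, y, x)"]) (simp add: fits' same_ends_def)
  next
    fix v assume "fits_X [\<sigma>] D' C' m v"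
    then obtain x y where x: "x \<in> X" "v \<sigma> = (x, y, x)"
      using fits' by blast
    then show "\<exists>v'. fits_X [\<sigma>] D {} m v' \<and> same_ends [\<sigma>] v v'"
      by (intro exI[of _ "\<lambda>_. (x, x, x)"]) (simp add: fits same_ends_def)
  next
    fix v v' assume "fits_X [\<sigma>] D {} m v" "fits_X [\<sigma>] D {} m v'" "same_ends [\<sigma>] v v'"
    then show "\<forall>\<sigma>\<in>set [\<sigma>]. v' \<sigma> = v \<sigma>"
      by (auto simp: fits same_ends_def)
  next
    fix v v' assume "fits_X [\<sigma>] D' C' m v" "fits_X [\<sigma>] D' C' m v'" "same_ends [\<sigma>] v v'"
    then show "\<forall>\<sigma>\<in>set [\<sigma>]. v' \<sigma> = v \<sigma>"
      using curl_rule_ex1[OF \<open>finite X\<close>] by (fastforce simp: fits' same_ends_def)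
  qed
qed

lemma classical_R2_same_colorings:
  assumes D: "is_vdiagram D" and D': "is_vdiagram D'" and R2: "classical_R2 D D'"
  shows "same_colorings_X D D'"
proof -
  obtain \<sigma> \<tau> s1 s2 t1 t2 where bigon: "bigon \<sigma> \<tau> s1 s2 t1 t2 D D'"
    and ou: "(on_strand \<sigma> s1, on_strand \<tau> t1) \<in> over_under D'" "(on_strand \<sigma> s2, on_strand \<tau> t2) \<in> over_under D'"
    using R2 unfolding classical_R2_def by blast
  have change: "disc_change [\<sigma>, \<tau>] D D'"
    and inner: "s1 \<in> inner_params \<sigma>" "s2 \<in> inner_params \<sigma>" "t1 \<in> inner_params \<tau>" "t2 \<in> inner_params \<tau>"
    and st: "s1 < s2" "t1 \<noteq> t2" and dp: "double_points_on [\<sigma>, \<tau>] D = {}"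
    and dp': "double_points_on [\<sigma>, \<tau>] D' =
       symmetrised {(on_strand \<sigma> s1, on_strand \<tau> t1), (on_strand \<sigma> s2, on_strand \<tau> t2)}"
    and dir: "crossing_direction D' (on_strand \<sigma> s1) (on_strand \<tau> t1) =
       - crossing_direction D' (on_strand \<sigma> s2) (on_strand \<tau> t2)"
    using bigon unfolding bigon_def by simp_all
  interpret local_change D D' "[\<sigma>, \<tau>]"
    by unfold_locales (use D D' change dp in \<open>auto simp: dp' symmetrised_def inner intro!: strand_interiorI\<close>)
  have distinct: "\<sigma> \<noteq> \<tau>" "\<tau> \<noteq> \<sigma>"
    using strands_distinct by auto
  define C' where "C' = {(\<sigma>, s1, \<tau>, t1), (\<sigma>, s2, \<tau>, t2)}"
  define d where "d = crossing_direction D' (on_strand \<sigma> s1) (on_strand \<tau> t1)"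
  have d: "d \<noteq> 0" "crossing_direction D' (on_strand \<sigma> s2) (on_strand \<tau> t2) = - d"
    using D'.transversal[OF subsetD[OF D'.over_under_double ou(1)]] dir by (simp_all add: d_def)
  \<comment> \<open>One choice of marks for both diagrams; in D no crossing lies on them and each
    strand has a single label.\<close>
  define m where "m = (\<lambda>\<rho>. if \<rho> = \<sigma> then (min s1 s2, max s1 s2) else (min t1 t2, max t1 t2))"
  have C: "local_crossings [\<sigma>, \<tau>] D {}"
    by (rule D.local_crossingsI[where V = "{}"]) (simp_all add: dp)
  have C': "local_crossings [\<sigma>, \<tau>] D' C'"
    by (rule D'.local_crossingsI[where V = "{}"]) (use ou inner in \<open>auto simp: C'_def dp'\<close>)
  have m: "marked [\<sigma>, \<tau>] {} m" "marked [\<sigma>, \<tau>] C' m"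
    using inner st distinct by (auto simp: marked_def m_def crossed_insert crossed_empty C'_def min_def max_def)
  have fits: "fits_X [\<sigma>, \<tau>] D {} m v \<longleftrightarrow> (\<exists>x\<in>X. \<exists>y\<in>X. v \<sigma> = (x, x, x) \<and> v \<tau> = (y, y, y))" for v
    by (cases "v \<sigma>"; cases "v \<tau>") (auto simp: fits_def crossed_insert crossed_empty)
  have fits': "fits_X [\<sigma>, \<tau>] D' C' m v \<longleftrightarrow>
      v \<sigma> \<in> X \<times> X \<times> X \<and> v \<tau> \<in> X \<times> X \<times> X \<and> bigon_rule (t1 < t2) d (v \<sigma>) (v \<tau>)" for v
  proof -
    have "crossed C' \<sigma> s1" "crossed C' \<sigma> s2" "crossed C' \<tau> t1" "crossed C' \<tau> t2"
      by (auto simp: crossed_insert crossed_empty C'_def)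
    then have "crossed C' \<sigma> (min s1 s2)" "crossed C' \<sigma> (max s1 s2)"
      "crossed C' \<tau> (min t1 t2)" "crossed C' \<tau> (max t1 t2)"
      by (simp_all add: min_def max_def)
    then show ?thesis
      using st distinct two_step_min_max[of s1 s2 "v \<sigma>"]
      by (simp add: fits_def m_def C'_def bigon_rule_def two_step_min_max d(2) flip: d_def)
  qed
  show ?thesis
  proof (rule same_coloringsI_local[OF C m(1) C' m(2)])
    fix v assume "fits_X [\<sigma>, \<tau>] D {} m v"
    then obtain x y where xy: "x \<in> X" "y \<in> X" "v \<sigma> = (x, x, x)" "v \<tau> = (y, y, y)"
      using fits by blast
    obtain a b where "a \<in> X" "b \<in> X" "bigon_rule (t1 < t2) d (x, a, x) (y, b, y)"
      using bigon_rule_obtain[OF d(1) xy(1,2)] .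
    then show "\<exists>v'. fits_X [\<sigma>, \<tau>] D' C' m v' \<and> same_ends [\<sigma>, \<tau>] v v'"
      using xy distinct by (intro exI[of _ "\<lambda>\<rho>. if \<rho> = \<sigma> then (x, a, x) else (y, b, y)"]) (simp add: fits' same_ends_def)
  next
    fix v assume v: "fits_X [\<sigma>, \<tau>] D' C' m v"
    obtain x a x' y b y' where xy: "v \<sigma> = (x, a, x')" "v \<tau> = (y, b, y')"
      by (metis prod_cases3)
    then have "x' = x" "y' = y" "x \<in> X" "y \<in> X"
      using v bigon_rule_ends[OF d(1), of "t1 < t2" x a x' y b y'] by (simp_all add: fits')
    then show "\<exists>v'. fits_X [\<sigma>, \<tau>] D {} m v' \<and> same_ends [\<sigma>, \<tau>] v v'"
      using xy distinct by (intro exI[of _ "\<lambda>\<rho>. if \<rho> = \<sigma> then (x, x, x) else (y, y, y)"]) (simp add: fits same_ends_def)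
  next
    fix v v' assume "fits_X [\<sigma>, \<tau>] D {} m v" "fits_X [\<sigma>, \<tau>] D {} m v'" "same_ends [\<sigma>, \<tau>] v v'"
    then show "\<forall>\<sigma>\<in>set [\<sigma>, \<tau>]. v' \<sigma> = v \<sigma>"
      by (auto simp: fits same_ends_def)
  next
    fix v v' assume v: "fits_X [\<sigma>, \<tau>] D' C' m v" "fits_X [\<sigma>, \<tau>] D' C' m v'"
      and ends: "same_ends [\<sigma>, \<tau>] v v'"
    obtain x a x' y b y' where xy: "v \<sigma> = (x, a, x')" "v \<tau> = (y, b, y')"
      by (metis prod_cases3)
    moreover obtain a' b' where xy': "v' \<sigma> = (x, a', x')" "v' \<tau> = (y, b', y')"
      using ends xy unfolding same_ends_def by (cases "v' \<sigma>"; cases "v' \<tau>") auto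
    ultimately show "\<forall>\<sigma>\<in>set [\<sigma>, \<tau>]. v' \<sigma> = v \<sigma>"
      using v bigon_rule_determined[of "t1 < t2" d x a x' y b y' a' b'] by (simp add: fits')
  qed
qed

end

section \<open>Triangle moves with classical crossings\<close>

definition triangle_marks :: "(nat \<Rightarrow> strand) \<Rightarrow> (nat \<Rightarrow> nat \<Rightarrow> real) \<Rightarrow> strand \<Rightarrow> real \<times> real" where
  "triangle_marks \<sigma> s = (\<lambda>\<rho>.
     if \<rho> = \<sigma> 1 then (min (s 1 2) (s 1 3), max (s 1 2) (s 1 3))
     else if \<rho> = \<sigma> 2 then (min (s 2 1) (s 2 3), max (s 2 1) (s 2 3))
     else (min (s 3 1) (s 3 2), max (s 3 1) (s 3 2)))"

definition triangle_crossings :: "(nat \<Rightarrow> strand) \<Rightarrow> (nat \<Rightarrow> nat \<Rightarrow> real) \<Rightarrow> local_crossing set" where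
  "triangle_crossings \<sigma> s = {(\<sigma> 1, s 1 2, \<sigma> 2, s 2 1), (\<sigma> 1, s 1 3, \<sigma> 3, s 3 1), (\<sigma> 2, s 2 3, \<sigma> 3, s 3 2)}"

text \<open>Transversality makes the directions non-zero, so the sign equations of
  \<open>triangle\<close> become strict comparisons, with \<kappa> reduced to the truth value of its
  positivity.\<close>

lemma (in virtual_diagram) triangle_data:
  assumes tri: "triangle \<kappa> \<sigma> s D" and \<kappa>: "\<kappa> \<in> {1, -1}"
  shows "s 1 2 \<in> inner_params (\<sigma> 1)" "s 1 3 \<in> inner_params (\<sigma> 1)" "s 2 1 \<in> inner_params (\<sigma> 2)"
    "s 2 3 \<in> inner_params (\<sigma> 2)" "s 3 1 \<in> inner_params (\<sigma> 3)" "s 3 2 \<in> inner_params (\<sigma> 3)"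
    and "double_points_on [\<sigma> 1, \<sigma> 2, \<sigma> 3] D =
       symmetrised {strand_crossing \<sigma> s 1 2, strand_crossing \<sigma> s 1 3, strand_crossing \<sigma> s 2 3}"
    and "s 1 2 \<noteq> s 1 3" "s 2 1 \<noteq> s 2 3" "s 3 1 \<noteq> s 3 2"
    and "s 1 2 < s 1 3 \<longleftrightarrow> (\<kappa> > 0 \<longleftrightarrow> strand_direction D \<sigma> s 2 3 > 0)"
    and "s 2 1 < s 2 3 \<longleftrightarrow> (\<kappa> > 0 \<longleftrightarrow> strand_direction D \<sigma> s 1 3 > 0)"
    and "s 3 1 < s 3 2 \<longleftrightarrow> (\<kappa> > 0 \<longleftrightarrow> strand_direction D \<sigma> s 1 2 > 0)"
proof -
  show "s 1 2 \<in> inner_params (\<sigma> 1)" "s 1 3 \<in> inner_params (\<sigma> 1)" "s 2 1 \<in> inner_params (\<sigma> 2)"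
    "s 2 3 \<in> inner_params (\<sigma> 2)" "s 3 1 \<in> inner_params (\<sigma> 3)" "s 3 2 \<in> inner_params (\<sigma> 3)"
    and dp: "double_points_on [\<sigma> 1, \<sigma> 2, \<sigma> 3] D =
       symmetrised {strand_crossing \<sigma> s 1 2, strand_crossing \<sigma> s 1 3, strand_crossing \<sigma> s 2 3}"
    using tri unfolding triangle_def by simp_all
  have "symmetrised {strand_crossing \<sigma> s 1 2, strand_crossing \<sigma> s 1 3, strand_crossing \<sigma> s 2 3} \<subseteq> double_points D"
    unfolding dp[symmetric] double_points_on_def by blast
  then have nz: "strand_direction D \<sigma> s 1 2 \<noteq> 0" "strand_direction D \<sigma> s 1 3 \<noteq> 0" "strand_direction D \<sigma> s 2 3 \<noteq> 0"
    by (intro transversal; simp add: symmetrised_def)+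
  have order: "x \<noteq> y \<and> (x < y \<longleftrightarrow> (\<kappa> > 0 \<longleftrightarrow> d > 0))" if "sgn (y - x) = \<kappa> * d" "d \<noteq> 0" for x y d :: real
  proof -
    have "\<kappa> * d \<noteq> 0"
      using \<kappa> that(2) by auto
    moreover have "x < y \<longleftrightarrow> \<kappa> * d > 0"
      unfolding that(1)[symmetric] by simp
    moreover have "\<kappa> * d > 0 \<longleftrightarrow> (\<kappa> > 0 \<longleftrightarrow> d > 0)"
      using \<kappa> that(2) by auto
    ultimately show ?thesis
      using that(1) by auto
  qed
  have "sgn (s 1 3 - s 1 2) = \<kappa> * strand_direction D \<sigma> s 2 3"
    "sgn (s 2 3 - s 2 1) = \<kappa> * strand_direction D \<sigma> s 1 3"
    "sgn (s 3 2 - s 3 1) = \<kappa> * strand_direction D \<sigma> s 1 2"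
    using tri unfolding triangle_def by simp_all
  from order[OF this(1) nz(3)] order[OF this(2) nz(2)] order[OF this(3) nz(1)]
  show "s 1 2 \<noteq> s 1 3" "s 2 1 \<noteq> s 2 3" "s 3 1 \<noteq> s 3 2"
    and "s 1 2 < s 1 3 \<longleftrightarrow> (\<kappa> > 0 \<longleftrightarrow> strand_direction D \<sigma> s 2 3 > 0)"
    and "s 2 1 < s 2 3 \<longleftrightarrow> (\<kappa> > 0 \<longleftrightarrow> strand_direction D \<sigma> s 1 3 > 0)"
    and "s 3 1 < s 3 2 \<longleftrightarrow> (\<kappa> > 0 \<longleftrightarrow> strand_direction D \<sigma> s 1 2 > 0)"
    by auto
qed

lemma (in virtual_diagram) triangle_interior:
  assumes "triangle \<kappa> \<sigma> s D" "\<kappa> \<in> {1, -1}"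
  shows "double_points_on [\<sigma> 1, \<sigma> 2, \<sigma> 3] D \<subseteq> strand_interior [\<sigma> 1, \<sigma> 2, \<sigma> 3] \<times> strand_interior [\<sigma> 1, \<sigma> 2, \<sigma> 3]"
  unfolding triangle_data(7)[OF assms]
  using triangle_data(1-6)[OF assms] by (auto simp: symmetrised_def intro!: strand_interiorI)

lemma triangle_change_local_change:
  assumes "is_vdiagram D" "is_vdiagram D'" "triangle_change \<sigma> s s' D D'"
  shows "local_change D D' [\<sigma> 1, \<sigma> 2, \<sigma> 3]"
proof -
  interpret D: virtual_diagram D by unfold_locales (rule assms)
  interpret D': virtual_diagram D' by unfold_locales (rule assms)
  obtain \<kappa> where \<kappa>: "\<kappa> \<in> {1, -1}" "triangle \<kappa> \<sigma> s D" "triangle (- \<kappa>) \<sigma> s' D'"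
    using assms(3) unfolding triangle_change_def by blast
  then have \<kappa>': "- \<kappa> \<in> {1, -1}"
    by auto
  show ?thesis
    using assms(3) D.triangle_interior[OF \<kappa>(2,1)] D'.triangle_interior[OF \<kappa>(3) \<kappa>']
    by unfold_locales (simp_all add: triangle_change_def)
qed

text \<open>Stated for a subset of the crossings, so that the same marks serve the classical move
  with three classical crossings and the mixed move with one.\<close>

lemma (in virtual_diagram) marked_triangle:
  assumes tri: "triangle \<kappa> \<sigma> s D" "\<kappa> \<in> {1, -1}" and distinct: "distinct [\<sigma> 1, \<sigma> 2, \<sigma> 3]"
    and C: "C \<subseteq> triangle_crossings \<sigma> s"
  shows "marked [\<sigma> 1, \<sigma> 2, \<sigma> 3] C (triangle_marks \<sigma> s)"
proof -
  have "crossed (triangle_crossings \<sigma> s) \<rho> t" if "crossed C \<rho> t" for \<rho> t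
    using that C unfolding crossed_def by blast
  moreover have "marked [\<sigma> 1, \<sigma> 2, \<sigma> 3] (triangle_crossings \<sigma> s) (triangle_marks \<sigma> s)"
    using triangle_data(1-6,8-10)[OF tri] distinct
    by (auto simp: marked_def triangle_marks_def triangle_crossings_def crossed_insert crossed_empty min_def max_def)
  ultimately show ?thesis
    unfolding marked_def by blast
qed

lemma (in biquandle) fits_triangle:
  assumes distinct: "distinct [\<sigma> 1, \<sigma> 2, \<sigma> 3]" and ne: "s 1 2 \<noteq> s 1 3" "s 2 1 \<noteq> s 2 3" "s 3 1 \<noteq> s 3 2"
  shows "fits_X [\<sigma> 1, \<sigma> 2, \<sigma> 3] E (triangle_crossings \<sigma> s) (triangle_marks \<sigma> s) v \<longleftrightarrow>
    v (\<sigma> 1) \<in> X \<times> X \<times> X \<and> v (\<sigma> 2) \<in> X \<times> X \<times> X \<and> v (\<sigma> 3) \<in> X \<times> X \<times> X \<and>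
    triangle_rule (s 1 2 < s 1 3) (s 2 1 < s 2 3) (s 3 1 < s 3 2)
      (strand_direction E \<sigma> s 1 2) (strand_direction E \<sigma> s 1 3) (strand_direction E \<sigma> s 2 3)
      (v (\<sigma> 1)) (v (\<sigma> 2)) (v (\<sigma> 3))"
proof -
  let ?C = "triangle_crossings \<sigma> s"
  have "crossed ?C (\<sigma> 1) (s 1 2)" "crossed ?C (\<sigma> 1) (s 1 3)" "crossed ?C (\<sigma> 2) (s 2 1)"
    "crossed ?C (\<sigma> 2) (s 2 3)" "crossed ?C (\<sigma> 3) (s 3 1)" "crossed ?C (\<sigma> 3) (s 3 2)"
    by (auto simp: crossed_insert crossed_empty triangle_crossings_def)
  then have crossed: "crossed ?C (\<sigma> 1) (min (s 1 2) (s 1 3))" "crossed ?C (\<sigma> 1) (max (s 1 2) (s 1 3))"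
    "crossed ?C (\<sigma> 2) (min (s 2 1) (s 2 3))" "crossed ?C (\<sigma> 2) (max (s 2 1) (s 2 3))"
    "crossed ?C (\<sigma> 3) (min (s 3 1) (s 3 2))" "crossed ?C (\<sigma> 3) (max (s 3 1) (s 3 2))"
    by (simp_all add: min_def max_def)
  have m: "triangle_marks \<sigma> s (\<sigma> 1) = (min (s 1 2) (s 1 3), max (s 1 2) (s 1 3))"
    "triangle_marks \<sigma> s (\<sigma> 2) = (min (s 2 1) (s 2 3), max (s 2 1) (s 2 3))"
    "triangle_marks \<sigma> s (\<sigma> 3) = (min (s 3 1) (s 3 2), max (s 3 1) (s 3 2))"
    using distinct by (auto simp: triangle_marks_def)
  show ?thesis
    unfolding fits_def
    by (simp add: crossed m del: One_nat_def)
      (simp add: triangle_crossings_def m two_step_min_max ne triangle_rule_def del: One_nat_def)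
qed

lemma (in biquandle) fits_triangle_move:
  assumes distinct: "distinct [\<sigma> 1, \<sigma> 2, \<sigma> 3]"
    and D: "is_vdiagram D" "triangle \<kappa> \<sigma> s D" "\<kappa> \<in> {1, -1}"
    and D': "is_vdiagram D'" "triangle (- \<kappa>) \<sigma> s' D'"
    and dir: "strand_direction D' \<sigma> s' 1 2 = strand_direction D \<sigma> s 1 2"
      "strand_direction D' \<sigma> s' 1 3 = strand_direction D \<sigma> s 1 3"
      "strand_direction D' \<sigma> s' 2 3 = strand_direction D \<sigma> s 2 3"
    and v: "fits_X [\<sigma> 1, \<sigma> 2, \<sigma> 3] D (triangle_crossings \<sigma> s) (triangle_marks \<sigma> s) v"
  shows "\<exists>v'. fits_X [\<sigma> 1, \<sigma> 2, \<sigma> 3] D' (triangle_crossings \<sigma> s') (triangle_marks \<sigma> s') v' \<and>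
    same_ends [\<sigma> 1, \<sigma> 2, \<sigma> 3] v v'"
proof -
  interpret D: virtual_diagram D by unfold_locales (rule D)
  interpret D': virtual_diagram D' by unfold_locales (rule D')
  have \<kappa>': "- \<kappa> \<in> {1, -1}"
    using D(3) by auto
  note tri = D.triangle_data(8-13)[OF D(2,3)] and tri' = D'.triangle_data(8-13)[OF D'(2) \<kappa>', unfolded dir]
  \<comment> \<open>The directions are unchanged and \<kappa> changes sign, so the order of the two
    crossings is reversed on every strand.\<close>
  have flip: "s' 1 2 < s' 1 3 \<longleftrightarrow> \<not> s 1 2 < s 1 3" "s' 2 1 < s' 2 3 \<longleftrightarrow> \<not> s 2 1 < s 2 3"
    "s' 3 1 < s' 3 2 \<longleftrightarrow> \<not> s 3 1 < s 3 2"
    unfolding tri(4-6) tri'(4-6) using D(3) by auto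
  obtain a0 a1 a2 where a: "v (\<sigma> 1) = (a0, a1, a2)"
    by (rule prod_cases3)
  obtain b0 b1 b2 where b: "v (\<sigma> 2) = (b0, b1, b2)"
    by (rule prod_cases3)
  obtain c0 c1 c2 where c: "v (\<sigma> 3) = (c0, c1, c2)"
    by (rule prod_cases3)
  note v' = iffD1[OF fits_triangle[OF distinct tri(1-3)] v, unfolded a b c]
  then have X: "{a0, a1, a2, b0, b1, b2, c0, c1, c2} \<subseteq> X"
    by simp
  obtain x y z where xyz: "x \<in> X" "y \<in> X" "z \<in> X" and
    rule: "triangle_rule (\<not> s 1 2 < s 1 3) (\<not> s 2 1 < s 2 3) (\<not> s 3 1 < s 3 2)
      (strand_direction D \<sigma> s 1 2) (strand_direction D \<sigma> s 1 3) (strand_direction D \<sigma> s 2 3)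
      (a0, x, a2) (b0, y, b2) (c0, z, c2)"
    using triangle_rule_move[OF tri(4-6) _ X] v' by blast
  let ?v = "\<lambda>\<rho>. if \<rho> = \<sigma> 1 then (a0, x, a2) else if \<rho> = \<sigma> 2 then (b0, y, b2) else (c0, z, c2)"
  have ev: "?v (\<sigma> 1) = (a0, x, a2)" "?v (\<sigma> 2) = (b0, y, b2)" "?v (\<sigma> 3) = (c0, z, c2)"
    using distinct by auto
  have "fits_X [\<sigma> 1, \<sigma> 2, \<sigma> 3] D' (triangle_crossings \<sigma> s') (triangle_marks \<sigma> s') ?v"
    unfolding fits_triangle[OF distinct tri'(1-3)] ev dir flip using rule X xyz by simp
  moreover have "same_ends [\<sigma> 1, \<sigma> 2, \<sigma> 3] v ?v"
    using ev a b c by (simp add: same_ends_def)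
  ultimately show ?thesis
    by blast
qed

lemma (in biquandle) fits_triangle_unique:
  assumes distinct: "distinct [\<sigma> 1, \<sigma> 2, \<sigma> 3]" and D: "is_vdiagram D" "triangle \<kappa> \<sigma> s D" "\<kappa> \<in> {1, -1}"
    and v: "fits_X [\<sigma> 1, \<sigma> 2, \<sigma> 3] D (triangle_crossings \<sigma> s) (triangle_marks \<sigma> s) v"
      "fits_X [\<sigma> 1, \<sigma> 2, \<sigma> 3] D (triangle_crossings \<sigma> s) (triangle_marks \<sigma> s) v'"
    and ends: "same_ends [\<sigma> 1, \<sigma> 2, \<sigma> 3] v v'"
  shows "\<forall>\<rho>\<in>set [\<sigma> 1, \<sigma> 2, \<sigma> 3]. v' \<rho> = v \<rho>"
proof -
  interpret D: virtual_diagram D by unfold_locales (rule D)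
  note fits = v[unfolded fits_triangle[OF distinct D.triangle_data(8-10)[OF D(2,3)]]]
  have X: "v (\<sigma> 1) \<in> X \<times> X \<times> X" "v (\<sigma> 2) \<in> X \<times> X \<times> X" "v (\<sigma> 3) \<in> X \<times> X \<times> X"
    and rule: "triangle_rule (s 1 2 < s 1 3) (s 2 1 < s 2 3) (s 3 1 < s 3 2)
      (strand_direction D \<sigma> s 1 2) (strand_direction D \<sigma> s 1 3) (strand_direction D \<sigma> s 2 3)
      (v (\<sigma> 1)) (v (\<sigma> 2)) (v (\<sigma> 3))"
    using fits(1) by iprover+
  have X': "v' (\<sigma> 1) \<in> X \<times> X \<times> X" "v' (\<sigma> 2) \<in> X \<times> X \<times> X" "v' (\<sigma> 3) \<in> X \<times> X \<times> X"
    and rule': "triangle_rule (s 1 2 < s 1 3) (s 2 1 < s 2 3) (s 3 1 < s 3 2)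
      (strand_direction D \<sigma> s 1 2) (strand_direction D \<sigma> s 1 3) (strand_direction D \<sigma> s 2 3)
      (v' (\<sigma> 1)) (v' (\<sigma> 2)) (v' (\<sigma> 3))"
    using fits(2) by iprover+
  have "fst (v' (\<sigma> 1)) = fst (v (\<sigma> 1))" "snd (snd (v' (\<sigma> 1))) = snd (snd (v (\<sigma> 1)))"
    "fst (v' (\<sigma> 2)) = fst (v (\<sigma> 2))" "snd (snd (v' (\<sigma> 2))) = snd (snd (v (\<sigma> 2)))"
    "fst (v' (\<sigma> 3)) = fst (v (\<sigma> 3))" "snd (snd (v' (\<sigma> 3))) = snd (snd (v (\<sigma> 3)))"
    using ends by (simp_all add: same_ends_def)
  from triangle_rule_determined[OF rule rule' X X' this] show ?thesis
    by simp
qed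

lemma (in biquandle) classical_R3_same_colorings:
  assumes D: "is_vdiagram D" and D': "is_vdiagram D'" and R3: "classical_R3 D D'"
  shows "same_colorings_X D D'"
proof -
  obtain \<sigma> s s' where R3': "triangle_change \<sigma> s s' D D' \<and>
      {strand_crossing \<sigma> s 1 2, strand_crossing \<sigma> s 1 3, strand_crossing \<sigma> s 2 3} \<subseteq> over_under D \<and>
      {strand_crossing \<sigma> s' 1 2, strand_crossing \<sigma> s' 1 3, strand_crossing \<sigma> s' 2 3} \<subseteq> over_under D'"
    using R3[unfolded classical_R3_def] by (elim exE)
  note tchange = R3'[THEN conjunct1]
    and ou = R3'[THEN conjunct2, THEN conjunct1] R3'[THEN conjunct2, THEN conjunct2]
  interpret local_change D D' "[\<sigma> 1, \<sigma> 2, \<sigma> 3]"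
    by (rule triangle_change_local_change[OF D D' tchange])
  from tchange[unfolded triangle_change_def, THEN conjunct2, THEN conjunct1]
  obtain \<kappa> where \<kappa>1: "\<kappa> \<in> {1, -1}" and tri: "triangle \<kappa> \<sigma> s D" "triangle (- \<kappa>) \<sigma> s' D'"
    by (elim bexE conjE) (rule that)
  then have \<kappa>: "\<kappa> \<in> {1, -1}" "- \<kappa> \<in> {1, -1}"
    by auto
  have dir: "strand_direction D' \<sigma> s' 1 2 = strand_direction D \<sigma> s 1 2"
    "strand_direction D' \<sigma> s' 1 3 = strand_direction D \<sigma> s 1 3"
    "strand_direction D' \<sigma> s' 2 3 = strand_direction D \<sigma> s 2 3"
    using tchange[unfolded triangle_change_def, THEN conjunct2, THEN conjunct2] by iprover+
  have C: "local_crossings [\<sigma> 1, \<sigma> 2, \<sigma> 3] D (triangle_crossings \<sigma> s)"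
    by (rule D.local_crossingsI[where V = "{}"])
      (use ou(1) D.triangle_data(1-7)[OF tri(1) \<kappa>(1)] in \<open>auto simp: triangle_crossings_def\<close>)
  have C': "local_crossings [\<sigma> 1, \<sigma> 2, \<sigma> 3] D' (triangle_crossings \<sigma> s')"
    by (rule D'.local_crossingsI[where V = "{}"])
      (use ou(2) D'.triangle_data(1-7)[OF tri(2) \<kappa>(2)] in \<open>auto simp: triangle_crossings_def\<close>)
  note m = D.marked_triangle[OF tri(1) \<kappa>(1) strands_distinct subset_refl]
    and m' = D'.marked_triangle[OF tri(2) \<kappa>(2) strands_distinct subset_refl]
  \<comment> \<open>Lets the same lemma be applied from D' back to D, with - \<kappa> as the initial
    sign.\<close>
  have tri'': "triangle (- (- \<kappa>)) \<sigma> s D"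
    using tri(1) by simp
  show ?thesis
    by (rule same_coloringsI_local[OF C m C' m'
          fits_triangle_move[OF strands_distinct D tri(1) \<kappa>(1) D' tri(2) dir]
          fits_triangle_move[OF strands_distinct D' tri(2) \<kappa>(2) D tri'' dir[symmetric]]
          fits_triangle_unique[OF strands_distinct D tri(1) \<kappa>(1)]
          fits_triangle_unique[OF strands_distinct D' tri(2) \<kappa>(2)]])
qed

text \<open>Strand 1 has a single label. Strands 2 and 3 change label once, at their common
  crossing; the mark of the virtual crossing only decides whether the middle piece carries the old
  or the new label.\<close>

lemma (in biquandle) fits_mixed:
  assumes distinct: "distinct [\<sigma> 1, \<sigma> 2, \<sigma> 3]" and ne: "s 1 2 \<noteq> s 1 3" "s 2 1 \<noteq> s 2 3" "s 3 1 \<noteq> s 3 2"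
  shows "fits_X [\<sigma> 1, \<sigma> 2, \<sigma> 3] E {(\<sigma> 2, s 2 3, \<sigma> 3, s 3 2)} (triangle_marks \<sigma> s) v \<longleftrightarrow>
    (\<exists>x\<in>X. v (\<sigma> 1) = (x, x, x)) \<and>
    (\<exists>b\<in>X. \<exists>b'\<in>X. \<exists>c\<in>X. \<exists>c'\<in>X. v (\<sigma> 2) = (b, if s 2 1 < s 2 3 then b else b', b') \<and>
      v (\<sigma> 3) = (c, if s 3 1 < s 3 2 then c else c', c') \<and>
      crossing (strand_direction E \<sigma> s 2 3) (b, b') (c, c'))"
proof -
  let ?C = "{(\<sigma> 2, s 2 3, \<sigma> 3, s 3 2)}"
  have crossed: "\<not> crossed ?C (\<sigma> 1) t" "crossed ?C (\<sigma> 2) t \<longleftrightarrow> t = s 2 3" "crossed ?C (\<sigma> 3) t \<longleftrightarrow> t = s 3 2" for t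
    using distinct by (auto simp: crossed_insert crossed_empty)
  have marks: "triangle_marks \<sigma> s (\<sigma> 1) = (min (s 1 2) (s 1 3), max (s 1 2) (s 1 3))"
    "triangle_marks \<sigma> s (\<sigma> 2) = (min (s 2 1) (s 2 3), max (s 2 1) (s 2 3))"
    "triangle_marks \<sigma> s (\<sigma> 3) = (min (s 3 1) (s 3 2), max (s 3 1) (s 3 2))"
    using distinct by (auto simp: triangle_marks_def)
  have order: "min (s 2 1) (s 2 3) = s 2 3 \<longleftrightarrow> \<not> s 2 1 < s 2 3" "max (s 2 1) (s 2 3) = s 2 3 \<longleftrightarrow> s 2 1 < s 2 3"
    "min (s 3 1) (s 3 2) = s 3 2 \<longleftrightarrow> \<not> s 3 1 < s 3 2" "max (s 3 1) (s 3 2) = s 3 2 \<longleftrightarrow> s 3 1 < s 3 2"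
    using ne by (auto simp: min_def max_def)
  obtain a a1 a' where a: "v (\<sigma> 1) = (a, a1, a')"
    by (rule prod_cases3)
  obtain b b1 b' where b: "v (\<sigma> 2) = (b, b1, b')"
    by (rule prod_cases3)
  obtain c c1 c' where c: "v (\<sigma> 3) = (c, c1, c')"
    by (rule prod_cases3)
  have fits: "fits_X [\<sigma> 1, \<sigma> 2, \<sigma> 3] E ?C (triangle_marks \<sigma> s) v \<longleftrightarrow>
      a \<in> X \<and> a1 = a \<and> a' = a \<and> {b, b', c, c'} \<subseteq> X \<and>
      b1 = (if s 2 1 < s 2 3 then b else b') \<and> c1 = (if s 3 1 < s 3 2 then c else c') \<and>
      crossing (strand_direction E \<sigma> s 2 3) (b, b') (c, c')"
    unfolding fits_def
    by (simp add: marks crossed order two_step_min_max ne first_pair_def last_pair_def a b c del: One_nat_def) auto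
  show ?thesis
    unfolding fits a b c prod.inject by (auto split del: if_split)
qed

lemma (in biquandle) fits_mixed_move:
  assumes distinct: "distinct [\<sigma> 1, \<sigma> 2, \<sigma> 3]"
    and ne: "s 1 2 \<noteq> s 1 3" "s 2 1 \<noteq> s 2 3" "s 3 1 \<noteq> s 3 2" "s' 1 2 \<noteq> s' 1 3" "s' 2 1 \<noteq> s' 2 3" "s' 3 1 \<noteq> s' 3 2"
    and dir: "strand_direction D' \<sigma> s' 2 3 = strand_direction D \<sigma> s 2 3"
    and v: "fits_X [\<sigma> 1, \<sigma> 2, \<sigma> 3] D {(\<sigma> 2, s 2 3, \<sigma> 3, s 3 2)} (triangle_marks \<sigma> s) v"
  shows "\<exists>v'. fits_X [\<sigma> 1, \<sigma> 2, \<sigma> 3] D' {(\<sigma> 2, s' 2 3, \<sigma> 3, s' 3 2)} (triangle_marks \<sigma> s') v' \<and>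
    same_ends [\<sigma> 1, \<sigma> 2, \<sigma> 3] v v'"
proof -
  obtain x b b' c c' where X: "x \<in> X" "b \<in> X" "b' \<in> X" "c \<in> X" "c' \<in> X"
    and v_eq: "v (\<sigma> 1) = (x, x, x)" "v (\<sigma> 2) = (b, if s 2 1 < s 2 3 then b else b', b')"
      "v (\<sigma> 3) = (c, if s 3 1 < s 3 2 then c else c', c')"
    and rule: "crossing (strand_direction D \<sigma> s 2 3) (b, b') (c, c')"
    using v unfolding fits_mixed[OF distinct ne(1-3)] by (elim conjE bexE) (rule that)
  let ?v = "\<lambda>\<rho>. if \<rho> = \<sigma> 1 then (x, x, x) else if \<rho> = \<sigma> 2 then (b, if s' 2 1 < s' 2 3 then b else b', b')
    else (c, if s' 3 1 < s' 3 2 then c else c', c')"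
  have ev: "?v (\<sigma> 1) = (x, x, x)" "?v (\<sigma> 2) = (b, if s' 2 1 < s' 2 3 then b else b', b')"
    "?v (\<sigma> 3) = (c, if s' 3 1 < s' 3 2 then c else c', c')"
    using distinct by auto
  have "fits_X [\<sigma> 1, \<sigma> 2, \<sigma> 3] D' {(\<sigma> 2, s' 2 3, \<sigma> 3, s' 3 2)} (triangle_marks \<sigma> s') ?v"
    unfolding fits_mixed[OF distinct ne(4-6)] ev dir
    by (intro conjI bexI[OF _ X(1)] bexI[OF _ X(2)] bexI[OF _ X(3)] bexI[OF _ X(4)] bexI[OF _ X(5)] refl rule)
  moreover have "same_ends [\<sigma> 1, \<sigma> 2, \<sigma> 3] v ?v"
    using ev v_eq by (simp add: same_ends_def)
  ultimately show ?thesis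
    by blast
qed

lemma (in biquandle) fits_mixed_unique:
  assumes distinct: "distinct [\<sigma> 1, \<sigma> 2, \<sigma> 3]" and ne: "s 1 2 \<noteq> s 1 3" "s 2 1 \<noteq> s 2 3" "s 3 1 \<noteq> s 3 2"
    and v: "fits_X [\<sigma> 1, \<sigma> 2, \<sigma> 3] D {(\<sigma> 2, s 2 3, \<sigma> 3, s 3 2)} (triangle_marks \<sigma> s) v"
      "fits_X [\<sigma> 1, \<sigma> 2, \<sigma> 3] D {(\<sigma> 2, s 2 3, \<sigma> 3, s 3 2)} (triangle_marks \<sigma> s) v'"
    and ends: "same_ends [\<sigma> 1, \<sigma> 2, \<sigma> 3] v v'"
  shows "\<forall>\<rho>\<in>set [\<sigma> 1, \<sigma> 2, \<sigma> 3]. v' \<rho> = v \<rho>"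
  using v ends unfolding fits_mixed[OF distinct ne] same_ends_def
  by (elim conjE bexE) (simp del: One_nat_def)

lemma (in biquandle) mixed_move_same_colorings:
  assumes D: "is_vdiagram D" and D': "is_vdiagram D'" and mixed: "mixed_move D D'"
  shows "same_colorings_X D D'"
proof -
  obtain \<sigma> s s' where move: "triangle_change \<sigma> s s' D D' \<and>
      strand_crossing \<sigma> s 2 3 \<in> over_under D \<and> strand_crossing \<sigma> s' 2 3 \<in> over_under D' \<and>
      (\<forall>(a, b)\<in>{(1, 2), (1, 3)}.
         \<not> classical_at D (on_strand (\<sigma> a) (s a b)) (on_strand (\<sigma> b) (s b a)) \<and>
         \<not> classical_at D' (on_strand (\<sigma> a) (s' a b)) (on_strand (\<sigma> b) (s' b a)))"
    using mixed[unfolded mixed_move_def] by (elim exE)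
  note tchange = move[THEN conjunct1]
  interpret local_change D D' "[\<sigma> 1, \<sigma> 2, \<sigma> 3]"
    by (rule triangle_change_local_change[OF D D' tchange])
  from tchange[unfolded triangle_change_def, THEN conjunct2, THEN conjunct1]
  obtain \<kappa> where \<kappa>1: "\<kappa> \<in> {1, -1}" and tri: "triangle \<kappa> \<sigma> s D" "triangle (- \<kappa>) \<sigma> s' D'"
    by (elim bexE conjE) (rule that)
  then have \<kappa>: "\<kappa> \<in> {1, -1}" "- \<kappa> \<in> {1, -1}"
    by auto
  have dir: "strand_direction D' \<sigma> s' 2 3 = strand_direction D \<sigma> s 2 3"
    using tchange[unfolded triangle_change_def, THEN conjunct2, THEN conjunct2] by iprover
  let ?C = "{(\<sigma> 2, s 2 3, \<sigma> 3, s 3 2)}" and ?C' = "{(\<sigma> 2, s' 2 3, \<sigma> 3, s' 3 2)}"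
  \<comment> \<open>Of the three double points only that of strands 2 and 3 is classical; the other
    two make up V.\<close>
  have C: "local_crossings [\<sigma> 1, \<sigma> 2, \<sigma> 3] D ?C"
    by (rule D.local_crossingsI[where V = "{strand_crossing \<sigma> s 1 2, strand_crossing \<sigma> s 1 3}"])
      (use move D.triangle_data(1-7)[OF tri(1) \<kappa>(1)] in \<open>auto simp: insert_commute\<close>)
  have C': "local_crossings [\<sigma> 1, \<sigma> 2, \<sigma> 3] D' ?C'"
    by (rule D'.local_crossingsI[where V = "{strand_crossing \<sigma> s' 1 2, strand_crossing \<sigma> s' 1 3}"])
      (use move D'.triangle_data(1-7)[OF tri(2) \<kappa>(2)] in \<open>auto simp: insert_commute\<close>)
  have m: "marked [\<sigma> 1, \<sigma> 2, \<sigma> 3] ?C (triangle_marks \<sigma> s)"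
    by (rule D.marked_triangle[OF tri(1) \<kappa>(1) strands_distinct]) (simp add: triangle_crossings_def)
  have m': "marked [\<sigma> 1, \<sigma> 2, \<sigma> 3] ?C' (triangle_marks \<sigma> s')"
    by (rule D'.marked_triangle[OF tri(2) \<kappa>(2) strands_distinct]) (simp add: triangle_crossings_def)
  note ne = D.triangle_data(8-10)[OF tri(1) \<kappa>(1)] and ne' = D'.triangle_data(8-10)[OF tri(2) \<kappa>(2)]
  show ?thesis
    by (rule same_coloringsI_local[OF C m C' m'
          fits_mixed_move[OF strands_distinct ne ne' dir] fits_mixed_move[OF strands_distinct ne' ne dir[symmetric]]
          fits_mixed_unique[OF strands_distinct ne] fits_mixed_unique[OF strands_distinct ne']])
qed

text \<open>With no classical crossing in the disc, \<open>over_under\<close> is the same set for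
  both diagrams, and all classical crossings keep their directions because they lie outside.\<close>

lemma (in local_change) same_coloringsI_virtual:
  assumes dp: "double_points_on \<sigma>s D \<subseteq> symmetrised V" "double_points_on \<sigma>s D' \<subseteq> symmetrised V'"
    and virtual: "\<And>p q. (p, q) \<in> V \<Longrightarrow> \<not> classical_at D p q" "\<And>p q. (p, q) \<in> V' \<Longrightarrow> \<not> classical_at D' p q"
  shows "same_colorings X under_op over_op D D'"
proof -
  interpret sym: local_change D' D \<sigma>s
    by (rule local_change_sym)
  have "local_crossings \<sigma>s D {}"
    by (rule D.local_crossingsI[where V = V]) (use dp(1) virtual(1) in auto)
  then have empty: "over_under D \<inter> strand_set \<sigma>s \<times> strand_set \<sigma>s = {}"
    by (simp add: local_crossings_def)
  have "local_crossings \<sigma>s D' {}"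
    by (rule D'.local_crossingsI[where V = V']) (use dp(2) virtual(2) in auto)
  then have empty': "over_under D' \<inter> strand_set \<sigma>s \<times> strand_set \<sigma>s = {}"
    by (simp add: local_crossings_def)
  have outside: "p \<notin> strand_set \<sigma>s" if "(p, q) \<in> over_under D" for p q
    using that empty double_point_sides D.over_under_double by blast
  have outside': "p \<notin> strand_set \<sigma>s" if "(p, q) \<in> over_under D'" for p q
    using that empty' sym.double_point_sides D'.over_under_double by blast
  have "(p, q) \<in> over_under D' \<longleftrightarrow> (p, q) \<in> over_under D" for p q
    using over_under_outside(1)[of p q] outside outside' by blast
  then have eq: "over_under D' = over_under D"
    by auto
  show ?thesis
    by (rule same_coloringsI_eq[OF ncircles eq]) (rule crossing_direction_outside[OF _ outside])
qed

lemma virtual_R1_same_colorings: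
  assumes D: "is_vdiagram D" and D': "is_vdiagram D'" and R1: "virtual_R1 D D'"
  shows "same_colorings X under_op over_op D D'"
proof -
  obtain \<sigma> s t where change: "disc_change [\<sigma>] D D'"
    and inner: "s \<in> inner_params \<sigma>" "t \<in> inner_params \<sigma>"
    and dp: "double_points_on [\<sigma>] D = {}"
    and dp': "double_points_on [\<sigma>] D' = symmetrised {(on_strand \<sigma> s, on_strand \<sigma> t)}"
    and virtual: "\<not> classical_at D' (on_strand \<sigma> s) (on_strand \<sigma> t)"
    using R1 unfolding virtual_R1_def curl_def by blast
  interpret local_change D D' "[\<sigma>]"
    by unfold_locales (use D D' change dp in \<open>auto simp: dp' symmetrised_def inner intro!: strand_interiorI\<close>)
  show ?thesis
    by (rule same_coloringsI_virtual[where V = "{}"]) (use virtual in \<open>auto simp: dp dp'\<close>)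
qed

lemma virtual_R2_same_colorings:
  assumes D: "is_vdiagram D" and D': "is_vdiagram D'" and R2: "virtual_R2 D D'"
  shows "same_colorings X under_op over_op D D'"
proof -
  obtain \<sigma> \<tau> s1 s2 t1 t2 where bigon: "bigon \<sigma> \<tau> s1 s2 t1 t2 D D'"
    and virtual: "\<not> classical_at D' (on_strand \<sigma> s1) (on_strand \<tau> t1)" "\<not> classical_at D' (on_strand \<sigma> s2) (on_strand \<tau> t2)"
    using R2 unfolding virtual_R2_def by blast
  have change: "disc_change [\<sigma>, \<tau>] D D'"
    and inner: "s1 \<in> inner_params \<sigma>" "s2 \<in> inner_params \<sigma>" "t1 \<in> inner_params \<tau>" "t2 \<in> inner_params \<tau>"
    and dp: "double_points_on [\<sigma>, \<tau>] D = {}"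
    and dp': "double_points_on [\<sigma>, \<tau>] D' =
       symmetrised {(on_strand \<sigma> s1, on_strand \<tau> t1), (on_strand \<sigma> s2, on_strand \<tau> t2)}"
    using bigon unfolding bigon_def by simp_all
  interpret local_change D D' "[\<sigma>, \<tau>]"
    by unfold_locales (use D D' change dp in \<open>auto simp: dp' symmetrised_def inner intro!: strand_interiorI\<close>)
  show ?thesis
    by (rule same_coloringsI_virtual[where V = "{}"]) (use virtual in \<open>auto simp: dp dp'\<close>)
qed

lemma virtual_R3_same_colorings:
  assumes D: "is_vdiagram D" and D': "is_vdiagram D'" and R3: "virtual_R3 D D'"
  shows "same_colorings X under_op over_op D D'"
proof -
  obtain \<sigma> s s' where move: "triangle_change \<sigma> s s' D D' \<and> (\<forall>(a, b)\<in>{(1, 2), (1, 3), (2, 3)}.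
      \<not> classical_at D (on_strand (\<sigma> a) (s a b)) (on_strand (\<sigma> b) (s b a)) \<and>
      \<not> classical_at D' (on_strand (\<sigma> a) (s' a b)) (on_strand (\<sigma> b) (s' b a)))"
    using R3[unfolded virtual_R3_def] by (elim exE)
  note tchange = move[THEN conjunct1]
  interpret local_change D D' "[\<sigma> 1, \<sigma> 2, \<sigma> 3]"
    by (rule triangle_change_local_change[OF D D' tchange])
  from tchange[unfolded triangle_change_def, THEN conjunct2, THEN conjunct1]
  obtain \<kappa> where \<kappa>1: "\<kappa> \<in> {1, -1}" and tri: "triangle \<kappa> \<sigma> s D" "triangle (- \<kappa>) \<sigma> s' D'"
    by (elim bexE conjE) (rule that)
  then have \<kappa>: "\<kappa> \<in> {1, -1}" "- \<kappa> \<in> {1, -1}"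
    by auto
  show ?thesis
    by (rule same_coloringsI_virtual[OF equalityD1[OF D.triangle_data(7)[OF tri(1) \<kappa>(1)]]
          equalityD1[OF D'.triangle_data(7)[OF tri(2) \<kappa>(2)]]]) (use move in auto)
qed

section \<open>From single moves to virtual equivalence\<close>

lemma (in biquandle) elementary_move_same_colorings:
  assumes "finite X" "elementary_move D D'"
  shows "same_colorings_X D D'"
proof -
  have D: "is_vdiagram D" and D': "is_vdiagram D'"
    using assms(2) by (simp_all add: elementary_move_def)
  from assms(2) consider "planar_isotopic D D'" | "reparametrised D D'" | "classical_R1 D D'" | "classical_R2 D D'"
    | "classical_R3 D D'" | "virtual_R1 D D'" | "virtual_R2 D D'" | "virtual_R3 D D'" | "mixed_move D D'"
    by (auto simp: elementary_move_def)
  then show ?thesis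
    by cases (intro planar_isotopic_same_colorings reparametrised_same_colorings classical_R1_same_colorings
        classical_R2_same_colorings classical_R3_same_colorings virtual_R1_same_colorings
        virtual_R2_same_colorings virtual_R3_same_colorings mixed_move_same_colorings assms(1) D D'; assumption)+
qed

text \<open>Backward steps of the equivalence closure are handled by
  \<open>same_colorings_sym\<close>, and the diagram property it asks for is part of
  \<open>elementary_move\<close>.\<close>

lemma (in biquandle) virtually_equivalent_same_colorings:
  assumes "finite X" "virtually_equivalent D D'"
  shows "same_colorings_X D D'"
  using assms(2) unfolding virtually_equivalent_def
proof (induction rule: equivclp_induct)
  case base
  show ?case
    by (rule same_colorings_refl)
next
  case (step D' D'')
  have "same_colorings_X D' D''"
    using step(2)
  proof
    assume "elementary_move D' D''"
    then show ?thesis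
      by (rule elementary_move_same_colorings[OF assms(1)])
  next
    assume move: "elementary_move D'' D'"
    then have "is_vdiagram D''"
      by (simp add: elementary_move_def)
    then show ?thesis
      by (rule same_colorings_sym) (rule elementary_move_same_colorings[OF assms(1) move])
  qed
  with step(3) show ?case
    by (rule same_colorings_trans)
qed

theorem theorem1p0p1:
  fixes X :: "'a set"
    and under_op over_op :: "'a \<Rightarrow> 'a \<Rightarrow> 'a"
    and S :: "('a \<Rightarrow> 'a) set"
    and N n :: nat
    and L\<^sub>1 L\<^sub>2 :: vdiagram
  assumes "biquandle X under_op over_op"
    and "finite X"
    and "S \<subseteq> biquandle_End X under_op over_op"
    and "N \<ge> 1"
    and "is_vdiagram L\<^sub>1" and "is_vdiagram L\<^sub>2"
    and "virtually_equivalent L\<^sub>1 L\<^sub>2"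
  shows "link_homology N X under_op over_op S L\<^sub>1 n \<cong> link_homology N X under_op over_op S L\<^sub>2 n"
proof -
  have "same_colorings X under_op over_op L\<^sub>1 L\<^sub>2"
    using biquandle.virtually_equivalent_same_colorings[OF assms(1,2,7)] .
  then obtain \<phi> where "quiver_iso \<phi> (coloring_quiver X under_op over_op S L\<^sub>1)
      (coloring_quiver X under_op over_op S L\<^sub>2)"
    by (rule same_colorings_quiver_iso[OF assms(5,6,3)])
  then show ?thesis
    unfolding link_homology_def by (rule clique_homology_iso)
qed

end
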